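(* Let $g\in \mathrm{Diff}^{\omega}_{\alpha}(S^1)$, let $(A_t)_{0\le t<\epsilon}$ be its family of Herman compacts, parametrized so that $\overline{\mathbb D}\cup A_t$ has logarithmic capacity $t$, let $(\phi_t)_{0\le t<\epsilon}$ be the associated Loewner chain, and let $g_t=\Phi_t(g)$. Then for every $t\ge 0$ (in the range $0\le t<\epsilon$) the right-hand derivative $$\chi_t(z)=\frac{d^+}{ds}\Big|_{s=t}(\phi_t^{-1}\circ\phi_s)(z)=\lim_{s\to t^+}\frac{\phi_t^{-1}(\phi_s(z))-z}{s-t}$$ exists, uniformly for $z$ in any compact subset of $\mathbb D_\infty$, and is given by $$\chi_t(z)=z\cdot(\mathcal H\, r^*\mu_{2,g_t})(z),$$ where $\mu_{2,g_t}$ is the unique $2$-conformal measure of $g_t$.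
   Context: $\overline{\mathbb D}$ is the closed unit disk, $\mathbb D_\infty=\hat{\mathbb C}\setminus\overline{\mathbb D}$, $S^1$ is the unit circle, and $\frac{d^+}{dt}$ denotes right-hand derivative. Functions on $\mathbb D_\infty$ of the form $z\cdot H(z)$ with $H$ holomorphic at $\infty$ have a simple pole at $\infty$; uniform convergence of such functions on compact subsets of $\mathbb D_\infty$ is understood on compact subsets of $\mathbb D_\infty\setminus\{\infty\}$ (equivalently, after division by $z$, on compact subsets of $\mathbb D_\infty$). Fix $\alpha\in(\mathbb R\setminus\mathbb Q)/\mathbb Z$. $\mathrm{Diff}^{\omega}_\alpha(S^1)$ is the set of analytic circle diffeomorphisms with rotation number $\alpha$; each such map is identified with its holomorphic extension to a neighbourhood of $S^1$. Herman compacts: for $g\in\mathrm{Diff}^\omega_\alpha(S^1)$, a Herman compact is a connected compact set $A\supset S^1$, totally invariant under $g$, such that $\hat{\mathbb C}\setminus A$ has two components (it is then invariant under reflection in $S^1$). A hull is a connected, full, non-trivial compact $K\subset\mathbb C$ containing $0$; its logarithmic capacity is the real number $c(K)$ such that the conformal map $\phi:\mathbb D_\infty\to\hat{\mathbb C}\setminus K$ with $\phi(\infty)=\infty$, $\phi'(\infty)>0$ satisfies $\phi(z)=e^{c(K)}z+O(1)$ near $\infty$. By a theorem of Perez-Marco, for $\epsilon>0$ small there is a unique, strictly increasing, Hausdorff continuous family $(A_t)_{0\le t<\epsilon}$ of Herman compacts of $g$ with $A_0=S^1$ such that $\overline{\mathbb D}\cup A_t$ has logarithmic capacity $t$. Loewner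 chain and semigroup: let $\Omega_t=\hat{\mathbb C}\setminus(\overline{\mathbb D}\cup A_t)$, let $\phi_t:\mathbb D_\infty\to\Omega_t$ be the conformal map with $\phi_t(\infty)=\infty$ and $\phi_t(z)=e^tz+O(1)$ near $\infty$, and $\psi_t=\phi_t^{-1}$. The family $(\phi_t)$ is the Loewner chain associated to $g$. The map $\psi_t\circ g\circ\psi_t^{-1}$, defined in an annulus in $\mathbb D_\infty$ having $S^1$ as a boundary component, extends analytically across $S^1$ to a circle diffeomorphism $g_t=:\Phi_t(g)\in\mathrm{Diff}^\omega_\alpha(S^1)$ (Perez-Marco). Conformal measures: an $s$-conformal measure for a circle diffeomorphism $g$ is a probability measure $\mu$ on $S^1$ with $\mu(g(E))=\int_E|g'(x)|^s\,d\mu(x)$ for all measurable $E\subset S^1$. For a $C^2$ circle diffeomorphism with irrational rotation number it exists and is unique for each $s\in\mathbb R$ (Douady–Yoccoz); it is denoted $\mu_{s,g}$. $r:S^1\to S^1$ is complex conjugation $r(\xi)=\overline\xi$, and $(r^*\mu)(E)=\mu(r(E))$. The Herglotz transform on $\mathbb D_\infty$ of a probability measure $\mu$ on $S^1$ is $(\mathcal H\mu)(z)=\int_{S^1}\frac{\xi+1/z}{\xi-1/z}\,d\mu(\xi)$. *)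

theory Defs
  imports "HOL-Complex_Analysis.Complex_Analysis" "HOL-Probability.Probability"
begin

section \<open>Analytic circle diffeomorphisms\<close>

definition circle_lift :: "(complex \<Rightarrow> complex) \<Rightarrow> (real \<Rightarrow> real) \<Rightarrow> bool" where
  "circle_lift g G \<longleftrightarrow>
     continuous_on UNIV G \<and> (\<forall>x. G (x + 1) = G x + 1) \<and>
     (\<forall>x. g (cis (2 * pi * x)) = cis (2 * pi * G x))"

text \<open>The rotation number is a class in \<open>\<real>/\<int>\<close>; the real \<open>\<alpha>\<close> is a representative of it.
  Two lifts differ by an integer, so quantifying existentially over the lift amounts to
  working modulo \<open>1\<close>.\<close>

definition has_rotation_number :: "(complex \<Rightarrow> complex) \<Rightarrow> real \<Rightarrow> bool" where
  "has_rotation_number g \<alpha> \<longleftrightarrow>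
     (\<exists>G. circle_lift g G \<and> (\<forall>x. (\<lambda>n. ((G ^^ n) x - x) / real n) \<longlonglongrightarrow> \<alpha>))"

text \<open>A diffeomorphism is represented by any total function that coincides near the unit circle
  with its holomorphic extension; the values far from the circle are irrelevant.\<close>

definition Diff_omega :: "real \<Rightarrow> (complex \<Rightarrow> complex) set" where
  "Diff_omega \<alpha> =
     {g. g analytic_on sphere 0 1 \<and> bij_betw g (sphere 0 1) (sphere 0 1) \<and>
         (\<forall>z\<in>sphere 0 1. deriv g z \<noteq> 0) \<and> has_rotation_number g \<alpha>}"


section \<open>Hulls and logarithmic capacity\<close>

text \<open>The domain \<open>\<D>\<^sub>\<infinity>\<close> without the point \<open>\<infinity>\<close>.\<close>

definition ext_disk :: "complex set" where
  "ext_disk = {z. 1 < norm z}"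

definition is_hull :: "complex set \<Rightarrow> bool" where
  "is_hull K \<longleftrightarrow> compact K \<and> connected K \<and> connected (- K) \<and> 0 \<in> K \<and> (\<exists>x\<in>K. x \<noteq> 0)"

text \<open>The conformal map \<open>\<phi>\<close> from \<open>\<D>\<^sub>\<infinity>\<close> onto the complement of \<open>K\<close> in the Riemann sphere is
  recorded through its restriction to the finite points. The expansion
  \<open>\<phi>(z) = e\<^sup>c z + O(1)\<close> contains \<open>\<phi>(\<infinity>) = \<infinity>\<close> and \<open>\<phi>'(\<infinity>) > 0\<close>.\<close>

definition exterior_map :: "complex set \<Rightarrow> real \<Rightarrow> (complex \<Rightarrow> complex) \<Rightarrow> bool" where
  "exterior_map K c \<phi> \<longleftrightarrow>
     \<phi> holomorphic_on ext_disk \<and> bij_betw \<phi> ext_disk (- K) \<and>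
     (\<lambda>z. \<phi> z - of_real (exp c) * z) \<in> O[at_infinity](\<lambda>_. 1)"

definition log_capacity :: "complex set \<Rightarrow> real" where
  "log_capacity K = (THE c. \<exists>\<phi>. exterior_map K c \<phi>)"


section \<open>Herman compacts\<close>

definition riemann_sphere :: "complex option topology" where
  "riemann_sphere = Alexandroff_compactification euclidean"

text \<open>\<open>U\<close> is the neighbourhood of the unit circle to which \<open>g\<close> has been extended, so that
  \<open>U \<inter> g -` A\<close> is the full preimage of \<open>A\<close>.\<close>

definition herman_compact :: "complex set \<Rightarrow> (complex \<Rightarrow> complex) \<Rightarrow> complex set \<Rightarrow> bool" where
  "herman_compact U g A \<longleftrightarrow>
     compact A \<and> connected A \<and> sphere 0 1 \<subseteq> A \<and> A \<subseteq> U \<and>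
     g ` A = A \<and> U \<inter> g -` A = A \<and>
     card (connected_components_of
       (subtopology riemann_sphere (topspace riemann_sphere - Some ` A))) = 2"

definition hausdorff_dist :: "complex set \<Rightarrow> complex set \<Rightarrow> real" where
  "hausdorff_dist A B = max (SUP x\<in>A. infdist x B) (SUP x\<in>B. infdist x A)"

definition herman_family ::
  "complex set \<Rightarrow> (complex \<Rightarrow> complex) \<Rightarrow> real \<Rightarrow> (real \<Rightarrow> complex set) \<Rightarrow> bool" where
  "herman_family U g \<epsilon> A \<longleftrightarrow>
     (\<forall>t\<in>{0..<\<epsilon>}. herman_compact U g (A t)) \<and>
     strict_mono_on {0..<\<epsilon>} A \<and>
     (\<forall>t\<in>{0..<\<epsilon>}. ((\<lambda>s. hausdorff_dist (A s) (A t)) \<longlongrightarrow> 0) (at t within {0..<\<epsilon>})) \<and>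
     A 0 = sphere 0 1 \<and>
     (\<forall>t\<in>{0..<\<epsilon>}. is_hull (cball 0 1 \<union> A t) \<and> log_capacity (cball 0 1 \<union> A t) = t)"


section \<open>Loewner chain and semigroup\<close>

definition loewner_chain :: "real \<Rightarrow> (real \<Rightarrow> complex set) \<Rightarrow> (real \<Rightarrow> complex \<Rightarrow> complex) \<Rightarrow> bool" where
  "loewner_chain \<epsilon> A \<phi> \<longleftrightarrow> (\<forall>t\<in>{0..<\<epsilon>}. exterior_map (cball 0 1 \<union> A t) t (\<phi> t))"

abbreviation ext_inv :: "(complex \<Rightarrow> complex) \<Rightarrow> complex \<Rightarrow> complex" where
  "ext_inv \<phi> \<equiv> inv_into ext_disk \<phi>"

text \<open>\<open>h\<close> is the analytic circle diffeomorphism (rotation number \<open>\<alpha>\<close>) that extends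
  \<open>\<phi>\<inverse> \<circ> g \<circ> \<phi>\<close> from an annulus \<open>1 < |z| < R\<close> across the circle. Near the circle \<open>h\<close> is uniquely
  determined by this.\<close>

definition semigroup_image ::
  "real \<Rightarrow> complex set \<Rightarrow> (complex \<Rightarrow> complex) \<Rightarrow> (complex \<Rightarrow> complex) \<Rightarrow> (complex \<Rightarrow> complex) \<Rightarrow> bool" where
  "semigroup_image \<alpha> U g \<phi> h \<longleftrightarrow>
     h \<in> Diff_omega \<alpha> \<and>
     (\<exists>R>1. \<forall>z. 1 < norm z \<and> norm z < R \<longrightarrow>
        \<phi> z \<in> U \<and> g (\<phi> z) \<in> \<phi> ` ext_disk \<and> h z = ext_inv \<phi> (g (\<phi> z)))"


section \<open>Conformal measures and the Herglotz transform\<close>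

text \<open>On the circle the modulus of the complex derivative of the extension equals the modulus of
  the derivative along the circle.\<close>

definition is_conformal_measure :: "real \<Rightarrow> (complex \<Rightarrow> complex) \<Rightarrow> complex measure \<Rightarrow> bool" where
  "is_conformal_measure s g \<mu> \<longleftrightarrow>
     prob_space \<mu> \<and> sets \<mu> = sets (restrict_space borel (sphere 0 1)) \<and>
     (\<forall>E\<in>sets \<mu>. emeasure \<mu> (g ` E) = (\<integral>\<^sup>+x\<in>E. ennreal (norm (deriv g x) powr s) \<partial>\<mu>))"

definition conformal_measure :: "real \<Rightarrow> (complex \<Rightarrow> complex) \<Rightarrow> complex measure" where
  "conformal_measure s g = (THE \<mu>. is_conformal_measure s g \<mu>)"

text \<open>The measure \<open>r\<^sup>*\<mu>\<close>. Conjugation is an involution, so image and preimage of a set agree and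
  \<open>r\<^sup>*\<mu>\<close> is a push-forward; see \<open>emeasure_conj_pullback\<close>.\<close>

definition conj_pullback :: "complex measure \<Rightarrow> complex measure" where
  "conj_pullback \<mu> = distr \<mu> \<mu> cnj"

lemma emeasure_conj_pullback:
  assumes "sets \<mu> = sets (restrict_space borel (sphere (0::complex) 1))" "E \<in> sets \<mu>"
  shows "emeasure (conj_pullback \<mu>) E = emeasure \<mu> (cnj ` E)"
proof -
  have sp: "space \<mu> = sphere 0 1"
    using sets_eq_imp_space_eq[OF assms(1)] by (simp add: space_restrict_space)
  have "cnj \<in> measurable (restrict_space borel (sphere 0 1)) (restrict_space borel (sphere 0 1))"
    by (intro measurable_restrict_space2 measurable_restrict_space1 borel_measurable_continuous_onI
        continuous_intros) (auto simp: space_restrict_space)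
  then have m: "cnj \<in> measurable \<mu> \<mu>"
    using measurable_cong_sets[OF assms(1) assms(1)] by simp
  have "cnj -` E \<inter> space \<mu> = cnj ` E"
  proof
    show "cnj -` E \<inter> space \<mu> \<subseteq> cnj ` E"
      by (metis Int_iff complex_cnj_cnj image_eqI subsetI vimage_eq)
    show "cnj ` E \<subseteq> cnj -` E \<inter> space \<mu>"
      using sets.sets_into_space[OF assms(2)] sp by auto
  qed
  then show ?thesis
    unfolding conj_pullback_def using emeasure_distr[OF m assms(2)] by simp
qed

definition herglotz :: "complex measure \<Rightarrow> complex \<Rightarrow> complex" where
  "herglotz \<mu> z = (\<integral>\<xi>. (\<xi> + 1 / z) / (\<xi> - 1 / z) \<partial>\<mu>)"

end

theory Submission
  imports Defs
begin

text \<open>Fix \<open>t\<close> and put \<open>f\<^sub>s = \<phi>\<^sub>t\<^sup>-\<^sup>1 \<circ> \<phi>\<^sub>s\<close> for \<open>s > t\<close>, a conformal map of the outside of the disk into itself with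
  \<open>f\<^sub>s(z) / z \<rightarrow> e\<^sup>s\<^sup>-\<^sup>t\<close> at infinity. By Schwarz's lemma \<open>log (f\<^sub>s(z) / z)\<close> has positive real part, so it is \<open>s - t\<close>
  times the Herglotz transform \<open>P\<^sub>s\<close> of a probability measure \<open>\<nu>\<^sub>s\<close> on the circle (\<open>univalent_outer_herglotz\<close>).
  Probability measures on the circle are weakly compact, so the theorem says that every limit of the \<open>\<nu>\<^sub>s\<close>, as
  \<open>s\<close> decreases to \<open>t\<close>, is the \<open>2\<close>-conformal measure of \<open>G = g\<^sub>t\<close>. Two things have to be shown: a limit is
  \<open>2\<close>-conformal (which also gives existence), and there is at most one \<open>2\<close>-conformal measure.

  A limit \<open>\<mu>\<close> is conformal because of the functional equation \<open>f\<^sub>s \<circ> g\<^sub>s = G \<circ> f\<^sub>s\<close>. Total invariance of the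
  hulls makes \<open>g\<^sub>s\<close> holomorphic in an annulus \<open>1 < |w| < r\<close> with \<open>r\<close> independent of \<open>s\<close>, and \<open>|g\<^sub>s| = 1\<close>
  on the circle. To first order in \<open>s - t\<close> the equation reads
  \<open>log |g\<^sub>s / G| \<approx> (s - t) Re (b P\<^sub>s - P\<^sub>s \<circ> G)\<close> with \<open>b(w) = w G'(w) / G(w)\<close>. The left side is harmonic, vanishes on
  the circle and is \<open>O(s - t)\<close> on a larger circle, hence is \<open>O((s - t) ln |w|)\<close> by the maximum principle.
  In the limit, \<open>Re (b P - P \<circ> G) = O(ln |w|)\<close> near the circle for the transform \<open>P\<close> of \<open>\<mu>\<close>
  (\<open>velocity_boundary_estimate\<close>). Moving \<open>b\<close> and \<open>G\<close> into the kernel changes real parts by \<open>O(ln |w|)\<close>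
  only (\<open>kernel_comparison\<close>), so the measures \<open>|G'| \<mu>\<close> and \<open>G\<^sup>*\<mu> / |G'|\<close> have transforms with
  asymptotically equal real parts, and therefore coincide (\<open>circle_measure_eqI_Re_boundary\<close>). That is
  \<open>G\<^sup>*\<mu> = |G'|\<^sup>2 \<mu>\<close>.

  Uniqueness is the theorem of Douady and Yoccoz. At a closest return time of the rotation, an arc from \<open>x\<close> to its
  return has images that are disjoint for a long time and cover the circle slightly later. Disjointness bounds
  the distortion, so the mass that a conformal measure gives to the arc is known up to a universal factor:
  any two conformal measures are comparable with a universal constant on such arcs, hence on all Borel sets
  because the arcs become small (Denjoy's theorem). Subtracting from one measure a fixed fraction of the other and
  normalising gives a conformal measure again; iterating this exhausts the measure
  (\<open>conformal_measure_unique\<close>).\<close>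

section \<open>Orbits of a lift with irrational rotation number\<close>

locale irrational_lift =
  fixes G :: "real \<Rightarrow> real" and \<alpha> :: real
  assumes cont: "continuous_on UNIV G"
    and mono: "strict_mono G"
    and shift_one: "\<And>x. G (x + 1) = G x + 1"
    and rotation: "\<And>x. (\<lambda>n. ((G ^^ n) x - x) / real n) \<longlonglongrightarrow> \<alpha>"
    and irrational: "\<alpha> \<notin> \<rat>"
begin

lemma shift_nat: "G (x + real n) = G x + real n"
proof (induction n)
  case (Suc n)
  have "G (x + real (Suc n)) = G ((x + real n) + 1)" by (simp add: algebra_simps)
  then show ?case using Suc by (simp add: shift_one)
qed simp

lemma shift_int: "G (x + of_int k) = G x + of_int k"
proof (cases "k \<ge> 0")
  case True
  then show ?thesis using shift_nat[of x "nat k"] by simp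
next
  case False
  then show ?thesis using shift_nat[of "x + of_int k" "nat (-k)"] by simp
qed

lemma iter_shift: "(G ^^ n) (x + of_int k) = (G ^^ n) x + of_int k"
  by (induction n) (simp_all add: shift_int)

lemma iter_strict_mono: "strict_mono (G ^^ n)"
  by (induction n) (use mono in \<open>auto simp: strict_mono_def\<close>)

lemma iter_less_iff: "(G ^^ n) x < (G ^^ n) y \<longleftrightarrow> x < y"
  by (rule strict_mono_less[OF iter_strict_mono])

lemma iter_cont: "continuous_on UNIV (G ^^ n)"
proof (induction n)
  case 0 show ?case by (simp add: continuous_on_id)
next
  case (Suc n)
  then show ?case using continuous_on_compose2[OF cont Suc] by (simp add: o_def)
qed

lemma iter_rotation:
  assumes "0 < d"
  shows "(\<lambda>k. ((G ^^ (d * k)) x - x) / real k) \<longlonglongrightarrow> real d * \<alpha>"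
proof -
  have "filterlim (\<lambda>k. d * k) at_top sequentially"
    using assms by (simp add: filterlim_subseq strict_mono_def)
  from filterlim_compose[OF rotation this]
  have "(\<lambda>k. real d * (((G ^^ (d * k)) x - x) / real (d * k))) \<longlonglongrightarrow> real d * \<alpha>"
    by (intro tendsto_intros)
  then show ?thesis using assms by simp
qed

lemma real_mult_irrational: "0 < d \<Longrightarrow> real d * \<alpha> \<noteq> of_int l"
proof
  assume "0 < d" "real d * \<alpha> = of_int l"
  then have "\<alpha> = of_int l / of_int (int d)" by (simp add: field_simps)
  then show False using irrational by (metis Rats_of_int Rats_divide)
qed

lemma iter_ge:
  assumes "\<And>y. y + of_int l \<le> (G ^^ d) y"
  shows "x + of_int (int k * l) \<le> (G ^^ (d * k)) x"
proof (induction k)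
  case (Suc k)
  have "x + of_int (int (Suc k) * l) = (x + of_int (int k * l)) + of_int l"
    by (simp add: algebra_simps)
  also have "\<dots> \<le> (G ^^ (d * k)) x + of_int l" using Suc by simp
  also have "\<dots> \<le> (G ^^ d) ((G ^^ (d * k)) x)" by (rule assms)
  also have "\<dots> = (G ^^ (d * Suc k)) x" by (simp add: funpow_add)
  finally show ?case .
qed simp

lemma iter_le:
  assumes "\<And>y. (G ^^ d) y \<le> y + of_int l"
  shows "(G ^^ (d * k)) x \<le> x + of_int (int k * l)"
proof (induction k)
  case (Suc k)
  have "(G ^^ (d * Suc k)) x = (G ^^ d) ((G ^^ (d * k)) x)" by (simp add: funpow_add)
  also have "\<dots> \<le> (G ^^ (d * k)) x + of_int l" by (rule assms)
  also have "\<dots> \<le> (x + of_int (int k * l)) + of_int l" using Suc by simp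
  also have "\<dots> = x + of_int (int (Suc k) * l)"
    by (simp add: algebra_simps)
  finally show ?case .
qed simp

lemma rotation_gt:
  assumes "0 < d" "\<And>y. y + of_int l \<le> (G ^^ d) y"
  shows "of_int l < real d * \<alpha>"
proof -
  have "of_int l \<le> real d * \<alpha>"
  proof (rule tendsto_lowerbound[OF iter_rotation[OF assms(1), of 0]])
    show "\<forall>\<^sub>F k in sequentially. of_int l \<le> ((G ^^ (d * k)) 0 - 0) / real k"
      using eventually_gt_at_top[of 0]
    proof eventually_elim
      case (elim k)
      have "real k * of_int l \<le> (G ^^ (d * k)) 0" using iter_ge[OF assms(2), where x=0] by simp
      then show ?case using elim by (simp add: field_simps)
    qed
  qed simp
  then show ?thesis using real_mult_irrational[OF assms(1)] by (metis less_le)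
qed

lemma rotation_lt:
  assumes "0 < d" "\<And>y. (G ^^ d) y \<le> y + of_int l"
  shows "real d * \<alpha> < of_int l"
proof -
  have "real d * \<alpha> \<le> of_int l"
  proof (rule tendsto_upperbound[OF iter_rotation[OF assms(1), of 0]])
    show "\<forall>\<^sub>F k in sequentially. ((G ^^ (d * k)) 0 - 0) / real k \<le> of_int l"
      using eventually_gt_at_top[of 0]
    proof eventually_elim
      case (elim k)
      have "(G ^^ (d * k)) 0 \<le> real k * of_int l" using iter_le[OF assms(2), where x=0] by simp
      then show ?case using elim by (simp add: field_simps)
    qed
  qed simp
  then show ?thesis using real_mult_irrational[OF assms(1)] by (metis less_le)
qed

lemma iter_ne: 
  assumes "0 < d" shows "(G ^^ d) y \<noteq> y + of_int l"
proof
  assume eq: "(G ^^ d) y = y + of_int l"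
  have *: "(G ^^ (d * k)) y = y + of_int (int k * l)" for k
  proof (induction k)
    case (Suc k)
    have "(G ^^ (d * Suc k)) y = (G ^^ d) ((G ^^ (d * k)) y)" by (simp add: funpow_add)
    also have "\<dots> = (G ^^ d) (y + of_int (int k * l))" by (simp only: Suc)
    also have "\<dots> = y + of_int l + of_int (int k * l)" by (simp only: iter_shift eq)
    finally show ?case by (simp add: algebra_simps)
  qed simp
  have "(\<lambda>k. ((G ^^ (d * k)) y - y) / real k) \<longlonglongrightarrow> of_int l"
    by (rule tendsto_eventually, rule eventually_mono[OF eventually_gt_at_top[of 0]]) (simp add: *)
  then have "real d * \<alpha> = of_int l"
    using iter_rotation[OF assms] LIMSEQ_unique by blast
  then show False using real_mult_irrational[OF assms] by blast
qed

lemma iter_sign: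
  assumes "0 < d"
  shows "y + of_int l < (G ^^ d) y \<longleftrightarrow> of_int l < real d * \<alpha>"
proof -
  have c: "continuous_on UNIV (\<lambda>y. (G ^^ d) y - y)"
    by (intro continuous_intros iter_cont)
  have conn: "connected (range (\<lambda>y. (G ^^ d) y - y))"
    by (rule connected_continuous_image[OF c]) simp
  have ne: "(G ^^ d) u - u \<noteq> of_int l" for u using iter_ne[OF assms, of u l] by auto
  consider "\<forall>u. of_int l < (G ^^ d) u - u" | "\<forall>u. (G ^^ d) u - u < of_int l"
  proof (cases "\<exists>u v. (G ^^ d) u - u < of_int l \<and> of_int l < (G ^^ d) v - v")
    case True
    then obtain u v where "(G ^^ d) u - u < of_int l" "of_int l < (G ^^ d) v - v" by blast
    then have "of_int l \<in> range (\<lambda>y. (G ^^ d) y - y)"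
      using connectedD_interval[OF conn, of "(G ^^ d) u - u" "(G ^^ d) v - v" "of_int l"] by auto
    then obtain y where "(G ^^ d) y - y = of_int l" by force
    then show ?thesis using ne by blast
  next
    case False
    then show ?thesis using that ne by (metis linorder_neqE_linordered_idom)
  qed
  then show ?thesis
  proof cases
    case 1
    then have "of_int l < real d * \<alpha>" 
      by (intro rotation_gt[OF assms]) (smt (verit))
    then show ?thesis using 1 by (smt (verit))
  next
    case 2
    then have "real d * \<alpha> < of_int l" 
      by (intro rotation_lt[OF assms]) (smt (verit))
    then show ?thesis using 2 by (smt (verit))
  qed
qed

text \<open>The orbits of the lift, together with all their integer translates, are ordered on the line
  exactly as those of the translation by \<open>\<alpha>\<close>. All the combinatorics of closest returns is
  read off from this.\<close>

lemma orbit_less_iff: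
  "(G ^^ m) x + of_int k < (G ^^ n) x + of_int l \<longleftrightarrow> real m * \<alpha> + of_int k < real n * \<alpha> + of_int l"
proof (cases m n rule: linorder_cases)
  case equal
  then show ?thesis by simp
next
  case less
  define d where "d = n - m"
  have n: "n = d + m" and d: "0 < d" using less by (auto simp: d_def)
  have "(G ^^ m) x + of_int k < (G ^^ n) x + of_int l \<longleftrightarrow> 
    (G ^^ m) x + of_int (k - l) < (G ^^ d) ((G ^^ m) x)"
    by (auto simp: n funpow_add)
  also have "\<dots> \<longleftrightarrow> of_int (k - l) < real d * \<alpha>" by (rule iter_sign[OF d])
  also have "\<dots> \<longleftrightarrow> real m * \<alpha> + of_int k < real n * \<alpha> + of_int l" 
    by (auto simp: n algebra_simps)
  finally show ?thesis .
next
  case greater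
  define d where "d = m - n"
  have m: "m = d + n" and d: "0 < d" using greater by (auto simp: d_def)
  have "(G ^^ m) x + of_int k < (G ^^ n) x + of_int l \<longleftrightarrow> 
    \<not> (G ^^ n) x + of_int (l - k) \<le> (G ^^ d) ((G ^^ n) x)"
    by (auto simp: m funpow_add)
  also have "\<dots> \<longleftrightarrow> \<not> (G ^^ n) x + of_int (l - k) < (G ^^ d) ((G ^^ n) x)"
    using iter_ne[OF d, of "(G ^^ n) x" "l - k"] by linarith
  also have "\<dots> \<longleftrightarrow> \<not> of_int (l - k) < real d * \<alpha>" using iter_sign[OF d] by blast
  also have "\<dots> \<longleftrightarrow> \<not> of_int (l - k) \<le> real d * \<alpha>"
    using real_mult_irrational[OF d, of "l - k"] by linarith
  also have "\<dots> \<longleftrightarrow> real m * \<alpha> + of_int k < real n * \<alpha> + of_int l" 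
    by (auto simp: m algebra_simps)
  finally show ?thesis .
qed

end

subsection \<open>Closest returns of an irrational rotation\<close>

text \<open>Here \<open>q\<close> and \<open>q'\<close> are two consecutive record times of approach of the orbit to its starting point, the first one
  from the right and the second one from the left.\<close>

definition closest_return :: "real \<Rightarrow> nat \<Rightarrow> int \<Rightarrow> nat \<Rightarrow> int \<Rightarrow> bool" where
  "closest_return \<alpha> q p q' p' \<longleftrightarrow>
     0 < q \<and> q \<le> q' \<and> 0 < real q * \<alpha> - of_int p \<and>
     real q' * \<alpha> - of_int p' < 0 \<and> of_int p' - real q' * \<alpha> < real q * \<alpha> - of_int p \<and>
     (\<forall>k l. 0 < k \<and> k < q' \<longrightarrow> real q * \<alpha> - of_int p \<le> \<bar>real k * \<alpha> - of_int l\<bar>)"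

lemma exists_small_return:
  fixes \<alpha> \<delta> :: real assumes "0 < \<delta>"
  shows "\<exists>k>0. \<exists>l. \<bar>real k * \<alpha> - of_int l\<bar> < \<delta>"
proof -
  obtain N :: nat where N: "N > 0" "1 / real N < \<delta>"
    using assms by (metis gr0I nat_approx_posE zero_less_Suc)
  obtain h k where k: "0 < k" "k \<le> int N" "\<bar>of_int k * \<alpha> - of_int h\<bar> < 1 / real N"
    using Dirichlet_approx[OF N(1), of \<alpha>] by metis
  moreover have "real (nat k) = of_int k" using k(1) by simp
  ultimately show ?thesis using N by (intro exI[of _ "nat k"] conjI exI[of _ h]) auto
qed

text \<open>Consecutive records lie on opposite sides: if they were on the same side, the difference of the two times
  would give a record in between.\<close>

lemma closest_return_after:
  fixes \<alpha> :: real and q0 :: nat and p0 :: int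
  assumes irr: "\<alpha> \<notin> \<rat>" and "0 < q0"
    and rec: "\<And>k l. 0 < k \<Longrightarrow> k \<le> N \<Longrightarrow> \<bar>real q0 * \<alpha> - of_int p0\<bar> \<le> \<bar>real k * \<alpha> - of_int l\<bar>"
    and N: "q0 \<le> N"
  obtains q1 p1 where "N < q1" "\<bar>real q1 * \<alpha> - of_int p1\<bar> < \<bar>real q0 * \<alpha> - of_int p0\<bar>"
    "(real q1 * \<alpha> - of_int p1) * (real q0 * \<alpha> - of_int p0) < 0"
    "\<And>k l. 0 < k \<Longrightarrow> k < q1 \<Longrightarrow> \<bar>real q0 * \<alpha> - of_int p0\<bar> \<le> \<bar>real k * \<alpha> - of_int l\<bar>"
    "\<And>k l. 0 < k \<Longrightarrow> k \<le> q1 \<Longrightarrow> \<bar>real q1 * \<alpha> - of_int p1\<bar> \<le> \<bar>real k * \<alpha> - of_int l\<bar>"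
proof -
  define \<theta> where "\<theta> = \<bar>real q0 * \<alpha> - of_int p0\<bar>"
  have nz: "real k * \<alpha> - of_int l \<noteq> 0" if "0 < k" for k l
  proof
    assume "real k * \<alpha> - of_int l = 0"
    then have "\<alpha> = of_int l / of_int (int k)" using that by (simp add: field_simps)
    then show False using irr by (metis Rats_of_int Rats_divide)
  qed
  have \<theta>: "0 < \<theta>" using nz[OF assms(2), of p0] by (simp add: \<theta>_def)
  define q1 where "q1 = (LEAST k. 0 < k \<and> (\<exists>l. \<bar>real k * \<alpha> - of_int l\<bar> < \<theta>))"
  have "0 < q1 \<and> (\<exists>l. \<bar>real q1 * \<alpha> - of_int l\<bar> < \<theta>)"
    unfolding q1_def using exists_small_return[OF \<theta>, of \<alpha>] by (rule LeastI_ex)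
  then obtain l1 where q1: "0 < q1" and l1: "\<bar>real q1 * \<alpha> - of_int l1\<bar> < \<theta>" by blast
  have least: "\<theta> \<le> \<bar>real k * \<alpha> - of_int l\<bar>" if "0 < k" "k < q1" for k l
    using not_less_Least[of k "\<lambda>k. 0 < k \<and> (\<exists>l. \<bar>real k * \<alpha> - of_int l\<bar> < \<theta>)"] that
    unfolding q1_def[symmetric] by (meson not_less)
  have Nq: "N < q1"
  proof (rule ccontr)
    assume "\<not> N < q1"
    then have "\<theta> \<le> \<bar>real q1 * \<alpha> - of_int l1\<bar>" using rec[of q1 l1] q1 by (simp add: \<theta>_def)
    then show False using l1 by simp
  qed
  have opp: "(real q1 * \<alpha> - of_int l1) * (real q0 * \<alpha> - of_int p0) < 0"
  proof (rule ccontr)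
    assume "\<not> ?thesis"
    then have same: "(real q1 * \<alpha> - of_int l1) * (real q0 * \<alpha> - of_int p0) > 0"
      using nz[OF q1, of l1] nz[OF assms(2), of p0] by (simp add: less_le)
    have d: "real (q1 - q0) * \<alpha> - of_int (l1 - p0) = (real q1 * \<alpha> - of_int l1) - (real q0 * \<alpha> - of_int p0)"
      using Nq N by (simp add: of_nat_diff algebra_simps)
    have "\<theta> \<le> \<bar>real (q1 - q0) * \<alpha> - of_int (l1 - p0)\<bar>"
      by (rule least) (use Nq N assms(2) in auto)
    then have "\<theta> \<le> \<bar>(real q1 * \<alpha> - of_int l1) - (real q0 * \<alpha> - of_int p0)\<bar>" unfolding d .
    then show False using same l1 unfolding \<theta>_def zero_less_mult_iff by linarith
  qed
  have best: "\<bar>real q1 * \<alpha> - of_int l1\<bar> \<le> \<bar>real k * \<alpha> - of_int l\<bar>" if "0 < k" "k \<le> q1" for k l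
  proof (cases "k = q1")
    case False
    then show ?thesis using least[of k l] that l1 by simp
  next
    case True
    show ?thesis
    proof (cases "l = l1")
      case False
      have "\<theta> \<le> 1 / 2"
      proof -
        have "\<theta> \<le> \<bar>real 1 * \<alpha> - of_int (round \<alpha>)\<bar>"
          unfolding \<theta>_def by (rule rec) (use N assms(2) in auto)
        also have "\<dots> \<le> 1/2" using of_int_round_abs_le[of \<alpha>] by (simp add: abs_minus_commute)
        finally show ?thesis .
      qed
      moreover have "1 \<le> \<bar>of_int l - of_int l1 :: real\<bar>" using False by linarith
      ultimately show ?thesis using l1 unfolding True by linarith
    qed (use True in simp)
  qed
  show thesis
    by (rule that[OF Nq l1[unfolded \<theta>_def] opp least[unfolded \<theta>_def] best])
qed

lemma closest_return_exists:
  fixes \<alpha> :: real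
  assumes irr: "\<alpha> \<notin> \<rat>"
  shows "\<exists>q p q' p'. N < q' \<and> closest_return \<alpha> q p q' p'"
proof -
  define d where "d = (\<lambda>k::nat. \<bar>real k * \<alpha> - of_int (round (real k * \<alpha>))\<bar>)"
  have dle: "d k \<le> \<bar>real k * \<alpha> - of_int l\<bar>" for k l
    unfolding d_def using round_diff_minimal[of "real k * \<alpha>" l] by (simp add: abs_minus_commute)
  obtain q0 where q0: "q0 \<in> {1..Suc N}" "\<And>k. k \<in> {1..Suc N} \<Longrightarrow> d q0 \<le> d k"
    using arg_min_if_finite[of "{1..Suc N}" d] by (metis atLeastAtMost_iff empty_iff finite_atLeastAtMost le_add1 order_refl plus_1_eq_Suc not_less)
  define p0 where "p0 = round (real q0 * \<alpha>)"
  have q0pos: "0 < q0" and q0N: "q0 \<le> Suc N" using q0(1) by auto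
  have rec0: "\<bar>real q0 * \<alpha> - of_int p0\<bar> \<le> \<bar>real k * \<alpha> - of_int l\<bar>" if "0 < k" "k \<le> Suc N" for k l
    using q0(2)[of k] dle[of k l] that by (auto simp: d_def p0_def)
  obtain q1 p1 where 1: "Suc N < q1" "\<bar>real q1 * \<alpha> - of_int p1\<bar> < \<bar>real q0 * \<alpha> - of_int p0\<bar>"
    "(real q1 * \<alpha> - of_int p1) * (real q0 * \<alpha> - of_int p0) < 0"
    "\<And>k l. 0 < k \<Longrightarrow> k < q1 \<Longrightarrow> \<bar>real q0 * \<alpha> - of_int p0\<bar> \<le> \<bar>real k * \<alpha> - of_int l\<bar>"
    "\<And>k l. 0 < k \<Longrightarrow> k \<le> q1 \<Longrightarrow> \<bar>real q1 * \<alpha> - of_int p1\<bar> \<le> \<bar>real k * \<alpha> - of_int l\<bar>"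
    using closest_return_after[OF irr q0pos rec0 q0N] by metis
  show ?thesis
  proof (cases "0 < real q0 * \<alpha> - of_int p0")
    case True
    then have "closest_return \<alpha> q0 p0 q1 p1"
      unfolding closest_return_def using 1 q0pos q0N 
      by (auto simp: mult_less_0_iff)
    then show ?thesis using 1(1) by (meson Suc_lessD)
  next
    case False
    then have pos: "0 < real q1 * \<alpha> - of_int p1" using 1(3) by (auto simp: mult_less_0_iff)
    have q1pos: "0 < q1" using 1(1) by simp
    obtain q2 p2 where 2: "q1 < q2" "\<bar>real q2 * \<alpha> - of_int p2\<bar> < \<bar>real q1 * \<alpha> - of_int p1\<bar>"
      "(real q2 * \<alpha> - of_int p2) * (real q1 * \<alpha> - of_int p1) < 0"
      "\<And>k l. 0 < k \<Longrightarrow> k < q2 \<Longrightarrow> \<bar>real q1 * \<alpha> - of_int p1\<bar> \<le> \<bar>real k * \<alpha> - of_int l\<bar>"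
      using closest_return_after[OF irr q1pos 1(5) order_refl] by metis
    have "closest_return \<alpha> q1 p1 q2 p2"
      unfolding closest_return_def using 2 q1pos pos
      by (auto simp: mult_less_0_iff)
    then show ?thesis using 1(1) 2(1) by (intro exI[of _ q1] exI[of _ p1] exI[of _ q2] exI[of _ p2]) auto
  qed
qed

section \<open>Arcs and measures on the circle\<close>

abbreviation turn :: "real \<Rightarrow> complex" where
  "turn x \<equiv> cis (2 * pi * x)"

abbreviation circle_borel :: "complex measure" where
  "circle_borel \<equiv> restrict_space borel (sphere 0 1)"

text \<open>Half-open arcs, so that adjacent arcs tile and the masses of arcs can be compared with distribution
  functions.\<close>

definition circle_arc :: "real \<Rightarrow> real \<Rightarrow> complex set" where
  "circle_arc a b = turn ` {a<..b}"

lemma turn_eq_iff: "turn x = turn y \<longleftrightarrow> (\<exists>k::int. x = y + of_int k)"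
proof -
  have "turn x = turn y \<longleftrightarrow> exp (\<i> * of_real (2 * pi * x)) = exp (\<i> * of_real (2 * pi * y))"
    by (simp add: cis_conv_exp)
  also have "\<dots> \<longleftrightarrow> (\<exists>k::int. \<i> * of_real (2 * pi * x) = \<i> * of_real (2 * pi * y) + (of_int (2 * k) * pi) * \<i>)"
    by (simp add: exp_eq)
  also have "\<dots> \<longleftrightarrow> (\<exists>k::int. x = y + of_int k)"
  proof (intro ex_cong1)
    fix k :: int
    have "\<i> * of_real (2 * pi * y) + (of_int (2 * k) * pi) * \<i> = \<i> * of_real (2 * pi * (y + of_int k))"
      by (simp add: algebra_simps)
    then show "(\<i> * of_real (2 * pi * x) = \<i> * of_real (2 * pi * y) + (of_int (2 * k) * pi) * \<i>) \<longleftrightarrow> x = y + of_int k"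
      by (simp only: mult_cancel_left of_real_eq_iff) simp
  qed
  finally show ?thesis .
qed

lemma turn_shift [simp]: "turn (x + of_int k) = turn x"
  using turn_eq_iff by blast

lemma turn_surj:
  assumes "\<xi> \<in> sphere 0 1" obtains x where "0 < x" "x \<le> 1" "\<xi> = turn x"
proof -
  have n: "norm \<xi> = 1" using assms by simp
  have *: "\<xi> = cis (Arg2pi \<xi>)" using Arg2pi_eq[of \<xi>] n by (simp add: cis_conv_exp)
  show thesis
  proof (cases "Arg2pi \<xi> = 0")
    case True
    then show ?thesis using that[of 1] * by simp
  next
    case False
    then have "0 < Arg2pi \<xi>" "Arg2pi \<xi> < 2 * pi" using Arg2pi[of \<xi>] by (auto simp: less_le)
    then show ?thesis using that[of "Arg2pi \<xi> / (2 * pi)"] * by (simp add: field_simps)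
  qed
qed

lemma continuous_turn: "continuous_on A turn"
  by (auto simp: cis_conv_exp intro!: continuous_intros)

lemma arc_mem_iff: "turn u \<in> circle_arc a b \<longleftrightarrow> (\<exists>k::int. a < u + of_int k \<and> u + of_int k \<le> b)"
proof
  assume "turn u \<in> circle_arc a b"
  then obtain v where "v \<in> {a<..b}" "turn v = turn u" unfolding circle_arc_def by force
  then show "\<exists>k::int. a < u + of_int k \<and> u + of_int k \<le> b" 
    unfolding turn_eq_iff by auto
next
  assume "\<exists>k::int. a < u + of_int k \<and> u + of_int k \<le> b"
  then obtain k :: int where "u + of_int k \<in> {a<..b}" by auto
  then show "turn u \<in> circle_arc a b" unfolding circle_arc_def using turn_shift[of u k] by (metis imageI)
qed

lemma arc_subset: "circle_arc a b \<subseteq> sphere 0 1" by (auto simp: circle_arc_def)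

lemma arc_shift: "circle_arc (a + of_int k) (b + of_int k) = circle_arc a b"
proof -
  have "{a + of_int k<..b + of_int k} = (\<lambda>x. x + of_int k) ` {a<..b}"
  proof (intro set_eqI iffI)
    fix x assume "x \<in> {a + of_int k<..b + of_int k}"
    then show "x \<in> (\<lambda>x. x + of_int k) ` {a<..b}"
      by (intro image_eqI[of x _ "x - of_int k"]) auto
  qed auto
  then show ?thesis unfolding circle_arc_def by (simp only: image_image turn_shift)
qed

lemma arc_full: "circle_arc a (a + 1) = sphere 0 1"
proof
  show "sphere 0 1 \<subseteq> circle_arc a (a + 1)"
  proof
    fix \<xi> :: complex assume "\<xi> \<in> sphere 0 1"
    then obtain x where x: "\<xi> = turn x" by (rule turn_surj)
    have "a < x + of_int (- \<lceil>x - a\<rceil> + 1) \<and> x + of_int (- \<lceil>x - a\<rceil> + 1) \<le> a + 1" by linarith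
    then show "\<xi> \<in> circle_arc a (a + 1)" unfolding x arc_mem_iff by blast
  qed
qed (rule arc_subset)

lemma arc_mono: "a' \<le> a \<Longrightarrow> b \<le> b' \<Longrightarrow> circle_arc a b \<subseteq> circle_arc a' b'"
  by (auto simp: circle_arc_def)

lemma arc_split: "a \<le> b \<Longrightarrow> b \<le> c \<Longrightarrow> circle_arc a c = circle_arc a b \<union> circle_arc b c"
  by (simp add: circle_arc_def image_Un[symmetric] ivl_disj_un_two(6))

lemma arc_disjoint: "a \<le> b \<Longrightarrow> b \<le> c \<Longrightarrow> c \<le> a + 1 \<Longrightarrow> circle_arc a b \<inter> circle_arc b c = {}"
proof (rule ccontr)
  assume *: "a \<le> b" "b \<le> c" "c \<le> a + 1" "circle_arc a b \<inter> circle_arc b c \<noteq> {}"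
  then obtain u where "turn u \<in> circle_arc a b" "turn u \<in> circle_arc b c" by (auto simp: circle_arc_def)
  then obtain k l :: int where "a < u + of_int k" "u + of_int k \<le> b" "b < u + of_int l" "u + of_int l \<le> c"
    unfolding arc_mem_iff by blast
  then have "0 < (of_int (l - k) :: real)" "(of_int (l - k) :: real) < 1" using * by auto
  then show False by (simp only: of_int_0_less_iff of_int_less_1_iff)
qed

lemma sets_circle_iff: "E \<in> sets circle_borel \<longleftrightarrow> E \<in> sets borel \<and> E \<subseteq> sphere 0 1"
  by (subst sets_restrict_space_iff) auto

lemma arc_sets: "circle_arc a b \<in> sets circle_borel"
proof -
  have "{a<..b} = (\<Union>n. {a + 1 / real (Suc n)..b})"
  proof (intro set_eqI iffI)
    fix x assume x: "x \<in> {a<..b}"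
    then obtain n where "inverse (real (Suc n)) < x - a" using reals_Archimedean[of "x - a"] by auto
    then have "x \<in> {a + 1 / real (Suc n)..b}" using x by (simp add: inverse_eq_divide)
    then show "x \<in> (\<Union>n. {a + 1 / real (Suc n)..b})" by blast
  next
    fix x assume "x \<in> (\<Union>n. {a + 1 / real (Suc n)..b})"
    then obtain n where "a + 1 / real (Suc n) \<le> x" "x \<le> b" by auto
    moreover have "0 < 1 / real (Suc n)" by simp
    ultimately show "x \<in> {a<..b}" unfolding greaterThanAtMost_iff by linarith
  qed
  then have "circle_arc a b = (\<Union>n. turn ` {a + 1 / real (Suc n)..b})"
    unfolding circle_arc_def by (simp add: image_UN)
  moreover have "turn ` {a + 1 / real (Suc n)..b} \<in> sets borel" for n
    by (intro borel_compact compact_continuous_image continuous_turn) simp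
  ultimately show ?thesis unfolding sets_circle_iff using arc_subset by auto
qed

lemma space_circle: "sets M = sets circle_borel \<Longrightarrow> space M = sphere 0 1"
  by (drule sets_eq_imp_space_eq) (simp add: space_restrict_space)

lemma turn_measurable: "turn \<in> measurable borel circle_borel"
  by (intro measurable_restrict_space2 borel_measurable_continuous_onI continuous_turn) auto

text \<open>Arc length is used to bound the total length of disjoint arcs by \<open>1\<close>, in the same way as the mass of
  conformal measures is bounded.\<close>

definition circle_length :: "complex measure" where
  "circle_length = distr (uniform_measure lborel {0<..1}) circle_borel turn"

lemma circle_length_sets: "sets circle_length = sets circle_borel"
  by (simp add: circle_length_def)

lemma prob_space_circle_length: "prob_space circle_length"
proof -
  interpret prob_space "uniform_measure lborel {0<..1::real}" 
    by (rule prob_space_uniform_measure) auto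
  show ?thesis unfolding circle_length_def
    by (rule prob_space_distr) (use turn_measurable in simp)
qed

lemma measure_circle_length_arc:
  assumes "a \<le> b" "b \<le> a + 1"
  shows "measure circle_length (circle_arc a b) = b - a"
proof -
  have tm: "turn \<in> measurable (uniform_measure lborel {0<..1}) circle_borel"
    using turn_measurable by simp
  define m where "m = \<lfloor>a\<rfloor>"
  define a' where "a' = a - of_int m"
  define b' where "b' = b - of_int m"
  have a': "0 \<le> a'" "a' < 1" unfolding a'_def m_def by linarith+
  have b': "a' \<le> b'" "b' \<le> a' + 1" using assms by (auto simp: a'_def b'_def)
  have arc: "circle_arc a b = circle_arc a' b'" using arc_shift[of a' m b'] by (simp add: a'_def b'_def)
  have "{0<..1} \<inter> turn -` circle_arc a b = {a'<..min b' 1} \<union> {0<..b' - 1}"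
  proof (intro set_eqI iffI)
    fix x assume "x \<in> {0<..1} \<inter> turn -` circle_arc a b"
    then obtain k :: int where k: "0 < x" "x \<le> 1" "a' < x + of_int k" "x + of_int k \<le> b'"
      unfolding arc using arc_mem_iff by auto
    then have "-1 < (of_int k :: real)" "(of_int k :: real) < 2" using a' b' by linarith+
    then have "k = 0 \<or> k = 1" by auto
    then show "x \<in> {a'<..min b' 1} \<union> {0<..b' - 1}" using k by auto
  next
    fix x assume x: "x \<in> {a'<..min b' 1} \<union> {0<..b' - 1}"
    then have "0 < x" "x \<le> 1" using a' b' by auto
    moreover have "\<exists>k::int. a' < x + of_int k \<and> x + of_int k \<le> b'"
      using x a' b' by (auto intro: exI[of _ 0] exI[of _ 1])
    ultimately show "x \<in> {0<..1} \<inter> turn -` circle_arc a b" unfolding arc using arc_mem_iff by auto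
  qed
  moreover have "measure circle_length (circle_arc a b) = measure lborel ({0<..1} \<inter> turn -` circle_arc a b)"
  proof -
    have "turn -` circle_arc a b \<in> sets borel"
      using measurable_sets[OF turn_measurable arc_sets, of a b] by simp
    then show ?thesis
    unfolding circle_length_def
    by (simp add: measure_distr[OF tm arc_sets] measure_uniform_measure)
  qed
  moreover have "measure lborel ({a'<..min b' 1} \<union> {0<..b' - 1}) 
      = measure lborel {a'<..min b' 1} + measure lborel {0<..b' - 1}"
  proof -
    have "{u<..v::real} \<in> fmeasurable lborel" for u v by (cases "u \<le> v") (auto simp: fmeasurable_def)
    then show ?thesis by (subst measure_Un3) (use a' b' in auto)
  qed
  moreover have "\<dots> = b - a" using a' b' by (auto simp: min_def a'_def b'_def)
  ultimately show ?thesis by simp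
qed

section \<open>Closest returns, bounded distortion and small intervals\<close>

text \<open>The last assumption is Lipschitz continuity of \<open>ln w\<close> in multiplicative form.\<close>

locale lifted_diffeo = irrational_lift G \<alpha> for G \<alpha> +
  fixes g :: "complex \<Rightarrow> complex" and w :: "real \<Rightarrow> real" and L :: real
  assumes g_cont: "continuous_on (sphere 0 1) g"
    and g_bij: "bij_betw g (sphere 0 1) (sphere 0 1)"
    and deriv_cont: "continuous_on (sphere 0 1) (deriv g)"
    and semiconj: "\<And>x. g (turn x) = turn (G x)"
    and w_pos: "\<And>x. 0 < w x"
    and deriv_G: "\<And>x. (G has_real_derivative w x) (at x)"
    and speed: "\<And>x. norm (deriv g (turn x)) = w x"
    and L_nonneg: "0 \<le> L"
    and w_lipschitz: "\<And>x y. w x \<le> exp (L * \<bar>x - y\<bar>) * w y"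
begin

lemma iter_le_iff: "(G ^^ n) x \<le> (G ^^ n) y \<longleftrightarrow> x \<le> y"
  using iter_less_iff[of n y x] by linarith

lemma image_Ioc: "G ` {a<..b} = {G a<..G b}"
proof
  show "G ` {a<..b} \<subseteq> {G a<..G b}"
    using mono by (auto simp: strict_mono_less strict_mono_less_eq)
  show "{G a<..G b} \<subseteq> G ` {a<..b}"
  proof
    fix y assume y: "y \<in> {G a<..G b}"
    then have "G a < G b" by simp
    then have "a \<le> b" using strict_mono_less[OF mono] by simp
    then obtain x where x: "a \<le> x" "x \<le> b" "G x = y"
      using IVT'[of G a y b] y continuous_on_subset[OF cont] by auto
    moreover have "x \<noteq> a" using x y by auto
    ultimately show "y \<in> G ` {a<..b}" by force
  qed
qed

lemma image_arc: "g ` circle_arc a b = circle_arc (G a) (G b)"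
  unfolding circle_arc_def image_image image_Ioc[symmetric] by (simp add: semiconj)

definition ret :: "nat \<Rightarrow> int \<Rightarrow> real \<Rightarrow> real" where
  "ret q p x = (G ^^ q) x - of_int p"

lemma iter_ret: "(G ^^ n) (ret q p x) = (G ^^ (n + q)) x - of_int p"
  using iter_shift[of n "(G ^^ q) x" "- p"] by (simp add: ret_def funpow_add)

lemma ret_iter: "ret q p ((G ^^ n) x) = (G ^^ n) (ret q p x)"
  using funpow_add[of q n G] by (simp add: iter_ret) (simp add: ret_def add.commute funpow_add)

text \<open>The combinatorial fact behind disjointness: two arcs of a closest return that meet would produce
  a return closer than the closest one.\<close>

lemma return_arcs_disjoint:
  assumes cr: "closest_return \<alpha> q p q' p'" and "i < j" "j - i < q'"
  shows "circle_arc ((G ^^ i) x) ((G ^^ i) (ret q p x)) \<inter> circle_arc ((G ^^ j) x) ((G ^^ j) (ret q p x)) = {}"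
proof (rule ccontr)
  assume "\<not> ?thesis"
  then obtain \<xi> where "\<xi> \<in> circle_arc ((G ^^ i) x) ((G ^^ i) (ret q p x))" "\<xi> \<in> circle_arc ((G ^^ j) x) ((G ^^ j) (ret q p x))"
    by blast
  moreover from this have "\<xi> \<in> sphere 0 1" using arc_subset by blast
  then obtain u where "\<xi> = turn u" by (rule turn_surj)
  ultimately have "turn u \<in> circle_arc ((G ^^ i) x) ((G ^^ i) (ret q p x))" 
      "turn u \<in> circle_arc ((G ^^ j) x) ((G ^^ j) (ret q p x))"
    by auto
  then obtain k l :: int where 
    k: "(G ^^ i) x < u + of_int k" "u + of_int k \<le> (G ^^ (i + q)) x - of_int p" and
    l: "(G ^^ j) x < u + of_int l" "u + of_int l \<le> (G ^^ (j + q)) x - of_int p"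
    unfolding arc_mem_iff iter_ret by blast
  have "(G ^^ i) x + of_int (l - k) < (G ^^ (j + q)) x + of_int (- p)" using k l by simp
  then have 1: "real i * \<alpha> + of_int (l - k) < real (j + q) * \<alpha> + of_int (- p)"
    unfolding orbit_less_iff .
  have "(G ^^ j) x + of_int (k - l) < (G ^^ (i + q)) x + of_int (- p)" using k l by simp
  then have 2: "real j * \<alpha> + of_int (k - l) < real (i + q) * \<alpha> + of_int (- p)"
    unfolding orbit_less_iff .
  have j: "real (j - i) * \<alpha> = real j * \<alpha> - real i * \<alpha>" using assms by (simp add: of_nat_diff algebra_simps)
  have "\<bar>real (j - i) * \<alpha> - of_int (l - k)\<bar> < real q * \<alpha> - of_int p"
    unfolding j using 1 2 by (simp add: algebra_simps abs_less_iff)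
  moreover have "real q * \<alpha> - of_int p \<le> \<bar>real (j - i) * \<alpha> - of_int (l - k)\<bar>"
    using cr assms unfolding closest_return_def by (metis zero_less_diff)
  ultimately show False by simp
qed

text \<open>The combinatorial fact behind covering: from any of the first \<open>q + q'\<close> points of an orbit one reaches
  another such point to the right, within one return arc, by adding \<open>q\<close> or subtracting
  \<open>q'\<close>.\<close>

lemma return_arcs_cover:
  assumes cr: "closest_return \<alpha> q p q' p'"
  shows "(\<Union>j<q + q'. circle_arc ((G ^^ j) x) ((G ^^ j) (ret q p x))) = sphere 0 1"
proof
  show "(\<Union>j<q + q'. circle_arc ((G ^^ j) x) ((G ^^ j) (ret q p x))) \<subseteq> sphere 0 1" using arc_subset by blast
  show "sphere 0 1 \<subseteq> (\<Union>j<q + q'. circle_arc ((G ^^ j) x) ((G ^^ j) (ret q p x)))"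
  proof
    fix \<xi> :: complex assume "\<xi> \<in> sphere 0 1"
    then obtain u where u: "\<xi> = turn u" by (rule turn_surj)
    define k where "k = (\<lambda>j. \<lceil>u - (G ^^ j) x\<rceil> - 1)"
    define v where "v = (\<lambda>j. (G ^^ j) x + of_int (k j))"
    have v: "v j < u" for j unfolding v_def k_def by linarith
    have vmax: "(G ^^ j) x + of_int l \<le> v j" if "(G ^^ j) x + of_int l < u" for j l
    proof -
      have "of_int l < u - (G ^^ j) x" using that by simp
      then have "l \<le> k j" unfolding k_def by linarith
      then show ?thesis unfolding v_def by simp
    qed
    have qs: "0 < q" "q \<le> q'" using cr by (auto simp: closest_return_def)
    obtain j where j: "j < q + q'" and jmax: "\<And>i. i < q + q' \<Longrightarrow> v i \<le> v j"
    proof -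
      have fin: "finite (v ` {..<q + q'})" "v ` {..<q + q'} \<noteq> {}" using qs by auto
      then obtain j where "j < q + q'" "v j = Max (v ` {..<q + q'})" using Max_in[OF fin] by force
      then show ?thesis using that fin by (metis Max_ge imageI lessThan_iff)
    qed
    have "u \<le> (G ^^ (j + q)) x - of_int p + of_int (k j)"
    proof (rule ccontr)
      assume "\<not> ?thesis"
      then have less: "(G ^^ (j + q)) x + of_int (k j - p) < u" by simp
      have cr': "0 < real q * \<alpha> - of_int p" "real q' * \<alpha> - of_int p' < 0"
        "of_int p' - real q' * \<alpha> < real q * \<alpha> - of_int p"
        using cr by (auto simp: closest_return_def)
      show False
      proof (cases "j < q'")
        case True
        have "v j < (G ^^ (j + q)) x + of_int (k j - p)"
          unfolding v_def orbit_less_iff using cr' by (simp add: algebra_simps)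
        also have "\<dots> \<le> v (j + q)" by (rule vmax[OF less])
        also have "\<dots> \<le> v j" using jmax[of "j + q"] True by simp
        finally show False by simp
      next
        case False
        then have jq: "real (j - q') * \<alpha> = real j * \<alpha> - real q' * \<alpha>" by (simp add: of_nat_diff algebra_simps)
        have "(G ^^ (j - q')) x + of_int (p' + k j) < (G ^^ (j + q)) x + of_int (k j - p)"
          unfolding orbit_less_iff jq using cr' by (simp add: algebra_simps)
        then have less': "(G ^^ (j - q')) x + of_int (p' + k j) < u" using less by simp
        have "v j < (G ^^ (j - q')) x + of_int (p' + k j)"
          unfolding v_def orbit_less_iff jq using cr' by (simp add: algebra_simps)
        also have "\<dots> \<le> v (j - q')" by (rule vmax[OF less'])
        also have "\<dots> \<le> v j" using jmax[of "j - q'"] j by simp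
        finally show False by simp
      qed
    qed
    then have "(G ^^ j) x < u + of_int (- k j) \<and> u + of_int (- k j) \<le> (G ^^ j) (ret q p x)"
      using v[of j] unfolding v_def iter_ret by simp
    then have "\<xi> \<in> circle_arc ((G ^^ j) x) ((G ^^ j) (ret q p x))" unfolding u arc_mem_iff by blast
    then show "\<xi> \<in> (\<Union>j<q + q'. circle_arc ((G ^^ j) x) ((G ^^ j) (ret q p x)))" using j by blast
  qed
qed

lemma ret_bounds:
  assumes cr: "closest_return \<alpha> q p q' p'" and "1 < q'"
  shows "x < ret q p x" "ret q p x < x + 1"
proof -
  have c: "0 < real q * \<alpha> - of_int p" "real q * \<alpha> - of_int p \<le> \<bar>real 1 * \<alpha> - of_int (round \<alpha>)\<bar>"
    using cr assms(2) unfolding closest_return_def by blast+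
  have "\<bar>real 1 * \<alpha> - of_int (round \<alpha>)\<bar> \<le> 1/2"
    using of_int_round_abs_le[of \<alpha>] by (simp add: abs_minus_commute)
  then have 1: "real q * \<alpha> - of_int p < 1" using c by simp
  have "(G ^^ 0) x + of_int p < (G ^^ q) x + of_int 0" unfolding orbit_less_iff using c by simp
  then show "x < ret q p x" by (simp add: ret_def)
  have "(G ^^ q) x + of_int 0 < (G ^^ 0) x + of_int (1 + p)" unfolding orbit_less_iff using 1 by simp
  then show "ret q p x < x + 1" by (simp add: ret_def)
qed

lemma measure_return_arcs_le:
  assumes cr: "closest_return \<alpha> q p q' p'" and M: "prob_space M" "sets M = sets circle_borel"
  shows "(\<Sum>j\<in>{m..<m + k * q'}. measure M (circle_arc ((G ^^ j) x) ((G ^^ j) (ret q p x)))) \<le> real k"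
proof (induction k)
  case (Suc k)
  interpret prob_space M by fact
  let ?A = "\<lambda>j. circle_arc ((G ^^ j) x) ((G ^^ j) (ret q p x))"
  let ?I = "{m + k * q'..<m + Suc k * q'}"
  have "disjoint_family_on ?A ?I"
    unfolding disjoint_family_on_def
  proof (intro ballI impI)
    fix i j assume *: "i \<in> ?I" "j \<in> ?I" "i \<noteq> j"
    then have d: "j - i < q'" "i - j < q'" by auto
    show "?A i \<inter> ?A j = {}"
    proof (cases "i < j")
      case True
      then show ?thesis by (rule return_arcs_disjoint[OF cr _ d(1)])
    next
      case False
      then have "j < i" using * by simp
      then show ?thesis using return_arcs_disjoint[OF cr _ d(2), of x] by (simp add: Int_commute)
    qed
  qed
  then have "(\<Sum>j\<in>?I. measure M (?A j)) = measure M (\<Union>j\<in>?I. ?A j)"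
    by (intro finite_measure_finite_Union[symmetric]) (use M arc_sets in auto)
  also have "\<dots> \<le> 1" by (rule prob_le_1)
  finally have 1: "(\<Sum>j\<in>?I. measure M (?A j)) \<le> 1" .
  have "{m..<m + Suc k * q'} = {m..<m + k * q'} \<union> ?I" by auto
  then have "(\<Sum>j\<in>{m..<m + Suc k * q'}. measure M (?A j)) 
      = (\<Sum>j\<in>{m..<m + k * q'}. measure M (?A j)) + (\<Sum>j\<in>?I. measure M (?A j))"
    by (simp only:) (rule sum.union_disjoint, auto)
  then show ?case using 1 Suc by simp
qed simp

lemma measure_return_arcs_ge:
  assumes cr: "closest_return \<alpha> q p q' p'" and M: "prob_space M" "sets M = sets circle_borel"
  shows "1 \<le> (\<Sum>j\<in>{m..<m + (q + q')}. measure M (circle_arc ((G ^^ j) x) ((G ^^ j) (ret q p x))))"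
proof -
  interpret prob_space M by fact
  let ?A = "\<lambda>j. circle_arc ((G ^^ j) x) ((G ^^ j) (ret q p x))"
  have "(\<Union>j\<in>{m..<m + (q + q')}. ?A j) = (\<Union>j<q + q'. circle_arc ((G ^^ j) ((G ^^ m) x)) ((G ^^ j) (ret q p ((G ^^ m) x))))"
  proof -
    have "{m..<m + (q + q')} = (\<lambda>j. j + m) ` {..<q + q'}"
      unfolding lessThan_atLeast0 by (simp add: add.commute)
    then show ?thesis by (simp add: ret_iter funpow_add)
  qed
  also have "\<dots> = space M" using return_arcs_cover[OF cr] space_circle[OF M(2)] by simp
  finally have "1 = measure M (\<Union>j\<in>{m..<m + (q + q')}. ?A j)" using prob_space by simp
  also have "\<dots> \<le> (\<Sum>j\<in>{m..<m + (q + q')}. measure M (?A j))"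
    by (rule finite_measure_subadditive_finite) (use M arc_sets in auto)
  finally show ?thesis .
qed

lemma sum_return_lengths:
  assumes cr: "closest_return \<alpha> q p q' p'" and "1 < q'" and "n \<le> m + k * q'"
  shows "(\<Sum>j\<in>{m..<n}. (G ^^ j) (ret q p x) - (G ^^ j) x) \<le> real k"
proof -
  have "(G ^^ j) x \<le> (G ^^ j) (ret q p x)" "(G ^^ j) (ret q p x) \<le> (G ^^ j) x + 1" for j
    using ret_bounds[OF cr assms(2), of "(G ^^ j) x"] unfolding ret_iter by auto
  then have "(\<Sum>j\<in>{m..<n}. (G ^^ j) (ret q p x) - (G ^^ j) x) = 
      (\<Sum>j\<in>{m..<n}. measure circle_length (circle_arc ((G ^^ j) x) ((G ^^ j) (ret q p x))))"
    by (simp add: measure_circle_length_arc)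
  also have "\<dots> \<le> (\<Sum>j\<in>{m..<m + k * q'}. measure circle_length (circle_arc ((G ^^ j) x) ((G ^^ j) (ret q p x))))"
    by (rule sum_mono2) (use assms(3) in auto)
  also have "\<dots> \<le> real k"
    by (rule measure_return_arcs_le[OF cr prob_space_circle_length circle_length_sets])
  finally show ?thesis .
qed

subsection \<open>Bounded distortion\<close>

lemma G_mvt:
  assumes "a \<le> b" obtains z where "a \<le> z" "z \<le> b" "G b - G a = (b - a) * w z"
proof (cases "a = b")
  case False
  then have "a < b" using assms by simp
  from MVT2[OF this, of G w] deriv_G obtain z where "a < z" "z < b" "G b - G a = (b - a) * w z" by blast
  then show ?thesis using that[of z] by simp
qed (use that[of a] in auto)

lemma w_near:
  assumes "x \<le> z" "z \<le> y"
  shows "w z \<le> w x * exp (L * (y - x))" "w x * exp (- (L * (y - x))) \<le> w z"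
proof -
  have e: "exp (L * \<bar>z - x\<bar>) \<le> exp (L * (y - x))"
    using assms L_nonneg by (simp add: mult_left_mono)
  have "w z \<le> exp (L * \<bar>z - x\<bar>) * w x" by (rule w_lipschitz)
  also have "\<dots> \<le> exp (L * (y - x)) * w x" using e w_pos[of x] by (simp add: mult_right_mono)
  finally show "w z \<le> w x * exp (L * (y - x))" by (simp add: mult.commute)
  have "w x \<le> exp (L * \<bar>x - z\<bar>) * w z" by (rule w_lipschitz)
  also have "\<dots> \<le> exp (L * (y - x)) * w z" 
    using e w_pos[of z] by (simp add: mult_right_mono abs_minus_commute)
  finally have "w x * exp (- (L * (y - x))) \<le> exp (L * (y - x)) * w z * exp (- (L * (y - x)))"
    by (rule mult_right_mono) simp
  also have "\<dots> = w z" by (simp add: exp_minus)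
  finally show "w x * exp (- (L * (y - x))) \<le> w z" .
qed

definition iter_speed :: "nat \<Rightarrow> real \<Rightarrow> real" where
  "iter_speed n x = (\<Prod>i<n. w ((G ^^ i) x))"

definition iter_length :: "nat \<Rightarrow> real \<Rightarrow> real \<Rightarrow> real" where
  "iter_length n x y = (\<Sum>i<n. (G ^^ i) y - (G ^^ i) x)"

lemma iter_speed_pos: "0 < iter_speed n x"
  by (simp add: iter_speed_def prod_pos w_pos)

text \<open>Quantities attached to an interval that are multiplied under \<open>G\<close> by a factor between
  the extreme values of the speed are multiplied under \<open>G\<^sup>n\<close> by the speed of \<open>G\<^sup>n\<close> at an endpoint, up to a
  factor controlled by the total length of the intermediate images. This applies to length and to
  the masses of conformal measures.\<close>

lemma distortion:
  assumes up: "\<And>a b B. a \<le> b \<Longrightarrow> (\<And>z. a \<le> z \<Longrightarrow> z \<le> b \<Longrightarrow> w z \<le> B) \<Longrightarrow> F (G a) (G b) \<le> B powr s * F a b"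
    and low: "\<And>a b B. a \<le> b \<Longrightarrow> 0 < B \<Longrightarrow> (\<And>z. a \<le> z \<Longrightarrow> z \<le> b \<Longrightarrow> B \<le> w z) \<Longrightarrow> B powr s * F a b \<le> F (G a) (G b)"
    and "x \<le> a" "a \<le> b" "b \<le> y" "0 \<le> s"
  shows "F ((G ^^ n) a) ((G ^^ n) b) \<le> (iter_speed n x * exp (L * iter_length n x y)) powr s * F a b"
    and "(iter_speed n x * exp (- (L * iter_length n x y))) powr s * F a b \<le> F ((G ^^ n) a) ((G ^^ n) b)"
proof (induction n)
  case 0
  show "F ((G ^^ 0) a) ((G ^^ 0) b) \<le> (iter_speed 0 x * exp (L * iter_length 0 x y)) powr s * F a b"
    and "(iter_speed 0 x * exp (- (L * iter_length 0 x y))) powr s * F a b \<le> F ((G ^^ 0) a) ((G ^^ 0) b)"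
    by (auto simp: iter_speed_def iter_length_def)
next
  case (Suc n)
  let ?x = "(G ^^ n) x" and ?y = "(G ^^ n) y" and ?a = "(G ^^ n) a" and ?b = "(G ^^ n) b"
  have o: "?x \<le> ?a" "?a \<le> ?b" "?b \<le> ?y" using assms by (auto simp: iter_le_iff)
  have S: "iter_speed (Suc n) x = iter_speed n x * w ?x" by (simp add: iter_speed_def)
  have T: "iter_length (Suc n) x y = iter_length n x y + (?y - ?x)" by (simp add: iter_length_def)
  have "F (G ?a) (G ?b) \<le> (w ?x * exp (L * (?y - ?x))) powr s * F ?a ?b"
    by (rule up[OF o(2)]) (use w_near[of ?x _ ?y] o in auto)
  also have "\<dots> \<le> (w ?x * exp (L * (?y - ?x))) powr s * ((iter_speed n x * exp (L * iter_length n x y)) powr s * F a b)"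
    by (rule mult_left_mono[OF Suc.IH(1)]) simp
  also have "\<dots> = (iter_speed (Suc n) x * exp (L * iter_length (Suc n) x y)) powr s * F a b"
  proof -
    have "exp (L * (iter_length n x y + (?y - ?x))) = exp (L * iter_length n x y) * exp (L * (?y - ?x))"
      unfolding exp_add[symmetric] by (simp add: algebra_simps)
    then show ?thesis
      unfolding S T using iter_speed_pos[of n x] w_pos[of ?x] by (simp add: powr_mult mult_ac)
  qed
  finally show "F ((G ^^ Suc n) a) ((G ^^ Suc n) b) \<le> (iter_speed (Suc n) x * exp (L * iter_length (Suc n) x y)) powr s * F a b"
    by simp
  have "(iter_speed (Suc n) x * exp (- (L * iter_length (Suc n) x y))) powr s * F a b
    = (w ?x * exp (- (L * (?y - ?x)))) powr s * ((iter_speed n x * exp (- (L * iter_length n x y))) powr s * F a b)"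
  proof -
    have "exp (- (L * (iter_length n x y + (?y - ?x)))) = exp (- (L * iter_length n x y)) * exp (- (L * (?y - ?x)))"
      unfolding exp_add[symmetric] by (simp add: algebra_simps)
    then show ?thesis
      unfolding S T using iter_speed_pos[of n x] w_pos[of ?x] by (simp add: powr_mult mult_ac)
  qed
  also have "\<dots> \<le> (w ?x * exp (- (L * (?y - ?x)))) powr s * F ?a ?b"
    by (rule mult_left_mono[OF Suc.IH(2)]) simp
  also have "\<dots> \<le> F (G ?a) (G ?b)"
    by (rule low[OF o(2)]) (use w_near[of ?x _ ?y] o w_pos[of ?x] in auto)
  finally show "(iter_speed (Suc n) x * exp (- (L * iter_length (Suc n) x y))) powr s * F a b \<le> F ((G ^^ Suc n) a) ((G ^^ Suc n) b)"
    by simp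
qed

lemma distortion_length:
  assumes "x \<le> a" "a \<le> b" "b \<le> y"
  shows "(G ^^ n) b - (G ^^ n) a \<le> iter_speed n x * exp (L * iter_length n x y) * (b - a)"
    and "iter_speed n x * exp (- (L * iter_length n x y)) * (b - a) \<le> (G ^^ n) b - (G ^^ n) a"
proof -
  have up: "G b - G a \<le> B powr 1 * (b - a)" if ab: "a \<le> b" and B: "\<And>z. a \<le> z \<Longrightarrow> z \<le> b \<Longrightarrow> w z \<le> B" for a b B
  proof -
    obtain z where z: "a \<le> z" "z \<le> b" "G b - G a = (b - a) * w z" using G_mvt[OF ab] .
    then show ?thesis using B[of z] ab w_pos[of z] by (simp add: mult.commute mult_right_mono)
  qed
  have low: "B powr 1 * (b - a) \<le> G b - G a" if ab: "a \<le> b" and "0 < B" "\<And>z. a \<le> z \<Longrightarrow> z \<le> b \<Longrightarrow> B \<le> w z" for a b B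
  proof -
    obtain z where z: "a \<le> z" "z \<le> b" "G b - G a = (b - a) * w z" using G_mvt[OF ab] .
    then show ?thesis using that(3)[of z] that(2) ab by (simp add: mult.commute mult_right_mono)
  qed
  have n: "0 \<le> iter_speed n x" using iter_speed_pos[of n x] by simp
  have pos: "0 \<le> iter_speed n x * exp (L * iter_length n x y)" "0 \<le> iter_speed n x * exp (- (L * iter_length n x y))"
    using n by auto
  have "(G ^^ n) b - (G ^^ n) a \<le> (iter_speed n x * exp (L * iter_length n x y)) powr 1 * (b - a)"
    by (rule distortion(1)[where F="\<lambda>a b. b - a" and s=1 and x=x and y=y and a=a and b=b, OF up low assms zero_le_one])
  then show "(G ^^ n) b - (G ^^ n) a \<le> iter_speed n x * exp (L * iter_length n x y) * (b - a)"
    unfolding powr_one[OF pos(1)] .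
  have "(iter_speed n x * exp (- (L * iter_length n x y))) powr 1 * (b - a) \<le> (G ^^ n) b - (G ^^ n) a"
    by (rule distortion(2)[where F="\<lambda>a b. b - a" and s=1 and x=x and y=y and a=a and b=b, OF up low assms zero_le_one])
  then show "iter_speed n x * exp (- (L * iter_length n x y)) * (b - a) \<le> (G ^^ n) b - (G ^^ n) a"
    unfolding powr_one[OF pos(2)] .
qed

end

section \<open>Domination of measures tested on arcs\<close>

text \<open>The difference of the two distribution functions is again a distribution function, and the measure that it
  defines complements \<open>M\<close> to \<open>c N\<close> on half-open intervals, hence on all Borel sets.\<close>

lemma measure_le_of_Ioc_le:
  fixes M N :: "real measure"
  assumes M: "finite_borel_measure M" and N: "finite_borel_measure N" and "0 \<le> c"
    and le: "\<And>a b. a < b \<Longrightarrow> measure M {a<..b} \<le> c * measure N {a<..b}"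
    and B: "B \<in> sets borel"
  shows "measure M B \<le> c * measure N B"
proof -
  interpret M: finite_borel_measure M by fact
  interpret N: finite_borel_measure N by fact
  have sp: "space M = UNIV" "space N = UNIV"
    using sets_eq_imp_space_eq[OF M.M_is_borel] sets_eq_imp_space_eq[OF N.M_is_borel] by auto
  define F where "F = (\<lambda>x. c * cdf N x - cdf M x)"
  have diff: "F b - F a = c * measure N {a<..b} - measure M {a<..b}" if "a < b" for a b
    using M.cdf_diff_eq[OF that] N.cdf_diff_eq[OF that] by (simp add: F_def algebra_simps)
  have mono: "F a \<le> F b" if "a \<le> b" for a b
    using diff[of a b] le[of a b] that by (cases "a = b") auto
  have rc: "continuous (at_right a) F" for a
    unfolding F_def by (intro continuous_intros M.cdf_is_right_cont N.cdf_is_right_cont)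
  define K where "K = interval_measure F"
  have setsK: "sets K = sets borel" "space K = UNIV" by (auto simp: K_def)
  have KI: "emeasure K {a<..b} = ennreal (F b - F a)" if "a \<le> b" for a b
    unfolding K_def by (rule emeasure_interval_measure_Ioc[OF that mono rc])
  have finK: "finite_measure K"
  proof
    have "(\<lambda>i. emeasure K {- real i<..real i}) \<longlonglongrightarrow> emeasure K (\<Union>i. {- real i<..real i})"
      by (rule Lim_emeasure_incseq) (auto simp: setsK incseq_def)
    moreover have "(\<Union>i. {- real i<..real i}) = UNIV"
    proof -
      have "x \<in> (\<Union>i. {- real i<..real i})" for x
      proof -
        obtain n where "\<bar>x\<bar> < real n" using reals_Archimedean2 by blast
        then show ?thesis by (intro UN_I[of n]) auto
      qed
      then show ?thesis by blast
    qed
    ultimately have lim: "(\<lambda>i. emeasure K {- real i<..real i}) \<longlonglongrightarrow> emeasure K UNIV" by simp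
    have "emeasure K {- real i<..real i} \<le> ennreal (c * measure N (space N))" for i
    proof -
      have "F (real i) - F (- real i) \<le> c * measure N (space N)"
      proof (cases "i = 0")
        case False
        then have "F (real i) - F (- real i) \<le> c * measure N {- real i<..real i}" 
          using diff[of "- real i" "real i"] by simp
        also have "\<dots> \<le> c * measure N (space N)"
          by (intro mult_left_mono N.bounded_measure assms)
        finally show ?thesis .
      qed (use assms in auto)
      then show ?thesis by (simp add: KI ennreal_leI)
    qed
    then have "emeasure K UNIV \<le> ennreal (c * measure N (space N))"
      by (intro LIMSEQ_le_const2[OF lim]) auto
    then show "emeasure K (space K) \<noteq> \<infinity>" unfolding setsK by (auto simp: top_unique)
  qed
  interpret K: finite_measure K by fact
  have "measure K B + measure M B = c * measure N B"
  proof -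
    let ?E = "range (\<lambda>(a, b). {a<..b::real})"
    have stable: "Int_stable ?E"
    proof (rule Int_stableI)
      fix A B assume "A \<in> ?E" "B \<in> ?E"
      then obtain a b c d where "A = {a<..b::real}" "B = {c<..d}" by auto
      then have "A \<inter> B = (\<lambda>(a, b). {a<..b}) (max a c, min b d)" by auto
      then show "A \<inter> B \<in> ?E" by blast
    qed
    have I: "measure K A + measure M A = c * measure N A" if "A \<in> ?E" for A
    proof -
      from that obtain a b where A: "A = {a<..b}" by auto
      show ?thesis
      proof (cases "a < b")
        case True
        then have "measure K A = F b - F a" unfolding A
          using KI[of a b] mono[of a b] by (simp add: measure_def)
        then show ?thesis using diff[OF True] A by simp
      qed (simp add: A)
    qed
    have U: "measure K UNIV + measure M UNIV = c * measure N UNIV"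
    proof -
      let ?I = "\<lambda>i::nat. {- real i<..real i}"
      have un: "(\<Union>i. ?I i) = UNIV"
      proof -
        have "x \<in> (\<Union>i. ?I i)" for x
        proof -
          obtain n where "\<bar>x\<bar> < real n" using reals_Archimedean2 by blast
          then show ?thesis by (intro UN_I[of n]) auto
        qed
        then show ?thesis by blast
      qed
      have inc: "incseq ?I" by (auto simp: incseq_def)
      have "(\<lambda>i. measure K (?I i)) \<longlonglongrightarrow> measure K UNIV" 
        using K.finite_Lim_measure_incseq[OF _ inc] unfolding un by (simp add: image_subset_iff setsK)
      moreover have "(\<lambda>i. measure M (?I i)) \<longlonglongrightarrow> measure M UNIV" 
        using M.finite_Lim_measure_incseq[OF _ inc] unfolding un by (simp add: image_subset_iff M.M_is_borel)
      moreover have "(\<lambda>i. measure N (?I i)) \<longlonglongrightarrow> measure N UNIV" 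
        using N.finite_Lim_measure_incseq[OF _ inc] unfolding un by (simp add: image_subset_iff N.M_is_borel)
      ultimately have "(\<lambda>i. measure K (?I i) + measure M (?I i)) \<longlonglongrightarrow> measure K UNIV + measure M UNIV"
        "(\<lambda>i. c * measure N (?I i)) \<longlonglongrightarrow> c * measure N UNIV"
        by (auto intro!: tendsto_intros)
      moreover have "measure K (?I i) + measure M (?I i) = c * measure N (?I i)" for i
        by (rule I) auto
      ultimately show ?thesis using LIMSEQ_unique by simp
    qed
    have "B \<in> sigma_sets UNIV ?E" using B unfolding borel_sigma_sets_Ioc by simp
    moreover have "?E \<subseteq> Pow UNIV" by simp
    ultimately have "Int_stable ?E" "?E \<subseteq> Pow UNIV" "B \<in> sigma_sets UNIV ?E" using stable by auto
    then show ?thesis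
    proof (induction B rule: sigma_sets_induct_disjoint)
      case (basic A)
      then show ?case by (rule I)
    next
      case (compl A)
      have A: "A \<in> sets borel" using compl by (simp add: borel_sigma_sets_Ioc)
      have "measure K (UNIV - A) = measure K UNIV - measure K A"
        "measure M (UNIV - A) = measure M UNIV - measure M A"
        "measure N (UNIV - A) = measure N UNIV - measure N A"
        using K.finite_measure_compl[of A] M.finite_measure_compl[of A] N.finite_measure_compl[of A] A
        by (simp_all add: setsK sp M.M_is_borel N.M_is_borel)
      note eqs = this
      show ?case unfolding eqs right_diff_distrib using compl(2) U by linarith
    next
      case (union A)
      have A: "range A \<subseteq> sets borel" using union by (auto simp: borel_sigma_sets_Ioc)
      have "(\<lambda>i. measure K (A i)) sums measure K (\<Union>i. A i)"
        "(\<lambda>i. measure M (A i)) sums measure M (\<Union>i. A i)"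
        "(\<lambda>i. measure N (A i)) sums measure N (\<Union>i. A i)"
        using K.finite_measure_UNION[of A] M.finite_measure_UNION[of A] N.finite_measure_UNION[of A] A union
        by (auto simp: setsK M.M_is_borel N.M_is_borel)
      from sums_add[OF this(1,2)] sums_mult[OF this(3), of c] show ?case
        using union sums_unique2 by simp
    qed auto
  qed
  then show ?thesis using measure_nonneg[of K B] by linarith
qed

text \<open>The inverse of \<open>turn\<close> on \<open>(0, 1]\<close>; the argument function itself takes the value \<open>0\<close> at \<open>1\<close>.\<close>

definition turn_inv :: "complex \<Rightarrow> real" where
  "turn_inv \<xi> = (if Arg2pi \<xi> = 0 then 1 else Arg2pi \<xi> / (2 * pi))"

lemma Arg2pi_measurable: "Arg2pi \<in> borel_measurable borel"
proof -
  have 1: "Arg2pi = (\<lambda>z. indicator (- \<real>\<^sub>\<ge>\<^sub>0) z *\<^sub>R Arg2pi z)"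
  proof
    fix z show "Arg2pi z = indicator (- \<real>\<^sub>\<ge>\<^sub>0) z *\<^sub>R Arg2pi z"
      by (cases "z \<in> \<real>\<^sub>\<ge>\<^sub>0") (auto simp: Arg2pi_eq_0 complex_nonneg_Reals_iff complex_is_Real_iff)
  qed
  show ?thesis
    by (subst 1, rule borel_measurable_continuous_on_indicator)
      (auto intro!: continuous_at_imp_continuous_on continuous_at_Arg2pi simp: closed_Compl)
qed

lemma turn_inv_measurable: "turn_inv \<in> borel_measurable borel"
  unfolding turn_inv_def[abs_def] using Arg2pi_measurable by measurable

lemma turn_inv_measurable_circle: "sets M = sets circle_borel \<Longrightarrow> turn_inv \<in> borel_measurable M"
  using measurable_restrict_space1[OF turn_inv_measurable] measurable_cong_sets by blast

lemma turn_inv: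
  assumes "\<xi> \<in> sphere 0 1"
  shows "turn (turn_inv \<xi>) = \<xi>" "0 < turn_inv \<xi>" "turn_inv \<xi> \<le> 1"
proof -
  have *: "\<xi> = cis (Arg2pi \<xi>)" using Arg2pi_eq[of \<xi>] assms by (simp add: cis_conv_exp)
  have b: "0 \<le> Arg2pi \<xi>" "Arg2pi \<xi> < 2 * pi" using Arg2pi[of \<xi>] by auto
  show "turn (turn_inv \<xi>) = \<xi>" using * by (auto simp: turn_inv_def)
  show "0 < turn_inv \<xi>" "turn_inv \<xi> \<le> 1" using b by (auto simp: turn_inv_def field_simps less_le)
qed

lemma measure_le_of_arc_le:
  assumes M: "finite_measure M" "sets M = sets circle_borel"
    and N: "finite_measure N" "sets N = sets circle_borel" and "0 \<le> c"
    and le: "\<And>a b. 0 \<le> a \<Longrightarrow> a \<le> b \<Longrightarrow> b \<le> 1 \<Longrightarrow> measure M (circle_arc a b) \<le> c * measure N (circle_arc a b)"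
    and E: "E \<in> sets circle_borel"
  shows "measure M E \<le> c * measure N E"
proof -
  have vimage: "turn_inv -` {a<..b} \<inter> sphere 0 1 = circle_arc (max a 0) (min b 1)" for a b
  proof (intro set_eqI iffI)
    fix \<xi> assume "\<xi> \<in> turn_inv -` {a<..b} \<inter> sphere 0 1"
    then show "\<xi> \<in> circle_arc (max a 0) (min b 1)"
      unfolding circle_arc_def using turn_inv[of \<xi>] by (intro image_eqI[of _ _ "turn_inv \<xi>"]) auto
  next
    fix \<xi> assume \<xi>: "\<xi> \<in> circle_arc (max a 0) (min b 1)"
    then obtain x where x: "\<xi> = turn x" "max a 0 < x" "x \<le> min b 1" by (auto simp: circle_arc_def)
    have s: "\<xi> \<in> sphere 0 1" using \<xi> arc_subset by blast
    then obtain k :: int where "turn_inv \<xi> = x + of_int k" using turn_inv(1) x(1) turn_eq_iff by metis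
    moreover from this have "-1 < (of_int k::real)" "(of_int k::real) < 1" using turn_inv[OF s] x by auto
    then have "k = 0" by linarith
    ultimately have "turn_inv \<xi> = x" by simp
    then show "\<xi> \<in> turn_inv -` {a<..b} \<inter> sphere 0 1" using s x by auto
  qed
  have push: "finite_borel_measure (distr M borel turn_inv) \<and>
      measure (distr M borel turn_inv) {a<..b} = measure M (circle_arc (max a 0) (min b 1)) \<and>
      measure (distr M borel turn_inv) (turn -` E) = measure M E"
    if M: "finite_measure M" "sets M = sets circle_borel" for M a b
  proof -
    interpret finite_measure M by fact
    note m = turn_inv_measurable_circle[OF M(2)]
    have "turn_inv -` (turn -` E) \<inter> sphere 0 1 = E" using E turn_inv(1) by (auto simp: sets_circle_iff)
    moreover have "turn -` E \<in> sets borel" using measurable_sets[OF turn_measurable E] by simp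
    ultimately show ?thesis
      using vimage[of a b] m space_circle[OF M(2)] 
      by (auto simp: measure_distr finite_borel_measure_def finite_borel_measure_axioms_def finite_measure_distr)
  qed
  have "measure (distr M borel turn_inv) (turn -` E) \<le> c * measure (distr N borel turn_inv) (turn -` E)"
  proof (rule measure_le_of_Ioc_le)
    show "turn -` E \<in> sets borel" using measurable_sets[OF turn_measurable E] by simp
    fix a b :: real assume "a < b"
    show "measure (distr M borel turn_inv) {a<..b} \<le> c * measure (distr N borel turn_inv) {a<..b}"
    proof (cases "max a 0 \<le> min b 1")
      case True
      then show ?thesis using push[OF M] push[OF N] le[of "max a 0" "min b 1"] by simp
    next
      case False
      then have "circle_arc (max a 0) (min b 1) = {}"
        unfolding circle_arc_def by (subst greaterThanAtMost_empty) auto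
      then show ?thesis using push[OF M] push[OF N] by simp
    qed
  qed (use push[OF M] push[OF N] \<open>0 \<le> c\<close> in auto)
  then show ?thesis using push[OF M] push[OF N] by simp
qed

section \<open>Uniqueness of the conformal measure\<close>

context lifted_diffeo
begin

lemma ret_shift: "ret q p (x + of_int k) = ret q p x + of_int k"
  by (simp add: ret_def iter_shift)

lemma iter_length_return_le:
  assumes "closest_return \<alpha> q p q' p'" "1 < q'" "n \<le> k * q'"
  shows "iter_length n x (ret q p x) \<le> real k"
  using sum_return_lengths[OF assms(1,2), of n 0 k x] assms(3)
  by (simp add: iter_length_def lessThan_atLeast0)

text \<open>Denjoy's argument. An interval contained in return arcs of arbitrarily high order is
  wandering, so its images have summable lengths. The images of a return arc, however, keep covering
  the circle, and bounded distortion passes a definite proportion of each of them to the interval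
  inside: the tails of the series do not tend to zero.\<close>

lemma no_wandering_interval:
  assumes "a < b"
  shows "\<exists>N. \<forall>q p q' p' x. closest_return \<alpha> q p q' p' \<longrightarrow> N < q' \<longrightarrow> \<not> (x \<le> a \<and> b \<le> ret q p x)"
proof (rule ccontr)
  assume "\<not> ?thesis"
  then have big: "\<exists>q p q' p' x. closest_return \<alpha> q p q' p' \<and> N < q' \<and> x \<le> a \<and> b \<le> ret q p x" for N
    by blast
  define l where "l = (\<lambda>j. (G ^^ j) b - (G ^^ j) a)"
  have l_pos: "0 < l j" for j unfolding l_def using assms by (simp add: iter_less_iff)
  let ?A = "\<lambda>j. circle_arc ((G ^^ j) a) ((G ^^ j) b)"
  have disj: "?A i \<inter> ?A j = {}" if "i < j" for i j
  proof -
    obtain q p q' p' x where cr: "closest_return \<alpha> q p q' p'" "j < q'" "x \<le> a" "b \<le> ret q p x"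
      using big[of j] by blast
    have "?A n \<subseteq> circle_arc ((G ^^ n) x) ((G ^^ n) (ret q p x))" for n
      by (rule arc_mono) (use cr in \<open>auto simp: iter_le_iff\<close>)
    then show ?thesis using return_arcs_disjoint[OF cr(1) that, of x] cr(2) by fastforce
  qed
  have l_le: "l j \<le> 1" for j
  proof -
    obtain q p q' p' x where cr: "closest_return \<alpha> q p q' p'" "1 < q'" "x \<le> a" "b \<le> ret q p x"
      using big[of 1] by blast
    have "(G ^^ j) b \<le> (G ^^ j) (ret q p x)" "(G ^^ j) x \<le> (G ^^ j) a" using cr by (auto simp: iter_le_iff)
    moreover have "(G ^^ j) (ret q p x) < (G ^^ j) x + 1"
      using ret_bounds(2)[OF cr(1,2), of "(G ^^ j) x"] unfolding ret_iter .
    ultimately show ?thesis unfolding l_def by linarith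
  qed
  interpret circ: prob_space circle_length by (rule prob_space_circle_length)
  have "(\<Sum>j<n. l j) \<le> 1" for n
  proof -
    have "(\<Sum>j<n. l j) = (\<Sum>j<n. measure circle_length (?A j))"
    proof (rule sum.cong)
      fix j
      show "l j = measure circle_length (?A j)"
        unfolding l_def by (rule measure_circle_length_arc[symmetric]) (use l_le[of j] l_pos[of j] in \<open>auto simp: l_def\<close>)
    qed simp
    also have "\<dots> = measure circle_length (\<Union>j<n. ?A j)"
    proof (rule circ.finite_measure_finite_Union[symmetric])
      show "disjoint_family_on ?A {..<n}" unfolding disjoint_family_on_def
        using disj by (metis Int_commute linorder_neqE_nat)
    qed (use circle_length_sets arc_sets in auto)
    also have "\<dots> \<le> 1" by (rule circ.prob_le_1)
    finally show ?thesis .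
  qed
  then have "summable l" by (intro summableI_nonneg_bounded[of l 1]) (use l_pos in \<open>auto simp: less_imp_le\<close>)
  \<comment> \<open>The iterates below number at most \<open>m + q + q' \<le> 3 q'\<close>, so distortion costs a factor \<open>exp (3 L)\<close> for the
    return arc and another one for the interval in it.\<close>
  define \<kappa> where "\<kappa> = exp (- (6 * L)) * (b - a)"
  have "0 < \<kappa>" using assms by (simp add: \<kappa>_def)
  then obtain m where m: "\<And>n. norm (sum l {m..<n}) < \<kappa>"
    using \<open>summable l\<close> unfolding summable_Cauchy by blast
  obtain q p q' p' x where cr: "closest_return \<alpha> q p q' p'" "max m 1 < q'" "x \<le> a" "b \<le> ret q p x"
    using big[of "max m 1"] by blast
  have q': "1 < q'" "m < q'" "q \<le> q'" using cr by (auto simp: closest_return_def)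
  let ?I = "{m..<m + (q + q')}"
  have x: "x \<le> ret q p x" "ret q p x - x \<le> 1" using ret_bounds[OF cr(1) q'(1), of x] by auto
  have lower: "\<kappa> * measure circle_length (circle_arc ((G ^^ j) x) ((G ^^ j) (ret q p x))) \<le> l j" if "j \<in> ?I" for j
  proof -
    have j: "j \<le> 3 * q'" using that q' by auto
    have len: "iter_length j x (ret q p x) \<le> 3" 
      using iter_length_return_le[OF cr(1) q'(1) j, of x] by simp
    have e: "exp (L * iter_length j x (ret q p x)) \<le> exp (3 * L)" 
      using mult_left_mono[OF len L_nonneg] by (simp add: mult.commute)
    have e': "exp (- (3 * L)) \<le> exp (- (L * iter_length j x (ret q p x)))" 
      using mult_left_mono[OF len L_nonneg] by (simp add: mult.commute)
    have ab: "(G ^^ j) x \<le> (G ^^ j) (ret q p x)" "(G ^^ j) (ret q p x) \<le> (G ^^ j) x + 1"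
      using ret_bounds[OF cr(1) q'(1), of "(G ^^ j) x"] unfolding ret_iter by auto
    have "measure circle_length (circle_arc ((G ^^ j) x) ((G ^^ j) (ret q p x))) = (G ^^ j) (ret q p x) - (G ^^ j) x"
      by (rule measure_circle_length_arc[OF ab])
    also have "\<dots> \<le> iter_speed j x * exp (L * iter_length j x (ret q p x)) * (ret q p x - x)"
      by (rule distortion_length) (use x in auto)
    also have "\<dots> \<le> iter_speed j x * exp (3 * L) * 1"
      by (intro mult_mono e x order_refl) (use iter_speed_pos[of j x] x in \<open>auto simp: less_imp_le\<close>)
    finally have up: "measure circle_length (circle_arc ((G ^^ j) x) ((G ^^ j) (ret q p x))) \<le> iter_speed j x * exp (3 * L)" by simp
    have "\<kappa> * measure circle_length (circle_arc ((G ^^ j) x) ((G ^^ j) (ret q p x))) \<le> \<kappa> * (iter_speed j x * exp (3 * L))"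
      using up \<open>0 < \<kappa>\<close> by simp
    also have "\<dots> = iter_speed j x * exp (- (3 * L)) * (b - a)"
    proof -
      have "exp (- (6 * L)) * exp (3 * L) = exp (- (3 * L))" unfolding exp_add[symmetric] by simp
      then show ?thesis unfolding \<kappa>_def by (metis (no_types, lifting) mult.assoc mult.commute)
    qed
    also have "\<dots> \<le> iter_speed j x * exp (- (L * iter_length j x (ret q p x))) * (b - a)"
      by (intro mult_right_mono mult_left_mono e') (use iter_speed_pos[of j x] assms in auto)
    also have "\<dots> \<le> l j"
      unfolding l_def by (rule distortion_length) (use cr assms in auto)
    finally show ?thesis .
  qed
  have "\<kappa> * 1 \<le> \<kappa> * (\<Sum>j\<in>?I. measure circle_length (circle_arc ((G ^^ j) x) ((G ^^ j) (ret q p x))))"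
    by (intro mult_left_mono measure_return_arcs_ge[OF cr(1) prob_space_circle_length circle_length_sets])
       (use \<open>0 < \<kappa>\<close> in auto)
  also have "\<dots> \<le> (\<Sum>j\<in>?I. l j)" 
    unfolding sum_distrib_left by (rule sum_mono) (use lower in auto)
  also have "\<dots> < \<kappa>" using m[of "m + (q + q')"] by (simp add: abs_less_iff)
  finally show False by simp
qed

text \<open>Return arcs whose lengths do not tend to zero would, by periodicity and compactness, all contain a fixed
  interval along a subsequence.\<close>

lemma return_arcs_small:
  assumes "0 < \<eta>"
  shows "\<exists>N. \<forall>q p q' p' x. closest_return \<alpha> q p q' p' \<longrightarrow> N < q' \<longrightarrow> ret q p x - x < \<eta>"
proof (rule ccontr)
  assume neg: "\<not> ?thesis"
  have big: "\<exists>q p q' p' x. closest_return \<alpha> q p q' p' \<and> N < q' \<and> x \<in> {0..1} \<and> x + \<eta> \<le> ret q p x" for N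
  proof -
    from neg obtain q p q' p' x where cr: "closest_return \<alpha> q p q' p'" "N < q'" "\<eta> \<le> ret q p x - x"
      by (meson not_less)
    have "ret q p (x + of_int (- \<lfloor>x\<rfloor>)) = ret q p x + of_int (- \<lfloor>x\<rfloor>)" by (rule ret_shift)
    moreover have "x + of_int (- \<lfloor>x\<rfloor>) \<in> {0..1}" unfolding atLeastAtMost_iff by linarith
    ultimately show ?thesis using cr by (intro exI[of _ q] exI[of _ p] exI[of _ q'] exI[of _ p'] exI[of _ "x + of_int (- \<lfloor>x\<rfloor>)"]) simp
  qed
  then obtain q p q' p' x where cr: "\<And>n. closest_return \<alpha> (q n) (p n) (q' n) (p' n)" "\<And>n. n < q' n" 
    "\<And>n. x n \<in> {0..1}" "\<And>n. x n + \<eta> \<le> ret (q n) (p n) (x n)"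
    by metis
  obtain xs r where r: "strict_mono r" "(x \<circ> r) \<longlonglongrightarrow> xs"
    using compact_imp_seq_compact[of "{0..1::real}"] cr(3) unfolding seq_compact_def
    by (metis compact_Icc)
  obtain N where N: "\<And>q p q' p' x. closest_return \<alpha> q p q' p' \<Longrightarrow> N < q' \<Longrightarrow> 
      \<not> (x \<le> xs + \<eta> / 4 \<and> xs + 3 * \<eta> / 4 \<le> ret q p x)"
  proof -
    have "xs + \<eta> / 4 < xs + 3 * \<eta> / 4" using assms by simp
    from no_wandering_interval[OF this] that show ?thesis by blast
  qed
  have "\<forall>\<^sub>F n in sequentially. dist ((x \<circ> r) n) xs < \<eta> / 4"
    using tendstoD[OF r(2), of "\<eta> / 4"] assms by simp
  then obtain n where n: "n > N" "dist (x (r n)) xs < \<eta> / 4"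
    using eventually_gt_at_top[of N] eventually_conj eventually_happens'[OF sequentially_bot] 
    by (metis (mono_tags, lifting) comp_apply)
  have "N < q' (r n)" using n(1) seq_suble[OF r(1), of n] cr(2)[of "r n"] by linarith
  moreover have "x (r n) \<le> xs + \<eta> / 4" "xs + 3 * \<eta> / 4 \<le> ret (q (r n)) (p (r n)) (x (r n))"
    using n(2) cr(4)[of "r n"] unfolding dist_real_def by linarith+
  ultimately show False using N[OF cr(1)] by blast
qed

subsection \<open>Conformal measures of return arcs\<close>

lemma conformal_arc_mass:
  assumes M: "is_conformal_measure s g M" and "0 \<le> s" and "a \<le> b"
  shows "(\<And>z. a \<le> z \<Longrightarrow> z \<le> b \<Longrightarrow> w z \<le> B) \<Longrightarrow> 
      measure M (circle_arc (G a) (G b)) \<le> B powr s * measure M (circle_arc a b)"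
    and "0 < B \<Longrightarrow> (\<And>z. a \<le> z \<Longrightarrow> z \<le> b \<Longrightarrow> B \<le> w z) \<Longrightarrow> 
      B powr s * measure M (circle_arc a b) \<le> measure M (circle_arc (G a) (G b))"
proof -
  interpret prob_space M using M by (simp add: is_conformal_measure_def)
  have arc: "circle_arc a b \<in> sets M" using M arc_sets by (simp add: is_conformal_measure_def)
  have eq: "emeasure M (circle_arc (G a) (G b)) = (\<integral>\<^sup>+x\<in>circle_arc a b. ennreal (norm (deriv g x) powr s) \<partial>M)"
    using M arc unfolding image_arc[symmetric] by (simp add: is_conformal_measure_def)
  have const: "(\<integral>\<^sup>+x\<in>circle_arc a b. ennreal (B powr s) \<partial>M) = ennreal (B powr s * measure M (circle_arc a b))"
    using arc by (simp add: nn_integral_cmult_indicator emeasure_eq_measure ennreal_mult)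
  {
    assume *: "\<And>z. a \<le> z \<Longrightarrow> z \<le> b \<Longrightarrow> w z \<le> B"
    have "emeasure M (circle_arc (G a) (G b)) \<le> (\<integral>\<^sup>+x\<in>circle_arc a b. ennreal (B powr s) \<partial>M)"
      unfolding eq
    proof (rule nn_integral_mono)
      fix x
      show "ennreal (norm (deriv g x) powr s) * indicator (circle_arc a b) x \<le> ennreal (B powr s) * indicator (circle_arc a b) x"
      proof (cases "x \<in> circle_arc a b")
        case True
        then obtain z where "x = turn z" "a < z" "z \<le> b" by (auto simp: circle_arc_def)
        then show ?thesis using *[of z] \<open>0 \<le> s\<close> w_pos[of z] True by (simp add: speed powr_mono2 ennreal_leI)
      qed simp
    qed
    then show "measure M (circle_arc (G a) (G b)) \<le> B powr s * measure M (circle_arc a b)"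
      unfolding const by (simp add: emeasure_eq_measure)
  }
  {
    assume *: "0 < B" "\<And>z. a \<le> z \<Longrightarrow> z \<le> b \<Longrightarrow> B \<le> w z"
    have "(\<integral>\<^sup>+x\<in>circle_arc a b. ennreal (B powr s) \<partial>M) \<le> emeasure M (circle_arc (G a) (G b))"
      unfolding eq
    proof (rule nn_integral_mono)
      fix x
      show "ennreal (B powr s) * indicator (circle_arc a b) x \<le> ennreal (norm (deriv g x) powr s) * indicator (circle_arc a b) x"
      proof (cases "x \<in> circle_arc a b")
        case True
        then obtain z where "x = turn z" "a < z" "z \<le> b" by (auto simp: circle_arc_def)
        then show ?thesis using *(2)[of z] \<open>0 \<le> s\<close> \<open>0 < B\<close> True by (simp add: speed powr_mono2 ennreal_leI)
      qed simp
    qed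
    then show "B powr s * measure M (circle_arc a b) \<le> measure M (circle_arc (G a) (G b))"
      unfolding const by (simp add: emeasure_eq_measure)
  }
qed

lemma conformal_iter_mass:
  fixes x :: real
  assumes M: "is_conformal_measure s g M" and "0 \<le> s"
    and cr: "closest_return \<alpha> q p q' p'" "1 < q'" and j: "j \<le> 2 * q'"
  defines "A \<equiv> circle_arc x (ret q p x)"
    and "Aj \<equiv> circle_arc ((G ^^ j) x) ((G ^^ j) (ret q p x))"
  shows "measure M Aj \<le> iter_speed j x powr s * exp (2 * L) powr s * measure M A"
    and "iter_speed j x powr s * measure M A \<le> exp (2 * L) powr s * measure M Aj"
proof -
  interpret prob_space M using M by (simp add: is_conformal_measure_def)
  have up: "measure M (circle_arc (G a) (G b)) \<le> B powr s * measure M (circle_arc a b)"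
    if "a \<le> b" "\<And>z. a \<le> z \<Longrightarrow> z \<le> b \<Longrightarrow> w z \<le> B" for a b B
    by (rule conformal_arc_mass(1)[OF M \<open>0 \<le> s\<close>]) (use that in auto)
  have low: "B powr s * measure M (circle_arc a b) \<le> measure M (circle_arc (G a) (G b))"
    if "a \<le> b" "0 < B" "\<And>z. a \<le> z \<Longrightarrow> z \<le> b \<Longrightarrow> B \<le> w z" for a b B
    by (rule conformal_arc_mass(2)[OF M \<open>0 \<le> s\<close>]) (use that in auto)
  have x: "x \<le> ret q p x" using ret_bounds[OF cr, of x] by simp
  have len: "iter_length j x (ret q p x) \<le> 2" using iter_length_return_le[OF cr j, of x] by simp
  have Llen: "L * iter_length j x (ret q p x) \<le> 2 * L" using mult_left_mono[OF len L_nonneg] by (simp add: mult.commute)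
  have W: "0 < iter_speed j x" by (rule iter_speed_pos)
  have "measure M Aj \<le> (iter_speed j x * exp (L * iter_length j x (ret q p x))) powr s * measure M A"
    unfolding A_def Aj_def
    by (rule distortion(1)[where F="\<lambda>a b. measure M (circle_arc a b)" and x=x and y="ret q p x", 
          OF up low order_refl x order_refl \<open>0 \<le> s\<close>])
  also have "\<dots> \<le> (iter_speed j x * exp (2 * L)) powr s * measure M A"
    by (intro mult_right_mono powr_mono2 mult_left_mono) (use Llen W \<open>0 \<le> s\<close> in auto)
  finally show "measure M Aj \<le> iter_speed j x powr s * exp (2 * L) powr s * measure M A"
    using W by (simp add: powr_mult)
  have "iter_speed j x powr s * measure M A = exp (2 * L) powr s * ((iter_speed j x * exp (- (2 * L))) powr s * measure M A)"
  proof -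
    have "exp (2 * L) powr s * exp (- (2 * L)) powr s = (exp (2 * L) * exp (- (2 * L))) powr s"
      by (rule powr_mult[symmetric])
    also have "exp (2 * L) * exp (- (2 * L)) = 1" unfolding exp_add[symmetric] by simp
    finally show ?thesis using W by (simp add: powr_mult)
  qed
  also have "\<dots> \<le> exp (2 * L) powr s * ((iter_speed j x * exp (- (L * iter_length j x (ret q p x)))) powr s * measure M A)"
    by (intro mult_left_mono mult_right_mono powr_mono2) (use Llen W \<open>0 \<le> s\<close> in auto)
  also have "\<dots> \<le> exp (2 * L) powr s * measure M Aj"
    unfolding A_def Aj_def
    by (intro mult_left_mono distortion(2)[where F="\<lambda>a b. measure M (circle_arc a b)" and x=x and y="ret q p x", 
          OF up low order_refl x order_refl \<open>0 \<le> s\<close>]) simp_all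
  finally show "iter_speed j x powr s * measure M A \<le> exp (2 * L) powr s * measure M Aj" .
qed

text \<open>The mass of a return arc is determined up to a universal factor by the speeds along its orbit, since
  its images cover the circle at least once and at most twice.\<close>

definition compare_const :: "real \<Rightarrow> real" where
  "compare_const s = 2 * (exp (2 * L) powr s)\<^sup>2"

lemma return_arc_comparable:
  assumes M: "is_conformal_measure s g M" and N: "is_conformal_measure s g N" and "0 \<le> s"
    and cr: "closest_return \<alpha> q p q' p'" "1 < q'"
  shows "measure M (circle_arc x (ret q p x)) \<le> compare_const s * measure N (circle_arc x (ret q p x))"
proof -
  have probs: "prob_space M" "sets M = sets circle_borel" "prob_space N" "sets N = sets circle_borel"
    using M N by (auto simp: is_conformal_measure_def)
  have q: "q \<le> q'" using cr by (simp add: closest_return_def)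
  let ?A = "\<lambda>j. circle_arc ((G ^^ j) x) ((G ^^ j) (ret q p x))"
  define \<kappa> where "\<kappa> = exp (2 * L) powr s"
  have \<kappa>: "0 < \<kappa>" by (simp add: \<kappa>_def)
  define W where "W = (\<Sum>j<q + q'. iter_speed j x powr s)"
  let ?m = "measure M (circle_arc x (ret q p x))" and ?n = "measure N (circle_arc x (ret q p x))"
  have "W * ?m \<le> (\<Sum>j<q + q'. \<kappa> * measure M (?A j))"
    unfolding W_def sum_distrib_right \<kappa>_def
    by (rule sum_mono, rule conformal_iter_mass(2)[OF M \<open>0 \<le> s\<close> cr]) (use q in auto)
  also have "\<dots> \<le> (\<Sum>j\<in>{0..<0 + 2 * q'}. \<kappa> * measure M (?A j))"
    by (rule sum_mono2) (use q \<kappa> in auto)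
  also have "\<dots> \<le> \<kappa> * 2"
    unfolding sum_distrib_left[symmetric]
    using measure_return_arcs_le[OF cr(1) probs(1,2), where m=0 and x=x and k=2] \<kappa> by simp
  finally have 1: "W * ?m \<le> \<kappa> * 2" .
  have "1 \<le> (\<Sum>j<q + q'. measure N (?A j))"
    using measure_return_arcs_ge[OF cr(1) probs(3,4), where m=0 and x=x] by (simp add: lessThan_atLeast0)
  also have "\<dots> \<le> (\<Sum>j<q + q'. iter_speed j x powr s * (\<kappa> * ?n))"
    unfolding \<kappa>_def mult.assoc[symmetric]
    by (rule sum_mono, rule conformal_iter_mass(1)[OF N \<open>0 \<le> s\<close> cr]) (use q in auto)
  also have "\<dots> = W * (\<kappa> * ?n)" unfolding W_def sum_distrib_right ..
  finally have 2: "1 \<le> W * (\<kappa> * ?n)" .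
  have W: "0 < W" unfolding W_def
    by (rule sum_pos) (use cr iter_speed_pos in \<open>auto simp: closest_return_def lessThan_empty_iff less_imp_neq[symmetric]\<close>)
  have "W * ?m \<le> W * (2 * \<kappa>\<^sup>2 * ?n)"
  proof -
    have "W * ?m \<le> (\<kappa> * 2) * 1" using 1 by simp
    also have "\<dots> \<le> (\<kappa> * 2) * (W * (\<kappa> * ?n))" by (rule mult_left_mono[OF 2]) (use \<kappa> in simp)
    finally show ?thesis by (simp add: power2_eq_square mult_ac)
  qed
  then show ?thesis using W unfolding compare_const_def \<kappa>_def[symmetric] by simp
qed

end

lemma tendsto_measure_arc_right:
  assumes N: "finite_measure N" "sets N = sets circle_borel" and "a \<le> b" "b < a + 1"
  shows "(\<lambda>n. measure N (circle_arc a (b + (a + 1 - b) / real (Suc n)))) \<longlonglongrightarrow> measure N (circle_arc a b)"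
proof -
  interpret finite_measure N by fact
  let ?b = "\<lambda>n. b + (a + 1 - b) / real (Suc n)"
  have le1: "?b n \<le> a + 1" "b \<le> ?b n" for n
  proof -
    have "(a + 1 - b) / real (Suc n) \<le> (a + 1 - b) / 1" by (rule divide_left_mono) (use assms in auto)
    then show "?b n \<le> a + 1" by simp
    show "b \<le> ?b n" using assms by simp
  qed
  have "decseq (\<lambda>n. circle_arc a (?b n))"
    unfolding decseq_def using assms
    by (intro allI impI arc_mono) (auto intro!: divide_left_mono)
  then have "(\<lambda>n. measure N (circle_arc a (?b n))) \<longlonglongrightarrow> measure N (\<Inter>n. circle_arc a (?b n))"
    by (intro finite_Lim_measure_decseq) (use N arc_sets in auto)
  moreover have "(\<Inter>n. circle_arc a (?b n)) = circle_arc a b"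
  proof
    show "circle_arc a b \<subseteq> (\<Inter>n. circle_arc a (?b n))" using arc_mono[OF order_refl le1(2)] by blast
    show "(\<Inter>n. circle_arc a (?b n)) \<subseteq> circle_arc a b"
    proof
      fix \<xi> assume \<xi>: "\<xi> \<in> (\<Inter>n. circle_arc a (?b n))"
      then have "\<xi> \<in> circle_arc a (?b 0)" by blast
      then obtain u where u: "\<xi> = turn u" "a < u" "u \<le> ?b 0" by (auto simp: circle_arc_def)
      have "u \<le> ?b n" for n
      proof -
        have "turn u \<in> circle_arc a (?b n)" using \<xi> u by blast
        then obtain k :: int where k: "a < u + of_int k" "u + of_int k \<le> ?b n" unfolding arc_mem_iff by blast
        have "-1 < (of_int k :: real)" "(of_int k :: real) < 1" using k u le1[of n] by auto
        then have "k = 0" by linarith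
        then show ?thesis using k by simp
      qed
      moreover have "?b \<longlonglongrightarrow> b + 0"
        by (intro tendsto_intros LIMSEQ_Suc lim_const_over_n)
      ultimately have "u \<le> b + 0" by (intro LIMSEQ_le_const[of ?b]) auto
      then show "\<xi> \<in> circle_arc a b" using u by (auto simp: circle_arc_def)
    qed
  qed
  ultimately show ?thesis by simp
qed

lemma nn_integral_measure_add:
  assumes "sets A = sets M" "sets B = sets M" "\<And>E. E \<in> sets M \<Longrightarrow> emeasure M E = emeasure A E + emeasure B E"
    and "f \<in> borel_measurable M"
  shows "(\<integral>\<^sup>+x. f x \<partial>M) = (\<integral>\<^sup>+x. f x \<partial>A) + (\<integral>\<^sup>+x. f x \<partial>B)"
  using assms(4)
proof (induction f rule: borel_measurable_induct)
  case (cong f g)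
  have "space A = space M" "space B = space M"
    using sets_eq_imp_space_eq[OF assms(1)] sets_eq_imp_space_eq[OF assms(2)] by auto
  then have "(\<integral>\<^sup>+x. f x \<partial>K) = (\<integral>\<^sup>+x. g x \<partial>K)" if "K \<in> {M, A, B}" for K
    using that cong by (intro nn_integral_cong) auto
  then show ?case using cong by simp
next
  case (set E)
  then show ?case using assms by simp
next
  case (mult u c)
  have "u \<in> borel_measurable A" "u \<in> borel_measurable B" using mult assms measurable_cong_sets by blast+
  then show ?case using mult by (simp add: nn_integral_cmult distrib_left)
next
  case (add u v)
  have m: "u \<in> borel_measurable A" "u \<in> borel_measurable B" "v \<in> borel_measurable A" "v \<in> borel_measurable B"
    using add assms measurable_cong_sets by blast+
  then show ?case using add by (simp add: nn_integral_add ac_simps)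
next
  case (seq U)
  have m: "U i \<in> borel_measurable A" "U i \<in> borel_measurable B" for i 
    using seq assms measurable_cong_sets by blast+
  have S: "(SUP i. U i) x = (SUP i. U i x)" for x by (rule SUP_apply)
  have *: "(\<integral>\<^sup>+x. (SUP i. U i) x \<partial>K) = (SUP i. \<integral>\<^sup>+x. U i x \<partial>K)" if "\<And>i. U i \<in> borel_measurable K" for K
    unfolding S by (rule nn_integral_monotone_convergence_SUP) (use seq that in auto)
  have inc: "incseq (\<lambda>i. \<integral>\<^sup>+x. U i x \<partial>K)" for K
    using seq by (auto simp: incseq_def le_fun_def intro!: nn_integral_mono)
  have "(\<integral>\<^sup>+x. (SUP i. U i) x \<partial>M) = (SUP i. (\<integral>\<^sup>+x. U i x \<partial>A) + (\<integral>\<^sup>+x. U i x \<partial>B))"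
    using *[of M] seq by simp
  also have "\<dots> = (SUP i. \<integral>\<^sup>+x. U i x \<partial>A) + (SUP i. \<integral>\<^sup>+x. U i x \<partial>B)"
    using ennreal_SUP_add[OF inc inc] by simp
  also have "\<dots> = (\<integral>\<^sup>+x. (SUP i. U i) x \<partial>A) + (\<integral>\<^sup>+x. (SUP i. U i) x \<partial>B)"
    using *[of A] *[of B] m by simp
  finally show ?case .
qed

context lifted_diffeo
begin

lemma ret_funpow: "(ret q p ^^ n) a = (G ^^ (n * q)) a + of_int (- (int n * p))"
proof (induction n)
  case (Suc n)
  have "(ret q p ^^ Suc n) a = ret q p ((G ^^ (n * q)) a + of_int (- (int n * p)))" using Suc by simp
  also have "\<dots> = ret q p ((G ^^ (n * q)) a) + of_int (- (int n * p))" by (rule ret_shift)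
  also have "\<dots> = (G ^^ (Suc n * q)) a + of_int (- (int (Suc n) * p))"
    by (simp add: ret_def funpow_add algebra_simps)
  finally show ?case .
qed simp

lemma return_tiling_exhausts:
  assumes "closest_return \<alpha> q p q' p'"
  obtains n where "b \<le> (ret q p ^^ n) a"
proof -
  have \<theta>: "0 < real q * \<alpha> - of_int p" using assms by (simp add: closest_return_def)
  obtain n where n: "of_int \<lceil>b - a\<rceil> < real n * (real q * \<alpha> - of_int p)"
    using reals_Archimedean3[OF \<theta>] by blast
  have "(G ^^ 0) a + of_int \<lceil>b - a\<rceil> < (G ^^ (n * q)) a + of_int (- (int n * p))"
    unfolding orbit_less_iff using n by (simp add: algebra_simps)
  then have "a + of_int \<lceil>b - a\<rceil> < (ret q p ^^ n) a" by (simp add: ret_funpow)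
  then show thesis by (intro that[of n]) linarith
qed

text \<open>Successive return arcs tile any arc up to an excess that is shorter than one return arc; the excess is
  harmless by continuity of the second measure from above.\<close>

lemma arc_comparable:
  assumes M: "is_conformal_measure s g M" and N: "is_conformal_measure s g N" and "0 \<le> s"
    and ab: "a \<le> b" "b \<le> a + 1"
  shows "measure M (circle_arc a b) \<le> compare_const s * measure N (circle_arc a b)"
proof -
  interpret M: prob_space M using M by (simp add: is_conformal_measure_def)
  interpret N: prob_space N using N by (simp add: is_conformal_measure_def)
  have sets: "sets M = sets circle_borel" "sets N = sets circle_borel" 
    using M N by (auto simp: is_conformal_measure_def)
  have C: "1 \<le> compare_const s"
  proof -
    have "1 powr s \<le> exp (2 * L) powr s" using L_nonneg \<open>0 \<le> s\<close> by (intro powr_mono2) auto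
    then have "1 \<le> (exp (2 * L) powr s)\<^sup>2" by simp
    then show ?thesis by (simp add: compare_const_def)
  qed
  have tiles: "measure M (circle_arc a ((ret q p ^^ n) a)) \<le> compare_const s * measure N (circle_arc a ((ret q p ^^ n) a))"
    if cr: "closest_return \<alpha> q p q' p'" "1 < q'" and "(ret q p ^^ n) a \<le> a + 1" for q p q' p' n
    using that(3)
  proof (induction n)
    case 0
    show ?case by (simp add: circle_arc_def)
  next
    case (Suc n)
    let ?r = "(ret q p ^^ n) a"
    have r: "?r < ret q p ?r" by (rule ret_bounds(1)[OF cr])
    have up: "a \<le> (ret q p ^^ m) a" for m
    proof (induction m)
      case (Suc m)
      then show ?case using ret_bounds(1)[OF cr, of "(ret q p ^^ m) a"] by simp
    qed simp
    have dj: "circle_arc a ?r \<inter> circle_arc ?r (ret q p ?r) = {}"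
      by (rule arc_disjoint) (use up[of n] r Suc.prems in auto)
    have un: "circle_arc a ((ret q p ^^ Suc n) a) = circle_arc a ?r \<union> circle_arc ?r (ret q p ?r)"
      using arc_split[of a ?r "ret q p ?r"] up[of n] r by simp
    have "measure M (circle_arc a ((ret q p ^^ Suc n) a)) = measure M (circle_arc a ?r) + measure M (circle_arc ?r (ret q p ?r))"
      unfolding un by (rule M.finite_measure_Union) (use sets arc_sets dj in auto)
    also have "\<dots> \<le> compare_const s * measure N (circle_arc a ?r) + compare_const s * measure N (circle_arc ?r (ret q p ?r))"
      using Suc r return_arc_comparable[OF M N \<open>0 \<le> s\<close> cr, of ?r] by (intro add_mono) auto
    also have "\<dots> = compare_const s * measure N (circle_arc a ((ret q p ^^ Suc n) a))"
      unfolding un by (subst N.finite_measure_Union) (use sets arc_sets dj in \<open>auto simp: distrib_left\<close>)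
    finally show ?case .
  qed
  show ?thesis
  proof (cases "b = a + 1")
    case True
    then show ?thesis using C M.prob_space N.prob_space space_circle[OF sets(1)] space_circle[OF sets(2)]
      by (simp add: arc_full)
  next
    case False
    then have b: "b < a + 1" using ab by simp
    have "measure M (circle_arc a b) \<le> compare_const s * measure N (circle_arc a (b + (a + 1 - b) / real (Suc n)))" for n
    proof (cases "a = b")
      case False
      define \<eta> where "\<eta> = (a + 1 - b) / real (Suc n)"
      have "(a + 1 - b) / real (Suc n) \<le> (a + 1 - b) / 1" by (rule divide_left_mono) (use b in auto)
      then have \<eta>: "0 < \<eta>" "b + \<eta> \<le> a + 1" using b by (auto simp: \<eta>_def)
      obtain K where K: "\<And>q p q' p' x. closest_return \<alpha> q p q' p' \<Longrightarrow> K < q' \<Longrightarrow> ret q p x - x < \<eta>"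
        using return_arcs_small[OF \<eta>(1)] by blast
      obtain q p q' p' where cr: "closest_return \<alpha> q p q' p'" "max K 1 < q'"
        using closest_return_exists[OF irrational, of "max K 1"] by blast
      define m where "m = (LEAST m. b \<le> (ret q p ^^ m) a)"
      have m: "b \<le> (ret q p ^^ m) a"
        unfolding m_def using return_tiling_exhausts[OF cr(1), of b a] by (metis (mono_tags, lifting) LeastI_ex)
      have "m \<noteq> 0" using m ab False by (intro notI) simp
      then obtain m' where m': "m = Suc m'" using not0_implies_Suc by blast
      then have "(ret q p ^^ m') a < b" using not_less_Least[of m' "\<lambda>m. b \<le> (ret q p ^^ m) a"] m_def by simp
      moreover have "(ret q p ^^ m) a - (ret q p ^^ m') a < \<eta>" using K[OF cr(1), of "(ret q p ^^ m') a"] cr(2) m' by simp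
      ultimately have m2: "(ret q p ^^ m) a \<le> b + \<eta>" by linarith
      have "measure M (circle_arc a b) \<le> measure M (circle_arc a ((ret q p ^^ m) a))"
        by (rule M.finite_measure_mono) (use m sets arc_sets arc_mono[OF order_refl m] in auto)
      also have "\<dots> \<le> compare_const s * measure N (circle_arc a ((ret q p ^^ m) a))"
        by (rule tiles[OF cr(1)]) (use cr m2 \<eta> in auto)
      also have "\<dots> \<le> compare_const s * measure N (circle_arc a (b + \<eta>))"
        by (intro mult_left_mono N.finite_measure_mono arc_mono m2) (use sets arc_sets C in auto)
      finally show ?thesis by (simp add: \<eta>_def)
    qed (use C in \<open>simp add: circle_arc_def\<close>)
    moreover have "(\<lambda>n. compare_const s * measure N (circle_arc a (b + (a + 1 - b) / real (Suc n)))) \<longlonglongrightarrow> compare_const s * measure N (circle_arc a b)"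
      by (intro tendsto_mult tendsto_const tendsto_measure_arc_right N.finite_measure_axioms sets ab b)
    ultimately show ?thesis by (intro LIMSEQ_le_const) auto
  qed
qed

lemma conformal_comparable:
  assumes M: "is_conformal_measure s g M" and N: "is_conformal_measure s g N" and "0 \<le> s"
    and E: "E \<in> sets circle_borel"
  shows "measure M E \<le> compare_const s * measure N E"
proof (rule measure_le_of_arc_le[OF _ _ _ _ _ _ E])
  show "0 \<le> compare_const s" by (simp add: compare_const_def)
  fix a b :: real assume "0 \<le> a" "a \<le> b" "b \<le> 1"
  then show "measure M (circle_arc a b) \<le> compare_const s * measure N (circle_arc a b)"
    by (intro arc_comparable[OF M N \<open>0 \<le> s\<close>]) auto
qed (use M N prob_space.finite_measure in \<open>auto simp: is_conformal_measure_def\<close>)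

lemma image_sets: "E \<in> sets circle_borel \<Longrightarrow> g ` E \<in> sets circle_borel"
proof -
  assume E: "E \<in> sets circle_borel"
  define h where "h = inv_into (sphere 0 1) g"
  have inj: "inj_on g (sphere 0 1)" and img: "g ` sphere 0 1 = sphere 0 1" using g_bij by (auto simp: bij_betw_def)
  have "continuous_on (g ` sphere 0 1) h"
    by (rule continuous_on_inv[OF g_cont]) (use inj in \<open>auto simp: h_def\<close>)
  then have "continuous_on (sphere 0 1) h" using img by simp
  then have "h \<in> measurable circle_borel borel" by (rule borel_measurable_continuous_on_restrict)
  moreover have "E \<in> sets borel" using E by (simp add: sets_circle_iff)
  ultimately have "h -` E \<inter> space circle_borel \<in> sets circle_borel" by (rule measurable_sets)
  moreover have "h -` E \<inter> space circle_borel = g ` E"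
  proof -
    have "h (g x) = x" if "x \<in> sphere 0 1" for x unfolding h_def using inj that by simp
    note hg = this
    have gh: "g (h y) = y" if "y \<in> sphere 0 1" for y 
      unfolding h_def using img that by (metis f_inv_into_f)
    have sub: "E \<subseteq> sphere 0 1" using E by (simp add: sets_circle_iff)
    have sp: "space circle_borel = sphere 0 1" by (simp add: space_restrict_space)
    show ?thesis unfolding sp
    proof (intro equalityI subsetI)
      fix y assume y: "y \<in> h -` E \<inter> sphere 0 1"
      then show "y \<in> g ` E" using gh[of y] by (intro image_eqI[of _ _ "h y"]) auto
    next
      fix y assume "y \<in> g ` E"
      then obtain x where x: "x \<in> E" "y = g x" by blast
      then have "x \<in> sphere 0 1" using sub by blast
      then have "h y = x" "y \<in> sphere 0 1" using hg x img by auto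
      then show "y \<in> h -` E \<inter> sphere 0 1" using x by simp
    qed
  qed
  ultimately show ?thesis by simp
qed

text \<open>Removing from a conformal measure a multiple of another one leaves, after normalisation, a conformal
  measure.\<close>

lemma conformal_remainder:
  assumes M: "is_conformal_measure s g M" and N: "is_conformal_measure s g N"
    and c: "0 \<le> c" "c < 1" and le: "\<And>E. E \<in> sets circle_borel \<Longrightarrow> c * measure N E \<le> measure M E"
  obtains R where "is_conformal_measure s g R" 
    "\<And>E. E \<in> sets circle_borel \<Longrightarrow> measure M E = c * measure N E + (1 - c) * measure R E"
proof -
  interpret M: prob_space M using M by (simp add: is_conformal_measure_def)
  interpret N: prob_space N using N by (simp add: is_conformal_measure_def)
  have sets: "sets M = sets circle_borel" "sets N = sets circle_borel" 
    using M N by (auto simp: is_conformal_measure_def)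
  define N' where "N' = scale_measure (ennreal c) N"
  have N'e: "emeasure N' E = ennreal (c * measure N E)" for E
    using c by (simp add: N'_def N.emeasure_eq_measure ennreal_mult)
  have setsN': "sets N' = sets circle_borel" using sets by (simp add: N'_def)
  have finN': "finite_measure N'" by standard (simp add: N'e)
  define D where "D = diff_measure M N'"
  have setsD: "sets D = sets circle_borel" by (simp add: D_def sets)
  have De: "emeasure D E = ennreal (measure M E - c * measure N E)" if "E \<in> sets circle_borel" for E
  proof -
    have "emeasure D E = emeasure M E - emeasure N' E"
      unfolding D_def by (rule emeasure_diff_measure[OF M.finite_measure_axioms finN'])
        (use sets setsN' that le in \<open>auto simp: N'e M.emeasure_eq_measure ennreal_leI\<close>)
    then show ?thesis using c by (simp add: N'e M.emeasure_eq_measure ennreal_minus)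
  qed
  define R where "R = scale_measure (ennreal (1 / (1 - c))) D"
  have Re: "emeasure R E = ennreal (1 / (1 - c) * (measure M E - c * measure N E))" if "E \<in> sets circle_borel" for E
    unfolding R_def emeasure_scale_measure De[OF that] using le[OF that] c by (intro ennreal_mult[symmetric]) auto
  have setsR: "sets R = sets circle_borel" by (simp add: R_def setsD)
  have topR: "space R = sphere 0 1" "space M = sphere 0 1" "space N = sphere 0 1" 
    using space_circle setsR sets by auto
  have S: "sphere 0 1 \<in> sets circle_borel" unfolding sets_circle_iff by auto
  have "is_conformal_measure s g R"
    unfolding is_conformal_measure_def
  proof (intro conjI ballI)
    have "measure M (sphere 0 1) = 1" "measure N (sphere 0 1) = 1" using M.prob_space N.prob_space topR by auto
    then show "prob_space R" by (intro prob_spaceI) (use Re[OF S] topR c in simp)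
    show "sets R = sets circle_borel" by (rule setsR)
    fix E assume "E \<in> sets R"
    then have E: "E \<in> sets circle_borel" by (simp add: setsR)
    let ?f = "\<lambda>x. ennreal (norm (deriv g x) powr s) * indicator E x"
    have "deriv g \<in> borel_measurable circle_borel"
      by (rule borel_measurable_continuous_on_restrict[OF deriv_cont])
    then have "deriv g \<in> borel_measurable M" using sets measurable_cong_sets by blast
    then have [measurable]: "deriv g \<in> borel_measurable M" .
    have [measurable]: "E \<in> M.events" using E sets by simp
    have f: "?f \<in> borel_measurable M" by measurable
    have f': "?f \<in> borel_measurable D" "?f \<in> borel_measurable N" 
      using f measurable_cong_sets[of D M borel borel] measurable_cong_sets[of N M borel borel] sets setsD by auto
    have "(\<integral>\<^sup>+x. ?f x \<partial>M) = (\<integral>\<^sup>+x. ?f x \<partial>D) + (\<integral>\<^sup>+x. ?f x \<partial>N')"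
    proof (rule nn_integral_measure_add)
      fix E assume "E \<in> sets M"
      then show "emeasure M E = emeasure D E + emeasure N' E"
        using De[of E] le[of E] sets c by (simp add: N'e M.emeasure_eq_measure ennreal_plus[symmetric] del: ennreal_plus)
    qed (use sets setsD setsN' f in auto)
    moreover have "(\<integral>\<^sup>+x. ?f x \<partial>N') = ennreal (c * measure N (g ` E))"
      using N E sets unfolding N'_def nn_integral_scale_measure[OF f'(2)]
      by (simp add: is_conformal_measure_def N.emeasure_eq_measure ennreal_mult c)
    moreover have "(\<integral>\<^sup>+x. ?f x \<partial>M) = ennreal (measure M (g ` E))"
      using M E sets by (simp add: is_conformal_measure_def M.emeasure_eq_measure)
    ultimately have "ennreal (measure M (g ` E)) = (\<integral>\<^sup>+x. ?f x \<partial>D) + ennreal (c * measure N (g ` E))" by simp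
    then have "(\<integral>\<^sup>+x. ?f x \<partial>D) = ennreal (measure M (g ` E)) - ennreal (c * measure N (g ` E))" by simp
    also have "\<dots> = emeasure D (g ` E)" using De[OF image_sets[OF E]] c by (simp add: ennreal_minus)
    finally show "emeasure R (g ` E) = (\<integral>\<^sup>+x. ?f x \<partial>R)"
      unfolding R_def nn_integral_scale_measure[OF f'(1)] by simp
  qed
  moreover have "measure M E = c * measure N E + (1 - c) * measure R E" if "E \<in> sets circle_borel" for E
  proof -
    have "measure R E = 1 / (1 - c) * (measure M E - c * measure N E)"
      using Re[OF that] le[OF that] c by (simp add: measure_def)
    then show ?thesis using c by simp
  qed
  ultimately show thesis using that by blast
qed

text \<open>Writing \<open>M = c N + (1 - c) R\<close> with \<open>R\<close> conformal and repeating this for \<open>R\<close>, with the same \<open>c\<close>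
  because the constant of comparison is universal, gives \<open>M \<ge> (1 - (1 - c)\<^sup>n) N\<close> for all \<open>n\<close>.\<close>

theorem conformal_measure_unique:
  assumes M: "is_conformal_measure s g M" and N: "is_conformal_measure s g N" and "0 \<le> s"
  shows "M = N"
proof -
  interpret M: prob_space M using M by (simp add: is_conformal_measure_def)
  interpret N: prob_space N using N by (simp add: is_conformal_measure_def)
  have sets: "sets M = sets circle_borel" "sets N = sets circle_borel" 
    using M N by (auto simp: is_conformal_measure_def)
  \<comment> \<open>The factor \<open>2\<close> makes \<open>c < 1\<close> a consequence of \<open>compare_const s \<ge> 1\<close>.\<close>
  define c where "c = 1 / (2 * compare_const s)"
  have C: "0 < compare_const s" by (simp add: compare_const_def)
  have "1 powr s \<le> exp (2 * L) powr s" using L_nonneg \<open>0 \<le> s\<close> by (intro powr_mono2) auto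
  then have "1 \<le> (exp (2 * L) powr s)\<^sup>2" by simp
  then have C1: "1 \<le> compare_const s" by (simp add: compare_const_def)
  have c: "0 < c" "c < 1" using C C1 by (auto simp: c_def field_simps)
  have step: "(1 - (1 - c) ^ n) * measure N E \<le> measure M E" 
    if "is_conformal_measure s g M" "E \<in> sets circle_borel" for n M E
    using that
  proof (induction n arbitrary: M E)
    case (Suc n)
    have le: "c * measure N E \<le> measure M E" if "E \<in> sets circle_borel" for E
    proof -
      have "measure N E \<le> compare_const s * measure M E"
        by (rule conformal_comparable[OF N Suc.prems(1) \<open>0 \<le> s\<close> that])
      also have "\<dots> \<le> (2 * compare_const s) * measure M E" using C by (intro mult_right_mono) auto
      finally show ?thesis using C by (simp add: c_def field_simps)
    qed
    obtain R where R: "is_conformal_measure s g R" 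
      "\<And>E. E \<in> sets circle_borel \<Longrightarrow> measure M E = c * measure N E + (1 - c) * measure R E"
      using conformal_remainder[OF Suc.prems(1) N _ c(2) le] c(1) by auto
    have "(1 - (1 - c) ^ Suc n) * measure N E = c * measure N E + (1 - c) * ((1 - (1 - c) ^ n) * measure N E)"
      by (simp add: algebra_simps)
    also have "\<dots> \<le> c * measure N E + (1 - c) * measure R E"
      using Suc.IH[OF R(1) Suc.prems(2)] c by (intro add_left_mono mult_left_mono) auto
    finally show ?case using R(2)[OF Suc.prems(2)] by simp
  qed simp
  have le: "measure N E \<le> measure M E" if "E \<in> sets circle_borel" for E
  proof -
    have "(\<lambda>n. (1 - (1 - c) ^ n) * measure N E) \<longlonglongrightarrow> (1 - 0) * measure N E"
      by (intro tendsto_intros LIMSEQ_power_zero) (use c in auto)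
    then show ?thesis using step[OF M that] by (intro LIMSEQ_le_const2) auto
  qed
  show ?thesis
  proof (rule measure_eqI)
    show "sets M = sets N" using sets by simp
    fix E assume E: "E \<in> sets M"
    then have E': "E \<in> sets circle_borel" "space M - E \<in> sets circle_borel" "space M = space N"
      using sets space_circle[OF sets(1)] space_circle[OF sets(2)] sets.compl_sets[of E M] by auto
    have "measure N (space M - E) = 1 - measure N E" "measure M (space M - E) = 1 - measure M E"
      using N.prob_compl[of E] M.prob_compl[of E] E E' sets by auto
    then have "measure M E = measure N E" using le[OF E'(1)] le[OF E'(2)] by linarith
    then show "emeasure M E = emeasure N E" by (simp add: M.emeasure_eq_measure N.emeasure_eq_measure)
  qed
qed

end

section \<open>Integration on the circle\<close>

lemma circle_measurable:
  fixes f :: "complex \<Rightarrow> 'b::{second_countable_topology, banach}"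
  assumes "sets M = sets circle_borel" "continuous_on (sphere 0 1) f"
  shows "f \<in> borel_measurable M"
  using borel_measurable_continuous_on_restrict[OF assms(2)] measurable_cong_sets[OF assms(1) refl] by blast

lemma circle_integrable:
  fixes f :: "complex \<Rightarrow> 'b::{second_countable_topology, banach}"
  assumes "finite_measure M" "sets M = sets circle_borel" "continuous_on (sphere 0 1) f"
  shows "integrable M f"
proof -
  interpret finite_measure M by fact
  have "bounded (f ` sphere 0 1)"
    by (intro compact_imp_bounded compact_continuous_image assms) simp
  then obtain B where "\<And>x. x \<in> sphere 0 1 \<Longrightarrow> norm (f x) \<le> B" unfolding bounded_iff by blast
  then show ?thesis
    by (intro integrable_const_bound[of _ B] AE_I2 circle_measurable assms) (simp add: space_circle[OF assms(2)])
qed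

subsection \<open>Weak compactness\<close>

text \<open>Helly's selection theorem for the measures transported to the interval; the limit is transported back by
  the continuous map \<open>turn\<close>, and mass that has moved to the end point \<open>0\<close> is placed at \<open>1\<close>, as it should be.\<close>

lemma circle_weak_compactness:
  fixes M :: "nat \<Rightarrow> complex measure"
  assumes M: "\<And>n. prob_space (M n)" "\<And>n. sets (M n) = sets circle_borel"
  obtains r N where "strict_mono (r :: nat \<Rightarrow> nat)" "prob_space N" "sets N = sets circle_borel"
    "\<And>f :: complex \<Rightarrow> complex. continuous_on (sphere 0 1) f \<Longrightarrow> (\<lambda>n. integral\<^sup>L (M (r n)) f) \<longlonglongrightarrow> integral\<^sup>L N f"
proof -
  define D where "D = (\<lambda>n. distr (M n) borel turn_inv)"
  have m: "turn_inv \<in> borel_measurable (M n)" for n by (rule turn_inv_measurable_circle[OF M(2)])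
  have rd: "real_distribution (D n)" for n
  proof -
    interpret prob_space "M n" by (rule M(1))
    show ?thesis unfolding D_def by (rule real_distribution_distr[OF m])
  qed
  have "tight D" unfolding tight_def
  proof (intro conjI allI impI)
    fix \<epsilon> :: real assume "0 < \<epsilon>"
    have "1 - \<epsilon> < measure (D n) {0<..1}" for n
    proof -
      interpret prob_space "M n" by (rule M(1))
      have "turn_inv -` {0<..1} \<inter> space (M n) = space (M n)"
        using turn_inv space_circle[OF M(2)[of n]] by auto
      then have "measure (D n) {0<..1} = 1"
        unfolding D_def using m[of n] by (simp add: measure_distr prob_space)
      then show ?thesis using \<open>0 < \<epsilon>\<close> by simp
    qed
    then show "\<exists>a b. a < b \<and> (\<forall>n. 1 - \<epsilon> < measure (D n) {a<..b})"
      by (intro exI[of _ 0] exI[of _ 1]) auto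
  qed (use rd in auto)
  from tight_imp_convergent_subsubsequence[OF this strict_mono_id]
  obtain r K where r: "strict_mono (r :: nat \<Rightarrow> nat)" and K: "real_distribution K" and wc: "weak_conv_m (D \<circ> r) K"
    by auto
  interpret K: real_distribution K by fact
  have tm: "turn \<in> measurable K circle_borel" 
    using turn_measurable measurable_cong_sets[OF K.events_eq_borel refl] by blast
  define N where "N = distr K circle_borel turn"
  show thesis
  proof (rule that[of r N])
    show "prob_space N" unfolding N_def by (rule K.prob_space_distr[OF tm])
    show setsN: "sets N = sets circle_borel" by (simp add: N_def)
    fix f :: "complex \<Rightarrow> complex" assume f: "continuous_on (sphere 0 1) f"
    have ft: "continuous_on UNIV (\<lambda>x. f (turn x))"
      by (rule continuous_on_compose2[OF f continuous_turn]) auto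
    have "bounded (f ` sphere 0 1)" by (intro compact_imp_bounded compact_continuous_image f) simp
    then obtain B where B: "\<And>x. x \<in> sphere 0 1 \<Longrightarrow> norm (f x) \<le> B" unfolding bounded_iff by blast
    have "(\<lambda>n. integral\<^sup>L ((D \<circ> r) n) (\<lambda>x. f (turn x))) \<longlonglongrightarrow> integral\<^sup>L K (\<lambda>x. f (turn x))"
      by (rule weak_conv_imp_integral_bdd_continuous_conv[OF _ K wc, where B=B])
        (use rd ft B in \<open>auto simp: continuous_on_eq_continuous_at\<close>)
    moreover have "integral\<^sup>L K (\<lambda>x. f (turn x)) = integral\<^sup>L N f"
      unfolding N_def by (rule integral_distr[OF tm circle_measurable[OF refl f], symmetric])
    moreover have "integral\<^sup>L ((D \<circ> r) n) (\<lambda>x. f (turn x)) = integral\<^sup>L (M (r n)) f" for n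
    proof -
      have "integral\<^sup>L ((D \<circ> r) n) (\<lambda>x. f (turn x)) = integral\<^sup>L (M (r n)) (\<lambda>\<xi>. f (turn (turn_inv \<xi>)))"
        unfolding D_def comp_def 
        by (rule integral_distr[OF m]) (rule borel_measurable_continuous_onI[OF ft])
      also have "\<dots> = integral\<^sup>L (M (r n)) f"
        by (rule Bochner_Integration.integral_cong) (use turn_inv space_circle[OF M(2)[of "r n"]] in auto)
      finally show ?thesis .
    qed
    ultimately show "(\<lambda>n. integral\<^sup>L (M (r n)) f) \<longlonglongrightarrow> integral\<^sup>L N f" by simp
  qed (rule r)
qed

subsection \<open>Measures determined by their moments\<close>

lemma circle_measure_eqI_continuous:
  assumes M: "finite_measure M" "sets M = sets circle_borel"
    and N: "finite_measure N" "sets N = sets circle_borel"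
    and eq: "\<And>f :: complex \<Rightarrow> real. continuous_on (sphere 0 1) f \<Longrightarrow> integral\<^sup>L M f = integral\<^sup>L N f"
  shows "M = N"
proof -
  have lim: "(\<lambda>n. \<integral>\<xi>. max 0 (1 - real n * infdist \<xi> C) \<partial>K) \<longlonglongrightarrow> measure K (C \<inter> sphere 0 1)"
    if K: "finite_measure K" "sets K = sets circle_borel" and C: "closed C" "C \<noteq> {}" for K C
  proof -
    interpret finite_measure K by fact
    have "(\<lambda>n. \<integral>\<xi>. max 0 (1 - real n * infdist \<xi> C) \<partial>K) \<longlonglongrightarrow> (\<integral>\<xi>. indicator (C \<inter> sphere 0 1) \<xi> \<partial>K)"
    proof (rule integral_dominated_convergence[where w="\<lambda>_. 1"])
      have "C \<inter> sphere 0 1 \<in> sets K" using C by (auto simp: K sets_circle_iff)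
      then show "indicat_real (C \<inter> sphere 0 1) \<in> borel_measurable K" by simp
      show "(\<lambda>\<xi>. max 0 (1 - real n * infdist \<xi> C)) \<in> borel_measurable K" for n
        by (intro circle_measurable K continuous_intros)
      show "AE x in K. (\<lambda>i. max 0 (1 - real i * infdist x C)) \<longlonglongrightarrow> indicat_real (C \<inter> sphere 0 1) x"
      proof (rule AE_I2)
        fix x assume "x \<in> space K"
        then have x: "x \<in> sphere 0 1" by (simp add: space_circle[OF K(2)])
        show "(\<lambda>i. max 0 (1 - real i * infdist x C)) \<longlonglongrightarrow> indicat_real (C \<inter> sphere 0 1) x"
        proof (cases "x \<in> C")
          case True
          then have "infdist x C = 0" by simp
          then show ?thesis using x True by simp
        next
          case False
          then have pos: "0 < infdist x C" using in_closed_iff_infdist_zero[OF C] infdist_nonneg[of x C] by (simp add: less_le)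
          obtain n where n: "1 < real n * infdist x C" using reals_Archimedean3[OF pos] by blast
          have "\<forall>\<^sub>F i in sequentially. max 0 (1 - real i * infdist x C) = 0"
            using eventually_ge_at_top[of n]
          proof eventually_elim
            case (elim i)
            then have "real n * infdist x C \<le> real i * infdist x C" using pos by simp
            then show ?case using n by simp
          qed
          then show ?thesis using False by (simp add: tendsto_eventually)
        qed
      qed
    qed (auto simp: infdist_nonneg)
    then show ?thesis using C K space_circle[OF K(2)] by (simp add: Int_absorb2)
  qed
  define M' where "M' = distr M borel (\<lambda>x. x)"
  define N' where "N' = distr N borel (\<lambda>x. x)"
  have push: "measure (distr K borel (\<lambda>x. x)) E = measure K (E \<inter> sphere 0 1) \<and> finite_measure (distr K borel (\<lambda>x. x))"
    if K: "finite_measure K" "sets K = sets circle_borel" and E: "E \<in> sets borel" for K E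
  proof -
    interpret finite_measure K by fact
    have "(\<lambda>x. x) \<in> borel_measurable K" by (intro circle_measurable K continuous_intros)
    then show ?thesis using E space_circle[OF K(2)] by (auto simp: measure_distr finite_measure_distr)
  qed
  have "M' = N'"
  proof (rule measure_eqI_generator_eq[where E="Collect closed" and \<Omega>=UNIV and A="\<lambda>_. UNIV"])
    show "Int_stable (Collect closed :: complex set set)" by (auto simp: Int_stable_def)
    show "sets M' = sigma_sets UNIV (Collect closed)" "sets N' = sigma_sets UNIV (Collect closed)"
      by (auto simp: M'_def N'_def borel_eq_closed)
    show "emeasure M' UNIV \<noteq> \<infinity>"
      using push[OF M, of UNIV] finite_measure.emeasure_finite unfolding M'_def by auto
    fix C :: "complex set" assume "C \<in> Collect closed"
    then have C: "closed C" by simp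
    have "measure M (C \<inter> sphere 0 1) = measure N (C \<inter> sphere 0 1)"
    proof (cases "C = {}")
      case False
      have "integral\<^sup>L M (\<lambda>\<xi>. max 0 (1 - real n * infdist \<xi> C)) = integral\<^sup>L N (\<lambda>\<xi>. max 0 (1 - real n * infdist \<xi> C))" for n
        by (intro eq continuous_intros)
      then show ?thesis using lim[OF M C False] lim[OF N C False] LIMSEQ_unique by simp
    qed simp
    then show "emeasure M' C = emeasure N' C"
      using push[OF M, of C] push[OF N, of C] C 
      by (simp add: M'_def N'_def finite_measure.emeasure_eq_measure)
  qed auto
  then have *: "measure M (E \<inter> sphere 0 1) = measure N (E \<inter> sphere 0 1)" if "E \<in> sets borel" for E
    using push[OF M that] push[OF N that] by (simp add: M'_def N'_def)
  show ?thesis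
  proof (rule measure_eqI)
    show "sets M = sets N" using M N by simp
    fix E assume "E \<in> sets M"
    then have "E \<in> sets borel" "E \<inter> sphere 0 1 = E" using M by (auto simp: sets_circle_iff)
    then show "emeasure M E = emeasure N E"
      using *[of E] M(1) N(1) by (simp add: finite_measure.emeasure_eq_measure)
  qed
qed

text \<open>On the circle a real polynomial in the two coordinates is a Laurent polynomial, because
  \<open>cnj \<xi> = 1 / \<xi>\<close>.\<close>

lemma real_polynomial_on_circle:
  fixes f :: "complex \<Rightarrow> real"
  assumes "real_polynomial_function f"
  shows "\<exists>n p. \<forall>\<xi>\<in>sphere 0 1. of_real (f \<xi>) * \<xi> ^ n = poly p \<xi>"
  using assms
proof (induction f rule: real_polynomial_function.induct)
  case (linear f)
  interpret bounded_linear f by fact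
  define a b where "a = complex_of_real (f 1)" and "b = complex_of_real (f \<i>)"
  have "of_real (f \<xi>) * \<xi> ^ 1 = poly [:a / 2 - b / (2 * \<i>), 0, a / 2 + b / (2 * \<i>):] \<xi>" if "\<xi> \<in> sphere 0 1" for \<xi>
  proof -
    have "\<xi> = Re \<xi> *\<^sub>R 1 + Im \<xi> *\<^sub>R \<i>" by (simp add: complex_eq_iff)
    then have "f \<xi> = f (Re \<xi> *\<^sub>R 1 + Im \<xi> *\<^sub>R \<i>)" by simp
    also have "\<dots> = Re \<xi> * f 1 + Im \<xi> * f \<i>" unfolding add scaleR by simp
    finally have f: "complex_of_real (f \<xi>) = of_real (Re \<xi>) * a + of_real (Im \<xi>) * b" by (simp add: a_def b_def)
    have c: "\<xi> * cnj \<xi> = 1" using that by (simp add: complex_norm_square[symmetric])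
    have "complex_of_real (Re \<xi>) = (\<xi> + cnj \<xi>) / 2" using complex_add_cnj[of \<xi>] by simp
    then have "complex_of_real (Re \<xi>) * \<xi> = (\<xi> * \<xi> + \<xi> * cnj \<xi>) / 2" by (simp add: algebra_simps)
    then have re: "complex_of_real (Re \<xi>) * \<xi> = (\<xi>\<^sup>2 + 1) / 2" unfolding c power2_eq_square .
    have "complex_of_real (Im \<xi>) = (\<xi> - cnj \<xi>) / (2 * \<i>)"
      unfolding complex_diff_cnj eq_divide_eq by simp
    then have "complex_of_real (Im \<xi>) * \<xi> = (\<xi> * \<xi> - \<xi> * cnj \<xi>) / (2 * \<i>)" by (simp add: algebra_simps)
    then have im: "complex_of_real (Im \<xi>) * \<xi> = (\<xi>\<^sup>2 - 1) / (2 * \<i>)" unfolding c power2_eq_square .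
    have "of_real (f \<xi>) * \<xi> ^ 1 = a * (complex_of_real (Re \<xi>) * \<xi>) + b * (complex_of_real (Im \<xi>) * \<xi>)"
      by (simp add: f algebra_simps)
    also have "\<dots> = poly [:a / 2 - b / (2 * \<i>), 0, a / 2 + b / (2 * \<i>):] \<xi>"
      unfolding re im by (simp add: power2_eq_square field_simps)
    finally show ?thesis .
  qed
  then show ?case by blast
next
  case (const c)
  have "\<forall>\<xi>\<in>sphere 0 1. of_real c * \<xi> ^ 0 = poly [:of_real c:] \<xi>" by simp
  then show ?case by blast
next
  case (add f g)
  then obtain n p m q where "\<forall>\<xi>\<in>sphere 0 1. of_real (f \<xi>) * \<xi> ^ n = poly p \<xi>" "\<forall>\<xi>\<in>sphere 0 1. of_real (g \<xi>) * \<xi> ^ m = poly q \<xi>"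
    by blast
  moreover have "of_real (f \<xi> + g \<xi>) * \<xi> ^ (n + m) = (of_real (f \<xi>) * \<xi> ^ n) * \<xi> ^ m + (of_real (g \<xi>) * \<xi> ^ m) * \<xi> ^ n" for \<xi> :: complex
    by (simp add: power_add algebra_simps)
  ultimately have "\<forall>\<xi>\<in>sphere 0 1. of_real (f \<xi> + g \<xi>) * \<xi> ^ (n + m) = poly (p * monom 1 m + q * monom 1 n) \<xi>"
    by (intro ballI) (simp only: poly_monom poly_add poly_mult mult_1_left)
  then show ?case by blast
next
  case (mult f g)
  then obtain n p m q where "\<forall>\<xi>\<in>sphere 0 1. of_real (f \<xi>) * \<xi> ^ n = poly p \<xi>" "\<forall>\<xi>\<in>sphere 0 1. of_real (g \<xi>) * \<xi> ^ m = poly q \<xi>"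
    by blast
  moreover have "of_real (f \<xi> * g \<xi>) * \<xi> ^ (n + m) = (of_real (f \<xi>) * \<xi> ^ n) * (of_real (g \<xi>) * \<xi> ^ m)" for \<xi> :: complex
    by (simp only: power_add of_real_mult mult_ac)
  ultimately have "\<forall>\<xi>\<in>sphere 0 1. of_real (f \<xi> * g \<xi>) * \<xi> ^ (n + m) = poly (p * q) \<xi>"
    by (intro ballI) (simp only: poly_mult)
  then show ?case by blast
qed

text \<open>Moments determine the integrals of Laurent polynomials, which are dense by the Stone-Weierstrass
  theorem.\<close>

lemma circle_measure_eqI_moments:
  assumes M: "finite_measure M" "sets M = sets circle_borel"
    and N: "finite_measure N" "sets N = sets circle_borel"
    and moments: "\<And>k. (\<integral>\<xi>. \<xi> ^ k \<partial>M) = (\<integral>\<xi>. \<xi> ^ k \<partial>N)"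
  shows "M = N"
proof (rule circle_measure_eqI_continuous[OF M N])
  interpret M: finite_measure M by fact
  interpret N: finite_measure N by fact
  have iM: "integrable M f" if "continuous_on (sphere 0 1) f" for f :: "complex \<Rightarrow> complex"
    by (rule circle_integrable[OF M that])
  have iN: "integrable N f" if "continuous_on (sphere 0 1) f" for f :: "complex \<Rightarrow> complex"
    by (rule circle_integrable[OF N that])
  have laurent: "(\<integral>\<xi>. \<xi> ^ k * cnj \<xi> ^ n \<partial>M) = (\<integral>\<xi>. \<xi> ^ k * cnj \<xi> ^ n \<partial>N)" for k n
  proof -
    have c: "\<xi> * cnj \<xi> = 1" if "\<xi> \<in> sphere 0 1" for \<xi> :: complex
      using that by (simp add: complex_norm_square[symmetric])
    show ?thesis
    proof (cases "n \<le> k")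
      case True
      have "\<xi> ^ k * cnj \<xi> ^ n = \<xi> ^ (k - n)" if "\<xi> \<in> sphere 0 1" for \<xi>
      proof -
        have "\<xi> ^ k * cnj \<xi> ^ n = \<xi> ^ (k - n) * (\<xi> * cnj \<xi>) ^ n"
          using True by (simp add: power_mult_distrib power_add[symmetric] mult.assoc[symmetric])
        then show ?thesis using c[OF that] by simp
      qed
      then have "(\<integral>\<xi>. \<xi> ^ k * cnj \<xi> ^ n \<partial>K) = (\<integral>\<xi>. \<xi> ^ (k - n) \<partial>K)" if "sets K = sets circle_borel" for K
        using space_circle[OF that] by (intro Bochner_Integration.integral_cong) auto
      then show ?thesis using moments M N by simp
    next
      case False
      have "\<xi> ^ k * cnj \<xi> ^ n = cnj (\<xi> ^ (n - k))" if "\<xi> \<in> sphere 0 1" for \<xi>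
      proof -
        have "\<xi> ^ k * cnj \<xi> ^ n = (\<xi> * cnj \<xi>) ^ k * cnj \<xi> ^ (n - k)"
          using False by (simp add: power_mult_distrib power_add[symmetric] mult.assoc)
        then show ?thesis using c[OF that] by simp
      qed
      then have "(\<integral>\<xi>. \<xi> ^ k * cnj \<xi> ^ n \<partial>K) = cnj (\<integral>\<xi>. \<xi> ^ (n - k) \<partial>K)" if "sets K = sets circle_borel" for K
        using space_circle[OF that] by (subst Bochner_Integration.integral_cnj[symmetric]) (intro Bochner_Integration.integral_cong, auto)
      then show ?thesis using moments M N by simp
    qed
  qed
  have poly: "integral\<^sup>L M f = integral\<^sup>L N f" if f: "real_polynomial_function f" for f :: "complex \<Rightarrow> real"
  proof -
    obtain n p where np: "\<And>\<xi>. \<xi> \<in> sphere 0 1 \<Longrightarrow> of_real (f \<xi>) * \<xi> ^ n = poly p \<xi>"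
      using real_polynomial_on_circle[OF f] by blast
    have eq: "complex_of_real (f \<xi>) = (\<Sum>i\<le>degree p. coeff p i * (\<xi> ^ i * cnj \<xi> ^ n))" if "\<xi> \<in> sphere 0 1" for \<xi>
    proof -
      have c: "\<xi> * cnj \<xi> = 1" using that by (simp add: complex_norm_square[symmetric])
      have "complex_of_real (f \<xi>) = of_real (f \<xi>) * (\<xi> * cnj \<xi>) ^ n" using c by simp
      also have "\<dots> = poly p \<xi> * cnj \<xi> ^ n" using np[OF that] by (simp add: power_mult_distrib mult.assoc[symmetric])
      finally show ?thesis by (simp add: poly_altdef sum_distrib_right mult.assoc)
    qed
    have "complex_of_real (integral\<^sup>L K f) = (\<Sum>i\<le>degree p. coeff p i * (\<integral>\<xi>. \<xi> ^ i * cnj \<xi> ^ n \<partial>K))"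
      if K: "finite_measure K" "sets K = sets circle_borel" for K
    proof -
      have "complex_of_real (integral\<^sup>L K f) = (\<integral>\<xi>. complex_of_real (f \<xi>) \<partial>K)" by simp
      also have "\<dots> = (\<integral>\<xi>. (\<Sum>i\<le>degree p. coeff p i * (\<xi> ^ i * cnj \<xi> ^ n)) \<partial>K)"
        by (intro Bochner_Integration.integral_cong) (use eq space_circle[OF K(2)] in auto)
      also have "\<dots> = (\<Sum>i\<le>degree p. (\<integral>\<xi>. coeff p i * (\<xi> ^ i * cnj \<xi> ^ n) \<partial>K))"
        by (rule Bochner_Integration.integral_sum) (intro circle_integrable[OF K] continuous_intros)
      finally show ?thesis by simp
    qed
    from this[OF M] this[OF N] have "complex_of_real (integral\<^sup>L M f) = complex_of_real (integral\<^sup>L N f)"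
      using laurent by simp
    then show ?thesis by simp
  qed
  fix f :: "complex \<Rightarrow> real" assume f: "continuous_on (sphere 0 1) f"
  have bound: "\<bar>integral\<^sup>L M f - integral\<^sup>L N f\<bar> \<le> e * (measure M (space M) + measure N (space N))" if "0 < e" for e
  proof -
    obtain p where p: "real_polynomial_function p" "\<And>x. x \<in> sphere 0 1 \<Longrightarrow> \<bar>f x - p x\<bar> < e"
      using Stone_Weierstrass_real_polynomial_function[OF compact_sphere f \<open>0 < e\<close>] by metis
    have pc: "continuous_on (sphere 0 1) p" using p(1) continuous_on_polymonial_function real_polynomial_function_eq by blast
    have *: "\<bar>integral\<^sup>L K f - integral\<^sup>L K p\<bar> \<le> e * measure K (space K)"
      if K: "finite_measure K" "sets K = sets circle_borel" for K
    proof -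
      interpret finite_measure K by fact
      have "integral\<^sup>L K f - integral\<^sup>L K p = (\<integral>x. f x - p x \<partial>K)"
        by (rule Bochner_Integration.integral_diff[symmetric]) (intro circle_integrable K f pc)+
      also have "\<bar>\<dots>\<bar> \<le> (\<integral>x. \<bar>f x - p x\<bar> \<partial>K)" by (rule integral_abs_bound)
      also have "\<dots> \<le> (\<integral>x. e \<partial>K)"
        by (rule integral_mono) (use p(2) space_circle[OF K(2)] in \<open>auto intro!: circle_integrable K continuous_intros f pc simp: less_imp_le\<close>)
      finally show ?thesis by (simp add: mult.commute)
    qed
    show ?thesis using *[OF M] *[OF N] poly[OF p(1)] by (simp add: distrib_left)
  qed
  have "\<bar>integral\<^sup>L M f - integral\<^sup>L N f\<bar> \<le> 0 + e" if "0 < e" for e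
  proof -
    let ?c = "measure M (space M) + measure N (space N) + 1"
    have c: "0 < ?c" by (simp add: add_nonneg_pos)
    have "\<bar>integral\<^sup>L M f - integral\<^sup>L N f\<bar> \<le> e / ?c * (measure M (space M) + measure N (space N))"
      by (rule bound) (use that c in simp)
    also have "\<dots> \<le> e / ?c * ?c" by (intro mult_left_mono) (use that c in auto)
    finally show ?thesis using c by simp
  qed
  then have "\<bar>integral\<^sup>L M f - integral\<^sup>L N f\<bar> \<le> 0" by (rule field_le_epsilon)
  then show "integral\<^sup>L M f = integral\<^sup>L N f" by simp
qed

section \<open>The Herglotz representation\<close>

lemma circle_length_integral:
  fixes F :: "complex \<Rightarrow> complex"
  assumes F: "continuous_on (sphere 0 1) F"
    and I: "((\<lambda>\<zeta>. F \<zeta> / \<zeta>) has_contour_integral I) (circlepath 0 1)"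
  shows "(\<integral>\<xi>. F \<xi> \<partial>circle_length) = I / (2 * pi * \<i>)"
proof -
  let ?f = "\<lambda>x. F (turn x)"
  have f: "continuous_on UNIV ?f" by (rule continuous_on_compose2[OF F continuous_turn]) auto
  have turn: "exp (2 * complex_of_real pi * \<i> * complex_of_real x) = turn x" for x
    by (simp add: cis_conv_exp mult_ac)
  have "((\<lambda>x. F (circlepath 0 1 x) / circlepath 0 1 x * vector_derivative (circlepath 0 1) (at x within {0..1})) has_integral I) {0..1}"
    using I by (simp add: has_contour_integral_def)
  moreover have "F (circlepath 0 1 x) / circlepath 0 1 x * vector_derivative (circlepath 0 1) (at x within {0..1}) = 2 * pi * \<i> * ?f x"
    if "x \<in> {0..1}" for x
  proof -
    have "vector_derivative (circlepath 0 1) (at x within {0..1}) = 2 * pi * \<i> * turn x"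
      using that unfolding turn[symmetric] by (subst vector_derivative_circlepath01) auto
    moreover have "circlepath 0 1 x = turn x" unfolding turn[symmetric] circlepath by simp
    ultimately show ?thesis by (simp only:) simp
  qed
  ultimately have "((\<lambda>x. 2 * pi * \<i> * ?f x) has_integral I) {0..1}"
    using has_integral_cong[of "{0..1}"] by (metis (no_types, lifting))
  then have "((\<lambda>x. inverse (2 * pi * \<i>) * (2 * pi * \<i> * ?f x)) has_integral inverse (2 * pi * \<i>) * I) {0..1}"
    by (rule has_integral_mult_right)
  then have hi: "(?f has_integral I / (2 * pi * \<i>)) {0..1}"
    by (simp add: field_simps)
  have "(?f has_integral I / (2 * pi * \<i>)) {0<..1}"
  proof (subst has_integral_spike_set_eq[of _ "{0..1}"])
    show "negligible {x \<in> {0<..1} - {0..1}. ?f x \<noteq> 0}" by (rule negligible_subset[of "{}"]) auto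
    show "negligible {x \<in> {0..1} - {0<..1}. ?f x \<noteq> 0}" by (rule negligible_subset[of "{0}"]) auto
  qed (rule hi)
  then have I': "integral {0<..1} ?f = I / (2 * pi * \<i>)" by (rule integral_unique)
  have u: "uniform_measure lborel {0<..1::real} = density lborel (\<lambda>x. ennreal (indicator {0<..1} x))"
    unfolding uniform_measure_def by (intro density_cong) (auto simp: indicator_def divide_ennreal_def split: if_splits)
  have si: "set_integrable lborel {0..1} ?f"
    by (rule borel_integrable_atLeastAtMost') (use f continuous_on_subset in blast)
  have si': "set_integrable lborel {0<..1} ?f"
    by (rule set_integrable_subset[OF si]) auto
  have fm: "?f \<in> borel_measurable borel" by (rule borel_measurable_continuous_onI[OF f])
  have tm: "turn \<in> measurable (uniform_measure lborel {0<..1}) circle_borel"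
    using turn_measurable by simp
  have "(\<integral>\<xi>. F \<xi> \<partial>circle_length) = (\<integral>x. ?f x \<partial>uniform_measure lborel {0<..1})"
    unfolding circle_length_def by (rule integral_distr[OF tm circle_measurable[OF refl F]])
  also have "\<dots> = (\<integral>x. indicator {0<..1} x *\<^sub>R ?f x \<partial>lborel)"
    unfolding u by (rule integral_density) (use fm in auto)
  also have "\<dots> = set_lebesgue_integral lborel {0<..1} ?f" by (simp add: set_lebesgue_integral_def)
  also have "\<dots> = integral {0<..1} ?f" by (rule set_borel_integral_eq_integral(2)[OF si'])
  finally show ?thesis using I' by simp
qed

lemma circle_length_cauchy:
  assumes F: "continuous_on (cball 0 1) F" "F holomorphic_on ball 0 1" and v: "norm v < 1"
  shows "(\<integral>\<xi>. F \<xi> * ((\<xi> + v) / (\<xi> - v)) \<partial>circle_length) = 2 * F v - F 0"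
proof -
  have ne: "\<xi> \<noteq> v" "\<xi> \<noteq> 0" if "\<xi> \<in> sphere 0 1" for \<xi> using that v by auto
  have Fs: "continuous_on (sphere 0 1) F" using F(1) by (rule continuous_on_subset) auto
  have c: "continuous_on (sphere 0 1) (\<lambda>\<xi>. F \<xi> * ((\<xi> + v) / (\<xi> - v)))"
    using ne by (intro continuous_intros Fs) auto
  have "((\<lambda>u. F u / (u - v)) has_contour_integral (2 * of_real pi * \<i> * F v)) (circlepath 0 1)"
    by (rule Cauchy_integral_circlepath[OF F]) (use v in simp)
  moreover have "((\<lambda>u. F u / (u - 0)) has_contour_integral (2 * of_real pi * \<i> * F 0)) (circlepath 0 1)"
    by (rule Cauchy_integral_circlepath[OF F]) simp
  ultimately have "((\<lambda>u. 2 * (F u / (u - v)) - F u / (u - 0)) has_contour_integral (2 * (2 * of_real pi * \<i> * F v) - 2 * of_real pi * \<i> * F 0)) (circlepath 0 1)"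
    by (intro has_contour_integral_diff has_contour_integral_lmul)
  then have "((\<lambda>\<xi>. F \<xi> * ((\<xi> + v) / (\<xi> - v)) / \<xi>) has_contour_integral (2 * (2 * of_real pi * \<i> * F v) - 2 * of_real pi * \<i> * F 0)) (circlepath 0 1)"
  proof (rule has_contour_integral_eq)
    fix \<xi> assume "\<xi> \<in> path_image (circlepath 0 1)"
    then have "\<xi> \<in> sphere 0 1" by (auto simp: path_image_circlepath)
    then show "2 * (F \<xi> / (\<xi> - v)) - F \<xi> / (\<xi> - 0) = F \<xi> * ((\<xi> + v) / (\<xi> - v)) / \<xi>"
      using ne[of \<xi>] by (simp add: divide_simps) (simp add: algebra_simps)
  qed
  from circle_length_integral[OF c this] show ?thesis by (simp add: diff_divide_distrib)
qed

text \<open>Cauchy's formula gives \<open>2 q(u) - q(0)\<close> for the integral with \<open>q\<close> in place of its real part, and the mean value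
  property gives the conjugate of \<open>q(0)\<close> for the integral with the conjugate of \<open>q\<close>, because \<open>cnj \<circ> q \<circ> cnj\<close> is
  holomorphic.\<close>

lemma schwarz_formula:
  assumes q: "q holomorphic_on ball 0 R" and "1 < R" and q0: "Im (q 0) = 0" and u: "norm u < 1"
  shows "(\<integral>\<xi>. (1 + \<xi> * u) / (1 - \<xi> * u) * of_real (Re (q (cnj \<xi>))) \<partial>circle_length) = q u"
proof -
  define Q where "Q = cnj \<circ> q \<circ> cnj"
  have "cnj ` ball 0 R = ball 0 R" by (auto simp: image_iff intro!: bexI[of _ "cnj _"])
  then have Q: "Q holomorphic_on ball 0 R"
    unfolding Q_def using q by (intro holomorphic_on_compose_cnj_cnj) auto
  have Q1: "Q holomorphic_on ball 0 1" "continuous_on (cball 0 1) Q"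
    using Q \<open>1 < R\<close> by (auto intro: holomorphic_on_subset continuous_on_subset[OF holomorphic_on_imp_continuous_on])
  have ne: "1 - \<xi> * u \<noteq> 0" if "norm \<xi> \<le> 1" for \<xi>
  proof
    assume "1 - \<xi> * u = 0"
    then have "norm \<xi> * norm u = 1" by (metis eq_iff_diff_eq_0 norm_mult norm_one)
    moreover have "norm \<xi> * norm u \<le> 1 * norm u" by (rule mult_right_mono) (use that in auto)
    ultimately show False using u by simp
  qed
  have finlen: "finite_measure circle_length" 
    using prob_space_circle_length by (simp add: prob_space_def)
  have Qs: "continuous_on (sphere 0 1) Q" using Q1(2) by (rule continuous_on_subset) auto
  have kc: "continuous_on (sphere 0 1) (\<lambda>\<xi>. (1 + \<xi> * u) / (1 - \<xi> * u))"
    using ne by (intro continuous_intros) auto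
  have q': "q (cnj \<xi>) = cnj (Q \<xi>)" for \<xi> by (simp add: Q_def)
  have 1: "(\<integral>\<xi>. (1 + \<xi> * u) / (1 - \<xi> * u) * cnj (Q \<xi>) \<partial>circle_length) = 2 * q u - q 0"
  proof -
    have "(\<integral>\<xi>. (1 + \<xi> * u) / (1 - \<xi> * u) * cnj (Q \<xi>) \<partial>circle_length) 
        = (\<integral>\<xi>. cnj (Q \<xi> * ((\<xi> + cnj u) / (\<xi> - cnj u))) \<partial>circle_length)"
    proof (rule Bochner_Integration.integral_cong)
      fix \<xi> assume "\<xi> \<in> space circle_length"
      then have s: "\<xi> \<in> sphere 0 1" using space_circle[OF circle_length_sets] by simp
      then have c: "\<xi> * cnj \<xi> = 1" by (simp add: complex_norm_square[symmetric])
      have nz: "\<xi> \<noteq> 0" using s by auto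
      have "(cnj \<xi> + u) / (cnj \<xi> - u) = (\<xi> * (cnj \<xi> + u)) / (\<xi> * (cnj \<xi> - u))" using nz by simp
      also have "\<dots> = (1 + \<xi> * u) / (1 - \<xi> * u)" unfolding distrib_left right_diff_distrib c ..
      finally have k: "(cnj \<xi> + u) / (cnj \<xi> - u) = (1 + \<xi> * u) / (1 - \<xi> * u)" .
      have "cnj (Q \<xi> * ((\<xi> + cnj u) / (\<xi> - cnj u))) = cnj (Q \<xi>) * ((cnj \<xi> + u) / (cnj \<xi> - u))" by simp
      then show "(1 + \<xi> * u) / (1 - \<xi> * u) * cnj (Q \<xi>) = cnj (Q \<xi> * ((\<xi> + cnj u) / (\<xi> - cnj u)))"
        unfolding k by (simp only: mult.commute)
    qed simp
    also have "\<dots> = cnj (2 * Q (cnj u) - Q 0)"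
      unfolding Bochner_Integration.integral_cnj by (subst circle_length_cauchy[OF Q1(2,1)]) (use u in auto)
    finally show ?thesis by (simp add: Q_def)
  qed
  have 2: "(\<integral>\<xi>. (1 + \<xi> * u) / (1 - \<xi> * u) * Q \<xi> \<partial>circle_length) = cnj (q 0)"
  proof -
    have "(\<integral>\<xi>. (1 + \<xi> * u) / (1 - \<xi> * u) * Q \<xi> \<partial>circle_length) = 
        (\<integral>\<xi>. ((1 + \<xi> * u) / (1 - \<xi> * u) * Q \<xi>) * ((\<xi> + 0) / (\<xi> - 0)) \<partial>circle_length)"
      by (rule Bochner_Integration.integral_cong) (use space_circle[OF circle_length_sets] in auto)
    also have "\<dots> = 2 * ((1 + 0 * u) / (1 - 0 * u) * Q 0) - (1 + 0 * u) / (1 - 0 * u) * Q 0"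
      by (rule circle_length_cauchy) (use ne in \<open>auto intro!: continuous_intros holomorphic_intros Q1\<close>)
    finally show ?thesis by (simp add: Q_def)
  qed
  have "(\<integral>\<xi>. (1 + \<xi> * u) / (1 - \<xi> * u) * of_real (Re (q (cnj \<xi>))) \<partial>circle_length)
    = (\<integral>\<xi>. ((1 + \<xi> * u) / (1 - \<xi> * u) * cnj (Q \<xi>) + (1 + \<xi> * u) / (1 - \<xi> * u) * Q \<xi>) / 2 \<partial>circle_length)"
  proof (rule Bochner_Integration.integral_cong)
    fix \<xi>
    have "complex_of_real (Re (q (cnj \<xi>))) = (cnj (Q \<xi>) + Q \<xi>) / 2"
      unfolding q' by (simp add: complex_eq_iff)
    then show "(1 + \<xi> * u) / (1 - \<xi> * u) * of_real (Re (q (cnj \<xi>))) = 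
      ((1 + \<xi> * u) / (1 - \<xi> * u) * cnj (Q \<xi>) + (1 + \<xi> * u) / (1 - \<xi> * u) * Q \<xi>) / 2" 
      by (simp only: distrib_left[symmetric] times_divide_eq_right)
  qed simp
  also have "\<dots> = ((\<integral>\<xi>. (1 + \<xi> * u) / (1 - \<xi> * u) * cnj (Q \<xi>) \<partial>circle_length) + 
      (\<integral>\<xi>. (1 + \<xi> * u) / (1 - \<xi> * u) * Q \<xi> \<partial>circle_length)) / 2"
  proof -
    have "integrable circle_length (\<lambda>\<xi>. (1 + \<xi> * u) / (1 - \<xi> * u) * cnj (Q \<xi>))"
      "integrable circle_length (\<lambda>\<xi>. (1 + \<xi> * u) / (1 - \<xi> * u) * Q \<xi>)"
      by (intro circle_integrable finlen circle_length_sets continuous_on_mult kc Qs continuous_on_cnj)+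
    then show ?thesis by simp
  qed
  also have "\<dots> = q u" unfolding 1 2 using q0 by (simp add: complex_eq_iff)
  finally show ?thesis .
qed

text \<open>The measure is a weak limit of the real parts of \<open>q\<close> on circles of radius tending to \<open>1\<close>.
  The kernel is the one for which \<open>u = 1 / z\<close> turns the formula into one on the outside of the disk,
  with the measure on the boundary of the outside.\<close>

lemma herglotz_representation:
  assumes q: "q holomorphic_on ball 0 1" and pos: "\<And>u. norm u < 1 \<Longrightarrow> 0 \<le> Re (q u)" and q0: "q 0 = 1"
  obtains N where "prob_space N" "sets N = sets circle_borel"
    "\<And>u. norm u < 1 \<Longrightarrow> q u = (\<integral>\<xi>. (1 + \<xi> * u) / (1 - \<xi> * u) \<partial>N)"
proof -
  define r where "r = (\<lambda>n. real n / real (Suc n))"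
  have r: "0 \<le> r n" "r n < 1" for n by (auto simp: r_def)
  define qr where "qr = (\<lambda>n z. q (of_real (r n) * z))"
  have qr_holo: "qr n holomorphic_on ball 0 (if n = 0 then 2 else 1 / r n)" for n
  proof (cases "n = 0")
    case True
    then show ?thesis by (simp add: qr_def r_def)
  next
    case False
    then have rp: "0 < r n" by (simp add: r_def)
    have "(\<lambda>z. of_real (r n) * z) ` ball (0 :: complex) (1 / r n) \<subseteq> ball 0 1"
      using rp by (auto simp: dist_norm norm_mult field_simps)
    then have "q \<circ> (\<lambda>z. of_real (r n) * z) holomorphic_on ball 0 (1 / r n)"
      by (intro holomorphic_on_compose_gen[OF _ q] holomorphic_intros)
    then show ?thesis using False by (simp add: qr_def o_def)
  qed
  have R: "1 < (if n = 0 then 2 else 1 / r n)" for n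
    using r[of n] by (auto simp: r_def)
  have schwarz: "(\<integral>\<xi>. (1 + \<xi> * u) / (1 - \<xi> * u) * of_real (Re (qr n (cnj \<xi>))) \<partial>circle_length) = qr n u"
    if "norm u < 1" for n u
    by (rule schwarz_formula[OF qr_holo R _ that]) (simp add: qr_def q0)
  have le1: "norm (of_real (r n) * z) < 1" if "norm z \<le> 1" for n and z :: complex
  proof -
    have "norm (of_real (r n) * z) = r n * norm z" using r[of n] by (simp add: norm_mult)
    also have "\<dots> \<le> r n * 1" by (rule mult_left_mono) (use that r in auto)
    finally show ?thesis using r[of n] by simp
  qed
  have nonneg: "0 \<le> Re (qr n (cnj \<xi>))" if "\<xi> \<in> sphere 0 1" for n \<xi>
    unfolding qr_def by (rule pos, rule le1) (use that in simp)
  interpret cl: prob_space circle_length by (rule prob_space_circle_length)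
  have dcont: "continuous_on (sphere 0 1) (\<lambda>\<xi>. Re (qr n (cnj \<xi>)))" for n
    unfolding qr_def using le1
    by (intro continuous_intros continuous_on_compose2[OF holomorphic_on_imp_continuous_on[OF q]]) auto
  define M where "M = (\<lambda>n. density circle_length (\<lambda>\<xi>. ennreal (Re (qr n (cnj \<xi>)))))"
  have setsM: "sets (M n) = sets circle_borel" for n by (simp add: M_def circle_length_sets)
  have int_M: "integral\<^sup>L (M n) f = (\<integral>\<xi>. f \<xi> * of_real (Re (qr n (cnj \<xi>))) \<partial>circle_length)"
    if f: "continuous_on (sphere 0 1) f" for f :: "complex \<Rightarrow> complex" and n
  proof -
    have "integral\<^sup>L (M n) f = (\<integral>\<xi>. Re (qr n (cnj \<xi>)) *\<^sub>R f \<xi> \<partial>circle_length)"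
      unfolding M_def by (rule integral_density)
        (use nonneg space_circle[OF circle_length_sets] in \<open>auto intro!: circle_measurable circle_length_sets f dcont\<close>)
    then show ?thesis by (simp add: scaleR_conv_of_real mult.commute)
  qed
  have probM: "prob_space (M n)" for n
  proof
    have i: "integrable circle_length (\<lambda>\<xi>. Re (qr n (cnj \<xi>)))"
      by (rule circle_integrable[OF cl.finite_measure_axioms circle_length_sets dcont])
    have "complex_of_real (\<integral>\<xi>. Re (qr n (cnj \<xi>)) \<partial>circle_length) = (\<integral>\<xi>. (1 + \<xi> * 0) / (1 - \<xi> * 0) * of_real (Re (qr n (cnj \<xi>))) \<partial>circle_length)"
      by simp
    also have "\<dots> = 1" by (subst schwarz) (auto simp: qr_def q0)
    finally have "(\<integral>\<xi>. Re (qr n (cnj \<xi>)) \<partial>circle_length) = 1" by (simp only: of_real_eq_1_iff)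
    moreover have "emeasure (M n) (space (M n)) = ennreal (\<integral>\<xi>. Re (qr n (cnj \<xi>)) \<partial>circle_length)"
    proof -
      have "emeasure (M n) (space (M n)) = (\<integral>\<^sup>+\<xi>. ennreal (Re (qr n (cnj \<xi>))) \<partial>circle_length)"
        unfolding M_def
        by (subst emeasure_density)
          (auto intro!: nn_integral_cong circle_measurable circle_length_sets dcont measurable_compose[OF _ measurable_ennreal] simp: indicator_def)
      also have "\<dots> = ennreal (\<integral>\<xi>. Re (qr n (cnj \<xi>)) \<partial>circle_length)"
        by (rule nn_integral_eq_integral[OF i]) (use nonneg space_circle[OF circle_length_sets] in auto)
      finally show ?thesis .
    qed
    ultimately show "emeasure (M n) (space (M n)) = 1" by simp
  qed
  obtain s N where s: "strict_mono s" and N: "prob_space N" "sets N = sets circle_borel"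
    and lim: "\<And>f :: complex \<Rightarrow> complex. continuous_on (sphere 0 1) f \<Longrightarrow> (\<lambda>n. integral\<^sup>L (M (s n)) f) \<longlonglongrightarrow> integral\<^sup>L N f"
  proof (rule circle_weak_compactness[of M, OF probM setsM])
    fix s N assume a: "strict_mono (s :: nat \<Rightarrow> nat)" "prob_space N" "sets N = sets circle_borel"
      "\<And>f :: complex \<Rightarrow> complex. continuous_on (sphere 0 1) f \<Longrightarrow> (\<lambda>n. integral\<^sup>L (M (s n)) f) \<longlonglongrightarrow> integral\<^sup>L N f"
    show thesis by (rule that[OF a])
  qed
  show thesis
  proof (rule that[OF N])
    fix u :: complex assume u: "norm u < 1"
    have ne: "1 - \<xi> * u \<noteq> 0" if "\<xi> \<in> sphere 0 1" for \<xi>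
    proof
      assume "1 - \<xi> * u = 0"
      then have "norm \<xi> * norm u = 1" by (metis eq_iff_diff_eq_0 norm_mult norm_one)
      then show False using u that by simp
    qed
    have kc: "continuous_on (sphere 0 1) (\<lambda>\<xi>. (1 + \<xi> * u) / (1 - \<xi> * u))"
      using ne by (intro continuous_intros) auto
    have "(\<lambda>n. qr (s n) u) \<longlonglongrightarrow> (\<integral>\<xi>. (1 + \<xi> * u) / (1 - \<xi> * u) \<partial>N)"
      using lim[OF kc] unfolding int_M[OF kc] schwarz[OF u] .
    moreover have "(\<lambda>n. qr (s n) u) \<longlonglongrightarrow> q u"
    proof -
      have "r \<longlonglongrightarrow> 1" unfolding r_def by (rule LIMSEQ_n_over_Suc_n)
      then have "(\<lambda>n. of_real (r (s n)) * u) \<longlonglongrightarrow> of_real 1 * u"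
        by (intro tendsto_intros LIMSEQ_subseq_LIMSEQ[OF _ s, unfolded o_def])
      moreover have "isCont q (of_real 1 * u)"
        using holomorphic_on_imp_continuous_on[OF q] u by (simp add: continuous_on_eq_continuous_at)
      ultimately have "(\<lambda>n. q (of_real (r (s n)) * u)) \<longlonglongrightarrow> q (of_real 1 * u)"
        by (rule isCont_tendsto_compose[rotated])
      then show ?thesis unfolding qr_def by simp
    qed
    ultimately show "q u = (\<integral>\<xi>. (1 + \<xi> * u) / (1 - \<xi> * u) \<partial>N)" by (rule LIMSEQ_unique[rotated])
  qed
qed

section \<open>The Herglotz transform on the outside of the disk\<close>

text \<open>The Herglotz transform of the reflected measure; the conjugation in the statement of the theorem and
  the inversion of the kernel cancel.\<close>

definition outer_herglotz :: "complex measure \<Rightarrow> complex \<Rightarrow> complex" where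
  "outer_herglotz M z = (\<integral>\<xi>. (z + \<xi>) / (z - \<xi>) \<partial>M)"

lemma outer_kernel_ne: "1 < norm z \<Longrightarrow> \<xi> \<in> sphere 0 1 \<Longrightarrow> z - \<xi> \<noteq> (0::complex)"
  by auto

lemma outer_kernel_cont: "1 < norm z \<Longrightarrow> continuous_on (sphere 0 1) (\<lambda>\<xi>. (z + \<xi>) / (z - \<xi> :: complex))"
  using outer_kernel_ne by (intro continuous_intros) auto

lemma herglotz_conj_pullback:
  assumes "sets M = sets circle_borel" "1 < norm z"
  shows "herglotz (conj_pullback M) z = outer_herglotz M z"
proof -
  have z: "z \<noteq> 0" using assms(2) by auto
  have m: "cnj \<in> measurable M M"
  proof -
    have "cnj \<in> measurable circle_borel circle_borel"
      by (intro measurable_restrict_space2 measurable_restrict_space1 borel_measurable_continuous_onI continuous_intros)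
        (auto simp: space_restrict_space)
    then show ?thesis using measurable_cong_sets[OF assms(1) assms(1)] by simp
  qed
  have kc: "continuous_on (sphere 0 1) (\<lambda>\<xi>. (\<xi> + 1 / z) / (\<xi> - 1 / z))"
  proof (intro continuous_intros ballI)
    fix \<xi> :: complex assume "\<xi> \<in> sphere 0 1"
    then have "norm \<xi> = 1" by simp
    moreover have "norm (1 / z) < 1" using assms(2) by (simp add: norm_divide divide_less_eq)
    ultimately show "\<xi> - 1 / z \<noteq> 0" by auto
  qed
  have "herglotz (conj_pullback M) z = (\<integral>\<xi>. (cnj \<xi> + 1 / z) / (cnj \<xi> - 1 / z) \<partial>M)"
    unfolding herglotz_def conj_pullback_def
    by (rule integral_distr[OF m circle_measurable[OF assms(1) kc]])
  also have "\<dots> = outer_herglotz M z" unfolding outer_herglotz_def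
  proof (rule Bochner_Integration.integral_cong)
    fix \<xi> assume "\<xi> \<in> space M"
    then have s: "\<xi> \<in> sphere 0 1" using space_circle[OF assms(1)] by simp
    then have c: "\<xi> * cnj \<xi> = 1" by (simp add: complex_norm_square[symmetric])
    have nz: "\<xi> * z \<noteq> 0" using s z by auto
    have "(cnj \<xi> + 1 / z) / (cnj \<xi> - 1 / z) = ((\<xi> * z) * (cnj \<xi> + 1 / z)) / ((\<xi> * z) * (cnj \<xi> - 1 / z))"
      using nz by simp
    also have "(\<xi> * z) * (cnj \<xi> + 1 / z) = (\<xi> * cnj \<xi>) * z + \<xi>" using z by (simp add: algebra_simps)
    also have "(\<xi> * z) * (cnj \<xi> - 1 / z) = (\<xi> * cnj \<xi>) * z - \<xi>" using z by (simp add: algebra_simps)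
    finally show "(cnj \<xi> + 1 / z) / (cnj \<xi> - 1 / z) = (z + \<xi>) / (z - \<xi>)" unfolding c by simp
  qed simp
  finally show ?thesis .
qed

lemma outer_herglotz_inverse:
  assumes "u \<noteq> 0"
  shows "outer_herglotz M (1 / u) = (\<integral>\<xi>. (1 + \<xi> * u) / (1 - \<xi> * u) \<partial>M)"
proof -
  have "(1 / u + \<xi>) / (1 / u - \<xi>) = (1 + \<xi> * u) / (1 - \<xi> * u)" for \<xi>
  proof -
    have "(1 / u + \<xi>) / (1 / u - \<xi>) = (u * (1 / u + \<xi>)) / (u * (1 / u - \<xi>))" using assms by simp
    then show ?thesis using assms by (simp add: algebra_simps)
  qed
  then show ?thesis by (simp add: outer_herglotz_def)
qed

lemma outer_kernel_norm_le:
  fixes z \<xi> :: complex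
  assumes "1 < norm z" "norm \<xi> = 1"
  shows "norm ((z + \<xi>) / (z - \<xi>)) \<le> (norm z + 1) / (norm z - 1)"
proof -
  have "norm (z + \<xi>) \<le> norm z + 1" using norm_triangle_ineq[of z \<xi>] assms by simp
  moreover have "norm z - 1 \<le> norm (z - \<xi>)" using norm_triangle_ineq2[of z \<xi>] assms by simp
  ultimately show ?thesis unfolding norm_divide using assms by (intro frac_le) auto
qed

lemma outer_herglotz_norm_le:
  assumes M: "prob_space M" "sets M = sets circle_borel" and z: "1 < norm z"
  shows "norm (outer_herglotz M z) \<le> (norm z + 1) / (norm z - 1)"
proof -
  interpret prob_space M by fact
  have "norm (outer_herglotz M z) \<le> (\<integral>\<xi>. norm ((z + \<xi>) / (z - \<xi>)) \<partial>M)"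
    unfolding outer_herglotz_def by (rule integral_norm_bound)
  also have "\<dots> \<le> (\<integral>\<xi>. (norm z + 1) / (norm z - 1) \<partial>M)"
    using outer_kernel_norm_le[OF z] space_circle[OF M(2)] 
    by (intro integral_mono circle_integrable[OF finite_measure_axioms M(2)] continuous_on_norm outer_kernel_cont z) auto
  finally show ?thesis by (simp add: prob_space)
qed

lemma outer_kernel_lipschitz:
  fixes z z' \<xi> :: complex
  assumes "r \<le> norm z" "r \<le> norm z'" "1 < r" "norm \<xi> = 1"
  shows "norm ((z + \<xi>) / (z - \<xi>) - (z' + \<xi>) / (z' - \<xi>)) \<le> 2 / (r - 1)\<^sup>2 * norm (z - z')"
proof -
  have a: "r - 1 \<le> norm (z - \<xi>)" using norm_triangle_ineq2[of z \<xi>] assms by simp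
  have b: "r - 1 \<le> norm (z' - \<xi>)" using norm_triangle_ineq2[of z' \<xi>] assms by simp
  have nz: "z - \<xi> \<noteq> 0" "z' - \<xi> \<noteq> 0" using a b assms by auto
  have "(z + \<xi>) / (z - \<xi>) - (z' + \<xi>) / (z' - \<xi>) = 2 * \<xi> * (z' - z) / ((z - \<xi>) * (z' - \<xi>))"
    using nz by (simp add: divide_simps) (simp add: algebra_simps)
  then have "norm ((z + \<xi>) / (z - \<xi>) - (z' + \<xi>) / (z' - \<xi>)) = 2 * norm (z - z') / (norm (z - \<xi>) * norm (z' - \<xi>))"
    using assms by (simp add: norm_divide norm_mult norm_minus_commute)
  also have "\<dots> \<le> 2 * norm (z - z') / ((r - 1) * (r - 1))"
    using a b assms by (intro divide_left_mono mult_mono mult_pos_pos) auto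
  finally show ?thesis by (simp add: power2_eq_square)
qed

lemma outer_herglotz_lipschitz:
  assumes M: "prob_space M" "sets M = sets circle_borel" and z: "r \<le> norm z" "r \<le> norm z'" "1 < r"
  shows "norm (outer_herglotz M z - outer_herglotz M z') \<le> 2 / (r - 1)\<^sup>2 * norm (z - z')"
proof -
  interpret prob_space M by fact
  have z1: "1 < norm z" "1 < norm z'" using z by auto
  have i: "integrable M (\<lambda>\<xi>. (z + \<xi>) / (z - \<xi>))" if "1 < norm z" for z
    by (intro circle_integrable[OF finite_measure_axioms M(2)] outer_kernel_cont that)
  have "outer_herglotz M z - outer_herglotz M z' = (\<integral>\<xi>. (z + \<xi>) / (z - \<xi>) - (z' + \<xi>) / (z' - \<xi>) \<partial>M)"
    unfolding outer_herglotz_def using i[OF z1(1)] i[OF z1(2)] by simp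
  also have "norm \<dots> \<le> (\<integral>\<xi>. norm ((z + \<xi>) / (z - \<xi>) - (z' + \<xi>) / (z' - \<xi>)) \<partial>M)"
    by (rule integral_norm_bound)
  also have "\<dots> \<le> (\<integral>\<xi>. 2 / (r - 1)\<^sup>2 * norm (z - z') \<partial>M)"
    using outer_kernel_lipschitz[OF z] space_circle[OF M(2)] 
    by (intro integral_mono circle_integrable[OF finite_measure_axioms M(2)] continuous_on_norm continuous_on_diff outer_kernel_cont z1) auto
  finally show ?thesis by (simp add: prob_space)
qed

text \<open>The moments of a measure can be read off its transform.\<close>

lemma circle_measure_eqI_herglotz:
  assumes M: "finite_measure M" "sets M = sets circle_borel"
    and N: "finite_measure N" "sets N = sets circle_borel"
    and eq: "\<And>u. norm u < 1 \<Longrightarrow> (\<integral>\<xi>. (1 + \<xi> * u) / (1 - \<xi> * u) \<partial>M) = (\<integral>\<xi>. (1 + \<xi> * u) / (1 - \<xi> * u) \<partial>N)"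
  shows "M = N"
proof -
  define T where "T = (\<lambda>(K :: complex measure) k u. \<integral>\<xi>. \<xi> ^ k / (1 - \<xi> * u) \<partial>K)"
  have ne: "1 - \<xi> * u \<noteq> 0" if "norm u < 1" "\<xi> \<in> sphere 0 1" for u \<xi> :: complex
  proof
    assume "1 - \<xi> * u = 0"
    then have "norm \<xi> * norm u = 1" by (metis eq_iff_diff_eq_0 norm_mult norm_one)
    then show False using that by simp
  qed
  have kc: "continuous_on (sphere 0 1) (\<lambda>\<xi>. \<xi> ^ k / (1 - \<xi> * u))" if "norm u < 1" for k and u :: complex
    using ne[OF that] by (intro continuous_intros) auto
  have T0: "T K k 0 = (\<integral>\<xi>. \<xi> ^ k \<partial>K)" for K k by (simp add: T_def)
  have rec: "T K k u = T K k 0 + u * T K (Suc k) u"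
    if K: "finite_measure K" "sets K = sets circle_borel" and u: "norm u < 1" for K k u
  proof -
    have "T K k u = (\<integral>\<xi>. \<xi> ^ k + u * (\<xi> ^ Suc k / (1 - \<xi> * u)) \<partial>K)"
      unfolding T_def
    proof (rule Bochner_Integration.integral_cong)
      fix \<xi> assume "\<xi> \<in> space K"
      then have "1 - \<xi> * u \<noteq> 0" using ne[OF u] space_circle[OF K(2)] by simp
      then show "\<xi> ^ k / (1 - \<xi> * u) = \<xi> ^ k + u * (\<xi> ^ Suc k / (1 - \<xi> * u))"
        by (simp add: field_simps)
    qed simp
    also have "\<dots> = (\<integral>\<xi>. \<xi> ^ k \<partial>K) + u * (\<integral>\<xi>. \<xi> ^ Suc k / (1 - \<xi> * u) \<partial>K)"
    proof -
      have "integrable K (\<lambda>\<xi>. \<xi> ^ k)" "integrable K (\<lambda>\<xi>. u * (\<xi> ^ Suc k / (1 - \<xi> * u)))"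
        by (intro circle_integrable[OF K] continuous_intros kc[OF u])+
      then show ?thesis by (simp only: Bochner_Integration.integral_add integral_mult_right_zero)
    qed
    finally show ?thesis unfolding T0 unfolding T_def .
  qed
  have lim: "(\<lambda>n. T K k (of_real (1 / real (n + 2)))) \<longlonglongrightarrow> T K k 0"
    if K: "finite_measure K" "sets K = sets circle_borel" for K k
  proof (rule LIM_zero_cancel, rule Lim_null_comparison)
    interpret finite_measure K by fact
    show "\<forall>\<^sub>F n in sequentially. norm (T K k (of_real (1 / real (n + 2))) - T K k 0) \<le> 2 * measure K (space K) * (1 / real (n + 2))"
    proof (intro always_eventually allI)
      fix n
      define u where "u = complex_of_real (1 / real (n + 2))"
      have nu: "norm u = 1 / real (n + 2)" unfolding u_def norm_of_real by simp
      have u: "norm u \<le> 1 / 2" unfolding nu by (rule divide_left_mono) auto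
      have "norm (T K (Suc k) u) \<le> (\<integral>\<xi>. norm (\<xi> ^ Suc k / (1 - \<xi> * u)) \<partial>K)"
        unfolding T_def by (rule integral_norm_bound)
      also have "\<dots> \<le> (\<integral>\<xi>. 2 \<partial>K)"
      proof (rule integral_mono)
        show "integrable K (\<lambda>\<xi>. norm (\<xi> ^ Suc k / (1 - \<xi> * u)))"
          using u by (intro circle_integrable[OF K] continuous_on_norm kc) auto
        show "norm (\<xi> ^ Suc k / (1 - \<xi> * u)) \<le> 2" if "\<xi> \<in> space K" for \<xi>
        proof -
          have x: "norm \<xi> = 1" using that space_circle[OF K(2)] by simp
          have "1 / 2 \<le> norm (1 - \<xi> * u)" using norm_triangle_ineq2[of 1 "\<xi> * u"] x u by (simp add: norm_mult)
          moreover from this have "0 < norm (1 - \<xi> * u)" by linarith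
          ultimately show ?thesis unfolding norm_divide norm_power x power_one by (simp add: divide_le_eq)
        qed
      qed auto
      finally have T: "norm (T K (Suc k) u) \<le> 2 * measure K (space K)" by (simp add: mult.commute)
      have "T K k u - T K k 0 = u * T K (Suc k) u" using rec[OF K, of u k] u by simp
      then have "norm (T K k u - T K k 0) = 1 / real (n + 2) * norm (T K (Suc k) u)" by (simp add: norm_mult nu)
      also have "\<dots> \<le> 1 / real (n + 2) * (2 * measure K (space K))" by (rule mult_left_mono[OF T]) simp
      finally show "norm (T K k (of_real (1 / real (n + 2))) - T K k 0) \<le> 2 * measure K (space K) * (1 / real (n + 2))"
        unfolding u_def[symmetric] by (simp add: mult.commute)
    qed
    have "(\<lambda>n. 1 / real (n + 2)) \<longlonglongrightarrow> 0"
      using LIMSEQ_ignore_initial_segment[OF lim_1_over_n[where 'a=real], of 2] by simp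
    then show "(\<lambda>n. 2 * measure K (space K) * (1 / real (n + 2))) \<longlonglongrightarrow> 0"
      by (rule tendsto_mult_right_zero)
  qed
  have base: "T M 0 u = T N 0 u" if u: "norm u < 1" for u
  proof -
    have *: "(\<integral>\<xi>. (1 + \<xi> * u) / (1 - \<xi> * u) \<partial>K) = 2 * T K 0 u - T K 0 0"
      if K: "finite_measure K" "sets K = sets circle_borel" and u: "norm u < 1" for K u
    proof -
      have "(\<integral>\<xi>. (1 + \<xi> * u) / (1 - \<xi> * u) \<partial>K) = (\<integral>\<xi>. 2 * (\<xi> ^ 0 / (1 - \<xi> * u)) - \<xi> ^ 0 \<partial>K)"
      proof (rule Bochner_Integration.integral_cong)
        fix \<xi> assume "\<xi> \<in> space K"
        then have "1 - \<xi> * u \<noteq> 0" using ne[OF u] space_circle[OF K(2)] by simp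
        then show "(1 + \<xi> * u) / (1 - \<xi> * u) = 2 * (\<xi> ^ 0 / (1 - \<xi> * u)) - \<xi> ^ 0"
          by (simp add: field_simps)
      qed simp
      also have "\<dots> = 2 * (\<integral>\<xi>. \<xi> ^ 0 / (1 - \<xi> * u) \<partial>K) - (\<integral>\<xi>. \<xi> ^ 0 \<partial>K)"
      proof -
        have "integrable K (\<lambda>\<xi>. \<xi> ^ 0 :: complex)" "integrable K (\<lambda>\<xi>. 2 * (\<xi> ^ 0 / (1 - \<xi> * u)))"
          by (intro circle_integrable[OF K] continuous_intros kc[OF u])+
        then show ?thesis by (simp only: Bochner_Integration.integral_diff integral_mult_right_zero)
      qed
      finally show ?thesis unfolding T0 unfolding T_def .
    qed
    have "T M 0 0 = T N 0 0" using eq[of 0] *[OF M, of 0] *[OF N, of 0] by simp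
    then show ?thesis using eq[OF u] *[OF M u] *[OF N u] by simp
  qed
  have T: "T M k u = T N k u" if "norm u < 1" for k u
    using that
  proof (induction k arbitrary: u)
    case (Suc k)
    have nz: "T M (Suc k) u = T N (Suc k) u" if "norm u < 1" "u \<noteq> 0" for u
      using rec[OF M that(1), of k] rec[OF N that(1), of k] Suc.IH[OF that(1)] Suc.IH[of 0] that by simp
    have "(\<lambda>n. T M (Suc k) (of_real (1 / real (n + 2)))) = (\<lambda>n. T N (Suc k) (of_real (1 / real (n + 2))))"
    proof
      fix n
      have "norm (complex_of_real (1 / real (n + 2))) < 1" unfolding norm_of_real by simp
      moreover have "complex_of_real (1 / real (n + 2)) \<noteq> 0"
        by (simp only: of_real_eq_0_iff) simp
      ultimately show "T M (Suc k) (of_real (1 / real (n + 2))) = T N (Suc k) (of_real (1 / real (n + 2)))"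
        by (rule nz)
    qed
    then have "T M (Suc k) 0 = T N (Suc k) 0" using lim[OF M, of "Suc k"] lim[OF N, of "Suc k"] LIMSEQ_unique by metis
    then show ?case using nz[of u] Suc.prems by (cases "u = 0") auto
  qed (use base in auto)
  show ?thesis by (rule circle_measure_eqI_moments[OF M N]) (use T[of 0] in \<open>simp add: T0\<close>)
qed

lemma herglotz_integral_holomorphic:
  assumes K: "finite_measure K" "sets K = sets circle_borel"
  shows "(\<lambda>u. \<integral>\<xi>. (1 + \<xi> * u) / (1 - \<xi> * u) \<partial>K) holomorphic_on ball 0 1"
proof -
  interpret finite_measure K by fact
  let ?H = "\<lambda>u. \<integral>\<xi>. (1 + \<xi> * u) / (1 - \<xi> * u) \<partial>K"
  have sp: "space K = sphere 0 1" by (rule space_circle[OF K(2)])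
  have ne: "1 - \<xi> * u \<noteq> 0" if "norm u < 1" "\<xi> \<in> sphere 0 1" for u \<xi> :: complex
  proof
    assume "1 - \<xi> * u = 0"
    then have "norm \<xi> * norm u = 1" by (metis eq_iff_diff_eq_0 norm_mult norm_one)
    then show False using that by simp
  qed
  have kc: "continuous_on (sphere 0 1) (\<lambda>\<xi>. (1 + \<xi> * u) / (1 - \<xi> * u))" if "norm u < 1" for u :: complex
    using ne[OF that] by (intro continuous_intros) auto
  have "(?H has_field_derivative (\<integral>\<xi>. 2 * \<xi> / (1 - \<xi> * u)\<^sup>2 \<partial>K)) (at u within ball 0 1)"
    if u: "u \<in> ball 0 1" for u
    unfolding has_field_derivative_iff tendsto_at_iff_sequentially
  proof (intro allI impI)
    fix X :: "nat \<Rightarrow> complex" assume X: "\<forall>i. X i \<in> ball 0 1 - {u}" and Xu: "X \<longlonglongrightarrow> u"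
    have nu: "norm u < 1" using u by simp
    have nX: "norm (X i) < 1" "X i \<noteq> u" for i using X by auto
    define d where "d = (1 - norm u) / 2"
    have d: "0 < d" using nu by (simp add: d_def)
    have quot: "(?H (X i) - ?H u) / (X i - u) = (\<integral>\<xi>. 2 * \<xi> / ((1 - \<xi> * X i) * (1 - \<xi> * u)) \<partial>K)" for i
    proof -
      have i: "integrable K (\<lambda>\<xi>. (1 + \<xi> * u) / (1 - \<xi> * u))" if "norm u < 1" for u
        by (rule circle_integrable[OF K kc[OF that]])
      have "(?H (X i) - ?H u) / (X i - u) = (\<integral>\<xi>. ((1 + \<xi> * X i) / (1 - \<xi> * X i) - (1 + \<xi> * u) / (1 - \<xi> * u)) / (X i - u) \<partial>K)"
        using i[OF nX(1)[of i]] i[OF nu] by simp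
      also have "\<dots> = (\<integral>\<xi>. 2 * \<xi> / ((1 - \<xi> * X i) * (1 - \<xi> * u)) \<partial>K)"
      proof (rule Bochner_Integration.integral_cong)
        fix \<xi> assume "\<xi> \<in> space K"
        then have n: "1 - \<xi> * u \<noteq> 0" "1 - \<xi> * X i \<noteq> 0" "X i - u \<noteq> 0" using ne nu nX sp by auto
        have "(1 + \<xi> * X i) / (1 - \<xi> * X i) - (1 + \<xi> * u) / (1 - \<xi> * u) = 2 * \<xi> * (X i - u) / ((1 - \<xi> * X i) * (1 - \<xi> * u))"
          using n by (simp add: divide_simps) (simp add: algebra_simps)
        then show "((1 + \<xi> * X i) / (1 - \<xi> * X i) - (1 + \<xi> * u) / (1 - \<xi> * u)) / (X i - u) = 2 * \<xi> / ((1 - \<xi> * X i) * (1 - \<xi> * u))"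
          using n by simp
      qed simp
      finally show ?thesis .
    qed
    have "\<forall>\<^sub>F i in sequentially. dist (X i) u < d" using Xu d by (rule tendstoD)
    then obtain m where m: "\<And>i. m \<le> i \<Longrightarrow> dist (X i) u < d" unfolding eventually_sequentially by blast
    have low: "d \<le> norm (1 - \<xi> * X (i + m))" "d \<le> norm (1 - \<xi> * u)" if "\<xi> \<in> sphere 0 1" for \<xi> i
    proof -
      have "norm (X (i + m)) \<le> norm u + d" using m[of "i + m"] norm_triangle_ineq2[of "X (i + m)" u] by (simp add: dist_norm)
      then have "norm (X (i + m)) \<le> 1 - d" by (simp add: d_def field_simps)
      then show "d \<le> norm (1 - \<xi> * X (i + m))" 
        using norm_triangle_ineq2[of 1 "\<xi> * X (i + m)"] that by (simp add: norm_mult)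
      have "norm u \<le> 1 - d" using nu by (simp add: d_def field_simps)
      then show "d \<le> norm (1 - \<xi> * u)"
        using norm_triangle_ineq2[of 1 "\<xi> * u"] that by (simp add: norm_mult)
    qed
    have "(\<lambda>i. \<integral>\<xi>. 2 * \<xi> / ((1 - \<xi> * X (i + m)) * (1 - \<xi> * u)) \<partial>K) \<longlonglongrightarrow> (\<integral>\<xi>. 2 * \<xi> / (1 - \<xi> * u)\<^sup>2 \<partial>K)"
    proof (rule integral_dominated_convergence[where w="\<lambda>_. 2 / (d * d)"])
      show "(\<lambda>\<xi>. 2 * \<xi> / (1 - \<xi> * u)\<^sup>2) \<in> borel_measurable K"
        using ne[OF nu] by (intro circle_measurable[OF K(2)] continuous_intros) auto
      show "(\<lambda>\<xi>. 2 * \<xi> / ((1 - \<xi> * X (i + m)) * (1 - \<xi> * u))) \<in> borel_measurable K" for i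
        using ne[OF nu] ne[OF nX(1)] by (intro circle_measurable[OF K(2)] continuous_intros) auto
      show "AE \<xi> in K. (\<lambda>i. 2 * \<xi> / ((1 - \<xi> * X (i + m)) * (1 - \<xi> * u))) \<longlonglongrightarrow> 2 * \<xi> / (1 - \<xi> * u)\<^sup>2"
      proof (rule AE_I2)
        fix \<xi> assume "\<xi> \<in> space K"
        then have n: "1 - \<xi> * u \<noteq> 0" using ne nu sp by auto
        show "(\<lambda>i. 2 * \<xi> / ((1 - \<xi> * X (i + m)) * (1 - \<xi> * u))) \<longlonglongrightarrow> 2 * \<xi> / (1 - \<xi> * u)\<^sup>2"
          unfolding power2_eq_square
          by (intro tendsto_intros LIMSEQ_ignore_initial_segment Xu) (use n in auto)
      qed
      show "AE \<xi> in K. norm (2 * \<xi> / ((1 - \<xi> * X (i + m)) * (1 - \<xi> * u))) \<le> 2 / (d * d)" for i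
      proof (rule AE_I2)
        fix \<xi> assume "\<xi> \<in> space K"
        then have s: "\<xi> \<in> sphere 0 1" using sp by simp
        have "d * d \<le> norm (1 - \<xi> * X (i + m)) * norm (1 - \<xi> * u)"
          using low[OF s] d by (intro mult_mono) auto
        then show "norm (2 * \<xi> / ((1 - \<xi> * X (i + m)) * (1 - \<xi> * u))) \<le> 2 / (d * d)"
          unfolding norm_divide norm_mult using s d by (intro frac_le) auto
      qed
    qed simp
    then have "(\<lambda>i. \<integral>\<xi>. 2 * \<xi> / ((1 - \<xi> * X i) * (1 - \<xi> * u)) \<partial>K) \<longlonglongrightarrow> (\<integral>\<xi>. 2 * \<xi> / (1 - \<xi> * u)\<^sup>2 \<partial>K)"
      by (rule LIMSEQ_offset)
    then show "((\<lambda>y. (?H y - ?H u) / (y - u)) \<circ> X) \<longlonglongrightarrow> (\<integral>\<xi>. 2 * \<xi> / (1 - \<xi> * u)\<^sup>2 \<partial>K)"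
      unfolding comp_def quot .
  qed
  then show ?thesis unfolding holomorphic_on_def field_differentiable_def by blast
qed

text \<open>By the Schwarz formula on circles of radius close to \<open>1\<close>, a Herglotz transform is controlled by its real
  part near the circle, so two measures whose transforms have asymptotically the same real part coincide.\<close>

lemma circle_measure_eqI_Re_boundary:
  assumes M: "finite_measure M" "sets M = sets circle_borel"
    and N: "finite_measure N" "sets N = sets circle_borel"
    and r0: "1 < r0" and bound: "\<And>z. 1 < norm z \<Longrightarrow> norm z < r0 \<Longrightarrow> 
      \<bar>Re (outer_herglotz M z) - Re (outer_herglotz N z)\<bar> \<le> c * ln (norm z)"
  shows "M = N"
proof (rule circle_measure_eqI_herglotz[OF M N])
  fix u :: complex assume u: "norm u < 1"
  define D where "D = (\<lambda>u. (\<integral>\<xi>. (1 + \<xi> * u) / (1 - \<xi> * u) \<partial>M) - (\<integral>\<xi>. (1 + \<xi> * u) / (1 - \<xi> * u) \<partial>N))"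
  have D: "D holomorphic_on ball 0 1"
    unfolding D_def by (intro holomorphic_intros herglotz_integral_holomorphic M N)
  have D0: "Im (D 0) = 0" by (simp add: D_def)
  have ReD: "\<bar>Re (D v)\<bar> \<le> c * ln (1 / norm v)" if v: "1 / r0 < norm v" "norm v < 1" for v
  proof -
    have nz: "v \<noteq> 0" using v r0 by auto
    have "1 < norm (1 / v)" "norm (1 / v) < r0" using v r0 nz by (auto simp: norm_divide field_simps)
    from bound[OF this] show ?thesis 
      unfolding D_def outer_herglotz_inverse[OF nz] by (simp add: norm_divide)
  qed
  interpret cl: prob_space circle_length by (rule prob_space_circle_length)
  have ne: "1 - \<xi> * u \<noteq> 0" if "\<xi> \<in> sphere 0 1" for \<xi>
  proof
    assume "1 - \<xi> * u = 0"
    then have "norm \<xi> * norm u = 1" by (metis eq_iff_diff_eq_0 norm_mult norm_one)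
    then show False using that u by simp
  qed
  define B where "B = 2 / (1 - norm u)"
  have B: "norm ((1 + \<xi> * u) / (1 - \<xi> * u)) \<le> B" if "\<xi> \<in> sphere 0 1" for \<xi>
  proof -
    have "norm (1 + \<xi> * u) \<le> 2" using norm_triangle_ineq[of 1 "\<xi> * u"] that u by (simp add: norm_mult)
    moreover have "1 - norm u \<le> norm (1 - \<xi> * u)" using norm_triangle_ineq2[of 1 "\<xi> * u"] that by (simp add: norm_mult)
    ultimately show ?thesis unfolding B_def norm_divide using u by (intro frac_le) auto
  qed
  have est: "norm (D (of_real \<rho> * u)) \<le> B * (c * ln (1 / \<rho>))" if \<rho>: "1 / r0 < \<rho>" "\<rho> < 1" for \<rho>
  proof -
    have \<rho>0: "0 < \<rho>" using \<rho> r0 by (meson divide_pos_pos less_trans zero_less_one)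
    have bn: "norm (of_real \<rho> * z) = \<rho> * norm z" for z :: complex using \<rho>0 by (simp add: norm_mult)
    have img: "(\<lambda>z. of_real \<rho> * z) ` ball (0 :: complex) (1 / \<rho>) \<subseteq> ball 0 1"
      by (intro image_subsetI) (simp add: bn pos_less_divide_eq[OF \<rho>0] mult.commute[of \<rho>])
    have "D \<circ> (\<lambda>z. of_real \<rho> * z) holomorphic_on ball 0 (1 / \<rho>)"
      by (intro holomorphic_on_compose_gen[OF _ D img] holomorphic_intros)
    then have hol: "(\<lambda>z. D (of_real \<rho> * z)) holomorphic_on ball 0 (1 / \<rho>)" by (simp add: o_def)
    have eq: "(\<integral>\<xi>. (1 + \<xi> * u) / (1 - \<xi> * u) * of_real (Re (D (of_real \<rho> * cnj \<xi>))) \<partial>circle_length) = D (of_real \<rho> * u)"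
      by (rule schwarz_formula[OF hol _ _ u]) (use \<rho> \<rho>0 D0 in auto)
    have cont: "continuous_on (sphere 0 1) (\<lambda>\<xi>. (1 + \<xi> * u) / (1 - \<xi> * u) * of_real (Re (D (of_real \<rho> * cnj \<xi>))))"
      using ne \<rho> \<rho>0
      by (intro continuous_intros continuous_on_compose2[OF holomorphic_on_imp_continuous_on[OF D]]) (auto simp: bn)
    have "norm (D (of_real \<rho> * u)) \<le> (\<integral>\<xi>. norm ((1 + \<xi> * u) / (1 - \<xi> * u) * of_real (Re (D (of_real \<rho> * cnj \<xi>)))) \<partial>circle_length)"
      unfolding eq[symmetric] by (rule integral_norm_bound)
    also have "\<dots> \<le> (\<integral>\<xi>. B * (c * ln (1 / \<rho>)) \<partial>circle_length)"
    proof (rule integral_mono)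
      show "integrable circle_length (\<lambda>\<xi>. norm ((1 + \<xi> * u) / (1 - \<xi> * u) * of_real (Re (D (of_real \<rho> * cnj \<xi>)))))"
        by (rule circle_integrable[OF cl.finite_measure_axioms circle_length_sets continuous_on_norm[OF cont]])
      fix \<xi> assume "\<xi> \<in> space circle_length"
      then have s: "\<xi> \<in> sphere 0 1" using space_circle[OF circle_length_sets] by simp
      have n: "norm (of_real \<rho> * cnj \<xi>) = \<rho>" using s bn[of "cnj \<xi>"] by simp
      have "\<bar>Re (D (of_real \<rho> * cnj \<xi>))\<bar> \<le> c * ln (1 / \<rho>)" using ReD[of "of_real \<rho> * cnj \<xi>"] \<rho> unfolding n by simp
      then show "norm ((1 + \<xi> * u) / (1 - \<xi> * u) * of_real (Re (D (of_real \<rho> * cnj \<xi>)))) \<le> B * (c * ln (1 / \<rho>))"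
        unfolding norm_mult norm_of_real using B[OF s] by (intro mult_mono) (auto simp: B_def u less_imp_le)
    qed auto
    finally show ?thesis using cl.prob_space by simp
  qed
  have r1: "1 / r0 < 1" using r0 by simp
  have ev: "\<forall>\<^sub>F \<rho> in at_left 1. norm (D (of_real \<rho> * u)) \<le> B * (c * ln (1 / \<rho>))"
    using eventually_at_left_real[OF r1] by eventually_elim (use est in auto)
  have "((\<lambda>\<rho>. B * (c * ln (1 / \<rho>))) \<longlongrightarrow> B * (c * ln (1 / 1))) (at_left 1)"
    by (intro tendsto_intros) auto
  then have "((\<lambda>\<rho>. D (of_real \<rho> * u)) \<longlongrightarrow> 0) (at_left 1)"
    by (intro Lim_null_comparison[OF ev]) simp
  moreover have "((\<lambda>\<rho>. D (of_real \<rho> * u)) \<longlongrightarrow> D (of_real 1 * u)) (at_left 1)"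
  proof (rule isCont_tendsto_compose[of "of_real 1 * u" D])
    show "isCont D (of_real 1 * u)" 
      using holomorphic_on_imp_continuous_on[OF D] u by (simp add: continuous_on_eq_continuous_at)
    show "((\<lambda>\<rho>. of_real \<rho> * u) \<longlongrightarrow> of_real 1 * u) (at_left 1)" by (intro tendsto_intros)
  qed
  ultimately have "D u = 0" using tendsto_unique[of "at_left (1::real)"] by (metis mult_1 of_real_1 trivial_limit_at_left_real)
  then show "(\<integral>\<xi>. (1 + \<xi> * u) / (1 - \<xi> * u) \<partial>M) = (\<integral>\<xi>. (1 + \<xi> * u) / (1 - \<xi> * u) \<partial>N)" by (simp add: D_def)
qed

section \<open>Lifting an analytic circle diffeomorphism\<close>

text \<open>The logarithmic derivative with respect to the angle.\<close>

definition angular_deriv :: "(complex \<Rightarrow> complex) \<Rightarrow> complex \<Rightarrow> complex" where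
  "angular_deriv g z = z * deriv g z / g z"

lemma turn_has_vector_derivative: "(turn has_vector_derivative (2 * pi * \<i> * turn x)) (at x)"
proof -
  have "((\<lambda>x. exp (of_real x * (2 * pi * \<i>))) has_vector_derivative (2 * pi * \<i>) * exp (of_real x * (2 * pi * \<i>))) (at x)"
    by (auto intro!: derivative_eq_intros has_vector_derivative_real_field)
  moreover have "exp (of_real x * (2 * pi * \<i>)) = turn x" for x
    by (simp add: cis_conv_exp mult_ac)
  ultimately show ?thesis by simp
qed

text \<open>Near \<open>x\<close> the lift is a branch of the logarithm of \<open>g \<circ> turn\<close>, up to a constant. Its derivative is the
  angular derivative of \<open>g\<close>, which is therefore real.\<close>

lemma lift_derivative:
  assumes g: "g field_differentiable at (turn x)" and gx: "norm (g (turn x)) = 1"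
    and cont: "continuous_on UNIV G" and semi: "\<And>x. g (turn x) = turn (G x)"
  shows "(G has_real_derivative Re (angular_deriv g (turn x))) (at x)" "Im (angular_deriv g (turn x)) = 0"
proof -
  let ?t = "turn x" and ?b = "angular_deriv g (turn x)"
  define \<rho> where "\<rho> = (\<lambda>y. g (turn y) / g ?t)"
  have gnz: "g ?t \<noteq> 0" using gx by auto
  have "(g has_field_derivative deriv g ?t) (at ?t)" using g by (simp add: DERIV_deriv_iff_field_differentiable)
  from field_vector_diff_chain_at[OF turn_has_vector_derivative this]
  have "((\<lambda>y. g (turn y)) has_vector_derivative (2 * pi * \<i> * ?t) * deriv g ?t) (at x)" by (simp add: o_def)
  from has_vector_derivative_mult_right[OF this, of "1 / g ?t"]
  have d1: "(\<rho> has_vector_derivative 1 / g ?t * ((2 * pi * \<i> * ?t) * deriv g ?t)) (at x)" 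
    by (simp add: \<rho>_def)
  have \<rho>x: "\<rho> x = 1" using gnz by (simp add: \<rho>_def)
  then have L: "Ln (\<rho> x) = 0" by simp
  from \<rho>x have "(Ln has_field_derivative 1) (at (\<rho> x))" 
    using has_field_derivative_Ln[of "\<rho> x"] by (simp add: complex_nonpos_Reals_iff)
  from field_vector_diff_chain_at[OF d1 this]
  have "((\<lambda>y. Ln (\<rho> y)) has_vector_derivative 2 * pi * \<i> * ?b) (at x)"
    by (simp add: o_def angular_deriv_def mult_ac)
  moreover have "\<forall>\<^sub>F y in at x. Ln (\<rho> y) = 2 * pi * \<i> * of_real (G y - G x)"
  proof -
    have "(G \<longlongrightarrow> G x) (at x)" using cont by (simp add: continuous_on_def)
    then have "\<forall>\<^sub>F y in at x. dist (G y) (G x) < 1 / 2" by (rule tendstoD) simp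
    then show ?thesis
    proof eventually_elim
      case (elim y)
      have "\<rho> y = exp (2 * pi * \<i> * of_real (G y - G x))"
        unfolding \<rho>_def semi by (simp add: cis_conv_exp algebra_simps exp_diff)
      moreover have "Ln (exp (2 * pi * \<i> * of_real (G y - G x))) = 2 * pi * \<i> * of_real (G y - G x)"
      proof (rule Ln_exp)
        have "\<bar>G y - G x\<bar> < 1 / 2" using elim by (simp only: dist_real_def)
        then have "2 * pi * \<bar>G y - G x\<bar> < 2 * pi * (1 / 2)"
          by (intro mult_strict_left_mono) auto
        moreover have "\<bar>2 * pi * (G y - G x)\<bar> = 2 * pi * \<bar>G y - G x\<bar>" by (simp only: abs_mult) simp
        ultimately have "\<bar>2 * pi * (G y - G x)\<bar> < pi" by simp
        then have *: "- pi < 2 * pi * (G y - G x) \<and> 2 * pi * (G y - G x) < pi"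
          by (simp only: abs_less_iff minus_less_iff)
        have Im: "Im (2 * pi * \<i> * of_real (G y - G x)) = 2 * pi * (G y - G x)" by simp
        show "- pi < Im (2 * pi * \<i> * of_real (G y - G x))" unfolding Im using * by simp
        show "Im (2 * pi * \<i> * of_real (G y - G x)) \<le> pi" unfolding Im using * by simp
      qed
      ultimately show ?case by simp
    qed
  qed
  ultimately obtain \<delta> where \<delta>: "0 < \<delta>" "\<And>y. y \<noteq> x \<Longrightarrow> dist y x < \<delta> \<Longrightarrow> Ln (\<rho> y) = 2 * pi * \<i> * of_real (G y - G x)"
    and dL: "((\<lambda>y. Ln (\<rho> y)) has_vector_derivative 2 * pi * \<i> * ?b) (at x)"
    unfolding eventually_at by auto
  have "((\<lambda>y. 2 * pi * \<i> * of_real (G y - G x)) has_vector_derivative 2 * pi * \<i> * ?b) (at x)"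
  proof (rule has_vector_derivative_transform_within[OF dL \<delta>(1)])
    fix y assume "dist y x < \<delta>"
    then show "Ln (\<rho> y) = 2 * pi * \<i> * of_real (G y - G x)" using \<delta>(2)[of y] L by (cases "y = x") auto
  qed simp
  from has_vector_derivative_mult_right[OF this, of "1 / (2 * pi * \<i>)"]
  have "((\<lambda>y. 1 / (2 * pi * \<i>) * (2 * pi * \<i> * of_real (G y - G x))) has_vector_derivative 1 / (2 * pi * \<i>) * (2 * pi * \<i> * ?b)) (at x)" .
  moreover have "1 / (2 * pi * \<i>) * (2 * pi * \<i> * c) = c" for c :: complex by simp
  ultimately have d: "((\<lambda>y. complex_of_real (G y - G x)) has_vector_derivative ?b) (at x)" by (simp only:)
  from bounded_linear.has_vector_derivative[OF bounded_linear_Re d] 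
  have r: "((\<lambda>y. G y - G x) has_real_derivative Re ?b) (at x)" by (simp add: has_real_derivative_iff_has_vector_derivative)
  from DERIV_add[OF r DERIV_const[of "G x"]] show "(G has_real_derivative Re ?b) (at x)" by simp
  from bounded_linear.has_vector_derivative[OF bounded_linear_Im d]
  have "((\<lambda>y. 0::real) has_real_derivative Im ?b) (at x)" by (simp add: has_real_derivative_iff_has_vector_derivative)
  then show "Im ?b = 0" using DERIV_unique DERIV_const by blast
qed

text \<open>The derivative of the lift has no zeros and mean value \<open>1\<close>, so it is positive, and it coincides with the modulus
  of the complex derivative.\<close>

lemma Diff_omega_lift:
  assumes g: "g \<in> Diff_omega \<alpha>" and irr: "\<alpha> \<notin> \<rat>"
  shows "\<exists>G w L. lifted_diffeo G \<alpha> g w L"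
    and "\<And>\<xi>. \<xi> \<in> sphere 0 1 \<Longrightarrow> angular_deriv g \<xi> = of_real (norm (deriv g \<xi>))"
proof -
  have an: "g analytic_on sphere 0 1" and bij: "bij_betw g (sphere 0 1) (sphere 0 1)"
    and nz: "\<And>z. z \<in> sphere 0 1 \<Longrightarrow> deriv g z \<noteq> 0" and rot: "has_rotation_number g \<alpha>"
    using g by (auto simp: Diff_omega_def)
  obtain G where lift: "circle_lift g G" and rotG: "\<And>x. (\<lambda>n. ((G ^^ n) x - x) / real n) \<longlonglongrightarrow> \<alpha>"
    using rot unfolding has_rotation_number_def by blast
  have cont: "continuous_on UNIV G" and shift: "\<And>x. G (x + 1) = G x + 1" and semi: "\<And>x. g (turn x) = turn (G x)"
    using lift unfolding circle_lift_def by auto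
  obtain V where V: "open V" "sphere 0 1 \<subseteq> V" "g holomorphic_on V" using an unfolding analytic_on_holomorphic by blast
  have fd: "g field_differentiable at \<xi>" if "\<xi> \<in> sphere 0 1" for \<xi>
    using V that holomorphic_on_imp_differentiable_at by blast
  have n1: "norm (g \<xi>) = 1" if "\<xi> \<in> sphere 0 1" for \<xi> using bij_betwE[OF bij] that by auto
  have S: "turn x \<in> sphere 0 1" for x by simp
  define w where "w = (\<lambda>x. Re (angular_deriv g (turn x)))"
  have dG: "(G has_real_derivative w x) (at x)" and im: "Im (angular_deriv g (turn x)) = 0" for x
    using lift_derivative[OF fd[OF S] n1[OF S] cont semi] by (auto simp: w_def)
  have absw: "\<bar>w x\<bar> = norm (deriv g (turn x))" for x
  proof -
    have "\<bar>w x\<bar> = norm (angular_deriv g (turn x))" using im[of x] by (simp add: w_def cmod_def)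
    also have "\<dots> = norm (deriv g (turn x))" using n1[OF S[of x]] by (simp add: angular_deriv_def norm_mult norm_divide)
    finally show ?thesis .
  qed
  define B where "B = angular_deriv g"
  define V' where "V' = V \<inter> {z \<in> V. g z \<noteq> 0}"
  have V': "open V'" "sphere 0 1 \<subseteq> V'"
  proof -
    have "open (V \<inter> g -` (- {0}))"
      by (rule continuous_open_preimage[OF holomorphic_on_imp_continuous_on[OF V(3)] V(1)]) auto
    moreover have "V \<inter> g -` (- {0}) = V'" by (auto simp: V'_def)
    ultimately show "open V'" by simp
    show "sphere 0 1 \<subseteq> V'" using V(2) n1 by (fastforce simp: V'_def)
  qed
  have gV': "g holomorphic_on V'" using V(3) by (rule holomorphic_on_subset) (auto simp: V'_def)
  have dgV': "deriv g holomorphic_on V'" by (rule holomorphic_deriv[OF gV' V'(1)])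
  have B: "B holomorphic_on V'"
    unfolding B_def angular_deriv_def using gV' dgV' by (auto intro!: holomorphic_intros simp: V'_def)
  have dB: "deriv B holomorphic_on V'" by (rule holomorphic_deriv[OF B V'(1)])
  have "continuous_on (sphere 0 1) (deriv B)"
    using holomorphic_on_imp_continuous_on[OF dB] V'(2) continuous_on_subset by blast
  then have "bounded (deriv B ` sphere 0 1)" by (intro compact_imp_bounded compact_continuous_image) auto
  then obtain K where K: "\<And>\<xi>. \<xi> \<in> sphere 0 1 \<Longrightarrow> norm (deriv B \<xi>) \<le> K" unfolding bounded_iff by blast
  have dcont: "continuous_on (sphere 0 1) (deriv g)"
    using holomorphic_on_imp_continuous_on[OF dgV'] V'(2) continuous_on_subset by blast
  have wlip: "\<bar>w x - w y\<bar> \<le> 2 * pi * K * \<bar>x - y\<bar>" for x y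
  proof -
    have "norm (B (turn x) - B (turn y)) \<le> 2 * pi * K * norm (x - y)"
    proof (rule differentiable_bound[of UNIV "\<lambda>x. B (turn x)" "\<lambda>x h. h *\<^sub>R (2 * pi * \<i> * turn x * deriv B (turn x))"])
      fix x :: real
      have "(B has_field_derivative deriv B (turn x)) (at (turn x))"
        using B V' S[of x] by (meson DERIV_deriv_iff_field_differentiable holomorphic_on_imp_differentiable_at subsetD)
      from field_vector_diff_chain_at[OF turn_has_vector_derivative this]
      show "((\<lambda>x. B (turn x)) has_derivative (\<lambda>h. h *\<^sub>R (2 * pi * \<i> * turn x * deriv B (turn x)))) (at x within UNIV)"
        by (simp add: o_def has_vector_derivative_def)
      show "onorm (\<lambda>h. h *\<^sub>R (2 * pi * \<i> * turn x * deriv B (turn x))) \<le> 2 * pi * K"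
      proof (rule onorm_le)
        fix h :: real
        have "norm (h *\<^sub>R (2 * pi * \<i> * turn x * deriv B (turn x))) = 2 * pi * norm (deriv B (turn x)) * norm h"
          by (simp add: norm_mult)
        also have "\<dots> \<le> 2 * pi * K * norm h" using K[OF S[of x]] by (intro mult_right_mono mult_left_mono) auto
        finally show "norm (h *\<^sub>R (2 * pi * \<i> * turn x * deriv B (turn x))) \<le> 2 * pi * K * norm h" .
      qed
    qed auto
    moreover have "\<bar>w x - w y\<bar> \<le> norm (B (turn x) - B (turn y))"
      using abs_Re_le_cmod[of "B (turn x) - B (turn y)"] by (simp add: w_def B_def)
    ultimately show ?thesis by simp
  qed
  have wcont: "continuous_on UNIV w"
  proof -
    have "continuous_on (sphere 0 1) B"
      using holomorphic_on_imp_continuous_on[OF B] V'(2) continuous_on_subset by blast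
    then have "continuous_on UNIV (\<lambda>x. B (turn x))" by (rule continuous_on_compose2[OF _ continuous_turn]) auto
    then show ?thesis unfolding w_def B_def by (intro continuous_intros)
  qed
  have wnz: "w x \<noteq> 0" for x using absw[of x] nz[OF S[of x]] by auto
  have wpos: "0 < w x" for x
  proof (rule ccontr)
    assume "\<not> 0 < w x"
    obtain z where "G 1 - G 0 = (1 - 0) * w z" using MVT2[of 0 1 G w] dG by auto
    then have z: "w z = 1" using shift[of 0] by simp
    have "connected (range w)" by (rule connected_continuous_image[OF wcont]) simp
    then have "0 \<in> range w" 
      using connectedD_interval[of "range w" "w x" "w z" 0] \<open>\<not> 0 < w x\<close> z by simp
    then obtain y where "w y = 0" by auto
    then show False using wnz by blast
  qed
  have speed: "norm (deriv g (turn x)) = w x" for x using absw[of x] wpos[of x] by simp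
  show "angular_deriv g \<xi> = of_real (norm (deriv g \<xi>))" if "\<xi> \<in> sphere 0 1" for \<xi>
  proof -
    obtain x where x: "\<xi> = turn x" using turn_surj[OF \<open>\<xi> \<in> sphere 0 1\<close>] .
    show ?thesis unfolding x speed using im[of x] by (simp add: w_def complex_eq_iff)
  qed
  have "\<exists>m>0. \<forall>x. m \<le> w x"
  proof -
    have "continuous_on (sphere 0 1) (\<lambda>\<xi>. norm (deriv g \<xi>))" by (intro continuous_intros dcont)
    then obtain \<xi>0 where \<xi>0: "\<xi>0 \<in> sphere 0 1" "\<And>\<xi>. \<xi> \<in> sphere 0 1 \<Longrightarrow> norm (deriv g \<xi>0) \<le> norm (deriv g \<xi>)"
      using continuous_attains_inf[of "sphere 0 (1::real) :: complex set" "\<lambda>\<xi>. norm (deriv g \<xi>)"] by auto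
    then show ?thesis using nz[OF \<xi>0(1)] speed S by (intro exI[of _ "norm (deriv g \<xi>0)"]) (metis zero_less_norm_iff)
  qed
  then obtain m where m: "0 < m" "\<And>x. m \<le> w x" by blast
  have Kp: "0 \<le> K" using K[OF S[of 0]] norm_ge_zero order_trans by blast
  define L where "L = 2 * pi * K / m"
  have Lp: "0 \<le> L" using Kp m by (simp add: L_def)
  have lip: "w x \<le> exp (L * \<bar>x - y\<bar>) * w y" for x y
  proof -
    have "w x \<le> w y + 2 * pi * K * \<bar>x - y\<bar>" using wlip[of x y] by linarith
    also have "2 * pi * K * \<bar>x - y\<bar> = L * \<bar>x - y\<bar> * m" using m by (simp add: L_def)
    also have "\<dots> \<le> L * \<bar>x - y\<bar> * w y" using m(2)[of y] Lp by (intro mult_left_mono) auto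
    also have "w y + L * \<bar>x - y\<bar> * w y = (1 + L * \<bar>x - y\<bar>) * w y" by (simp add: distrib_right)
    also have "\<dots> \<le> exp (L * \<bar>x - y\<bar>) * w y" 
      by (intro mult_right_mono exp_ge_add_one_self) (use wpos[of y] in simp)
    finally show ?thesis by simp
  qed
  have "strict_mono G"
  proof (rule strict_monoI)
    fix x y :: real assume "x < y"
    then show "G x < G y" by (rule DERIV_pos_imp_increasing) (use dG wpos in blast)
  qed
  then have "lifted_diffeo G \<alpha> g w L"
    using cont shift rotG irr bij dcont semi wpos dG speed Lp lip
      holomorphic_on_imp_continuous_on[OF V(3)] V(2) continuous_on_subset
    by unfold_locales blast+
  then show "\<exists>G w L. lifted_diffeo G \<alpha> g w L" by blast
qed

section \<open>A maximum principle on annuli\<close>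

definition closed_annulus :: "real \<Rightarrow> complex set" where
  "closed_annulus R = {z. 1 \<le> norm z \<and> norm z \<le> R}"

definition open_annulus :: "real \<Rightarrow> complex set" where
  "open_annulus R = {z. 1 < norm z \<and> norm z < R}"

lemma open_open_annulus: "open (open_annulus R)"
  unfolding open_annulus_def by (intro open_Collect_conj open_Collect_less continuous_intros)

lemma closed_closed_annulus: "closed (closed_annulus R)"
  unfolding closed_annulus_def by (intro closed_Collect_conj closed_Collect_le continuous_intros)

lemma open_annulus_subset: "open_annulus R \<subseteq> closed_annulus R"
  by (auto simp: open_annulus_def closed_annulus_def)

lemma annulus_modulus_upper:
  assumes "1 < R" and cont: "continuous_on (closed_annulus R) F" and hol: "F holomorphic_on open_annulus R"
    and nz: "\<And>z. z \<in> closed_annulus R \<Longrightarrow> F z \<noteq> 0"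
    and inner: "\<And>z. norm z = 1 \<Longrightarrow> norm (F z) \<le> 1"
    and outer: "\<And>z. norm z = R \<Longrightarrow> ln (norm (F z)) \<le> M"
    and Nk: "real N * M \<le> real k * ln R"
    and z: "z \<in> open_annulus R"
  shows "real N * ln (norm (F z)) \<le> real k * ln (norm z)"
proof -
  have clos: "closure (open_annulus R) \<subseteq> closed_annulus R"
    by (rule closure_minimal[OF open_annulus_subset closed_closed_annulus])
  have znz: "z \<noteq> 0" if "z \<in> closed_annulus R" for z using that by (auto simp: closed_annulus_def)
  have "norm (F z ^ N / z ^ k) \<le> 1"
  proof (rule maximum_modulus_frontier[where f="\<lambda>z. F z ^ N / z ^ k" and S="open_annulus R"])
    have "(\<lambda>z. F z ^ N / z ^ k) holomorphic_on open_annulus R"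
      using znz open_annulus_subset by (intro holomorphic_intros hol) auto
    then show "(\<lambda>z. F z ^ N / z ^ k) holomorphic_on interior (open_annulus R)"
      by (simp add: interior_open[OF open_open_annulus])
    have "continuous_on (closed_annulus R) (\<lambda>z. F z ^ N / z ^ k)"
      using znz by (intro continuous_intros cont) auto
    then show "continuous_on (closure (open_annulus R)) (\<lambda>z. F z ^ N / z ^ k)"
      by (rule continuous_on_subset[OF _ clos])
    show "bounded (open_annulus R)"
      unfolding bounded_iff open_annulus_def by (intro exI[of _ R]) auto
    show "z \<in> open_annulus R" by (rule z)
    fix y assume "y \<in> frontier (open_annulus R)"
    then have "y \<in> closed_annulus R" "y \<notin> open_annulus R"
      using clos by (auto simp: frontier_def interior_open[OF open_open_annulus])
    then consider "norm y = 1" | "norm y = R" "y \<in> closed_annulus R" by (force simp: open_annulus_def closed_annulus_def)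
    then show "norm (F y ^ N / y ^ k) \<le> 1"
    proof cases
      case 1
      then show ?thesis using inner[of y] by (simp add: norm_divide norm_power power_le_one)
    next
      case 2
      have pos: "0 < norm (F y)" using nz[OF 2(2)] by simp
      have "ln (norm (F y) ^ N) = real N * ln (norm (F y))" using pos by (simp add: ln_realpow)
      also have "\<dots> \<le> real N * M" by (intro mult_left_mono outer 2) simp
      also have "\<dots> \<le> ln (R ^ k)" using Nk \<open>1 < R\<close> by (simp add: ln_realpow)
      finally have "norm (F y) ^ N \<le> R ^ k" using pos \<open>1 < R\<close> by (subst (asm) ln_le_cancel_iff) auto
      then show ?thesis using 2(1) \<open>1 < R\<close> by (simp add: norm_divide norm_power divide_le_eq)
    qed
  qed
  moreover have zc: "z \<in> closed_annulus R" "0 < norm z" using z open_annulus_subset znz by auto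
  ultimately have "norm (F z) ^ N \<le> norm z ^ k" by (simp add: norm_divide norm_power divide_le_eq split: if_splits)
  then have "ln (norm (F z) ^ N) \<le> ln (norm z ^ k)" using nz[OF zc(1)] zc(2) by (subst ln_le_cancel_iff) auto
  then show ?thesis using nz[OF zc(1)] zc(2) by (simp add: ln_realpow)
qed

text \<open>The logarithm of the modulus of a function without zeros is harmonic, so it is controlled by a multiple
  of \<open>ln |z|\<close> if it vanishes on the unit circle. Working with the powers \<open>F\<^sup>N / z\<^sup>k\<close>
  avoids branches; the freedom to take \<open>N\<close> large is what makes the estimate useful for a
  family of functions that converges to one of modulus \<open>1\<close>.\<close>

lemma annulus_modulus_bound:
  assumes "1 < R" and cont: "continuous_on (closed_annulus R) F" and hol: "F holomorphic_on open_annulus R"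
    and nz: "\<And>z. z \<in> closed_annulus R \<Longrightarrow> F z \<noteq> 0"
    and inner: "\<And>z. norm z = 1 \<Longrightarrow> norm (F z) = 1"
    and outer: "\<And>z. norm z = R \<Longrightarrow> \<bar>ln (norm (F z))\<bar> \<le> M"
    and Nk: "real N * M \<le> real k * ln R"
    and z: "z \<in> open_annulus R"
  shows "real N * \<bar>ln (norm (F z))\<bar> \<le> real k * ln (norm z)"
proof -
  have 1: "real N * ln (norm (F z)) \<le> real k * ln (norm z)"
    by (rule annulus_modulus_upper[OF assms(1-4) _ _ Nk z]) (use inner outer abs_le_D1 in auto)
  have "real N * ln (norm (1 / F z)) \<le> real k * ln (norm z)"
  proof (rule annulus_modulus_upper[OF \<open>1 < R\<close> _ _ _ _ _ Nk z])
    show "continuous_on (closed_annulus R) (\<lambda>z. 1 / F z)" using nz by (intro continuous_intros cont) auto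
    show "(\<lambda>z. 1 / F z) holomorphic_on open_annulus R"
      using nz open_annulus_subset by (intro holomorphic_intros hol) auto
    show "1 / F z \<noteq> 0" if "z \<in> closed_annulus R" for z using nz[OF that] by simp
    show "norm (1 / F z) \<le> 1" if "norm z = 1" for z using inner[OF that] by (simp add: norm_divide)
    show "ln (norm (1 / F z)) \<le> M" if "norm z = R" for z
    proof -
      have "F z \<noteq> 0" using that \<open>1 < R\<close> by (intro nz) (auto simp: closed_annulus_def)
      then show ?thesis using outer[OF that] by (simp add: norm_divide ln_div)
    qed
  qed
  moreover have "F z \<noteq> 0" using z open_annulus_subset nz by blast
  ultimately have "real N * - ln (norm (F z)) \<le> real k * ln (norm z)" by (simp add: norm_divide ln_div)
  then show ?thesis using 1 by (simp add: abs_if)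
qed

lemma annulus_Re_bound:
  assumes "1 < R" and cont: "continuous_on (closed_annulus R) f" and hol: "f holomorphic_on open_annulus R"
    and inner: "\<And>z. norm z = 1 \<Longrightarrow> Re (f z) = 0"
    and outer: "\<And>z. norm z = R \<Longrightarrow> \<bar>Re (f z)\<bar> \<le> M"
    and z: "z \<in> open_annulus R"
  shows "\<bar>Re (f z)\<bar> \<le> real (nat \<lceil>M / ln R\<rceil>) * ln (norm z)"
proof -
  have "M / ln R \<le> real (nat \<lceil>M / ln R\<rceil>)" by linarith
  then have k: "real 1 * M \<le> real (nat \<lceil>M / ln R\<rceil>) * ln R"
    using \<open>1 < R\<close> by (simp add: divide_le_eq)
  have "real 1 * \<bar>ln (norm (exp (f z)))\<bar> \<le> real (nat \<lceil>M / ln R\<rceil>) * ln (norm z)"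
    by (rule annulus_modulus_bound[OF \<open>1 < R\<close> _ _ _ _ _ k z])
      (use inner outer in \<open>auto intro!: continuous_intros holomorphic_intros cont hol\<close>)
  then show ?thesis by simp
qed

lemma Re_of_real_mult: "Re (of_real r * z) = r * Re z"
  by simp

section \<open>Comparison of kernels near the circle\<close>

text \<open>In the application the outside is mapped to the outside because the map is conjugate there to a map between
  complements of hulls; the condition on the angular derivative expresses that orientation is preserved.\<close>

locale outer_diffeo =
  fixes g :: "complex \<Rightarrow> complex" and R :: real
  assumes R: "1 < R"
    and analytic: "g analytic_on sphere 0 1"
    and holo: "g holomorphic_on open_annulus R"
    and bij: "bij_betw g (sphere 0 1) (sphere 0 1)"
    and deriv_nz: "\<And>\<xi>. \<xi> \<in> sphere 0 1 \<Longrightarrow> deriv g \<xi> \<noteq> 0"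
    and outside: "\<And>z. z \<in> open_annulus R \<Longrightarrow> 1 < norm (g z)"
    and angular: "\<And>\<xi>. \<xi> \<in> sphere 0 1 \<Longrightarrow> angular_deriv g \<xi> = of_real (norm (deriv g \<xi>))"
begin

lemma norm_circle: "norm z = 1 \<Longrightarrow> norm (g z) = 1"
  using bij_betwE[OF bij] by auto

lemma differentiable: 
  assumes "1 \<le> norm z" "norm z < R" shows "g field_differentiable at z"
proof (cases "norm z = 1")
  case True
  then show ?thesis using analytic analytic_on_imp_differentiable_at[of g "sphere 0 1"] by simp
next
  case False
  then have "z \<in> open_annulus R" using assms by (auto simp: open_annulus_def)
  then show ?thesis using holo open_open_annulus holomorphic_on_imp_differentiable_at by blast
qed

lemma g_nz: "1 \<le> norm z \<Longrightarrow> norm z < R \<Longrightarrow> g z \<noteq> 0"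
  using norm_circle[of z] outside[of z] by (cases "norm z = 1") (auto simp: open_annulus_def)

lemma continuous:
  assumes "r < R" shows "continuous_on (closed_annulus r) g"
  using assms differentiable
  by (intro continuous_at_imp_continuous_on ballI field_differentiable_imp_continuous_at) (auto simp: closed_annulus_def)

lemma analytic_annulus: "g analytic_on (closed_annulus r)" if "r < R"
proof -
  have "g analytic_on open_annulus R" using holo open_open_annulus by (simp add: analytic_on_open)
  then have "g analytic_on (sphere 0 1 \<union> open_annulus R)" using analytic by (simp add: analytic_on_Un)
  then show ?thesis by (rule analytic_on_subset) (use that in \<open>auto simp: closed_annulus_def open_annulus_def\<close>)
qed

lemma angular_analytic: "angular_deriv g analytic_on (closed_annulus r)" if "r < R"
  unfolding angular_deriv_def[abs_def]
  using analytic_annulus[OF that] g_nz that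
  by (intro analytic_intros analytic_deriv) (auto simp: closed_annulus_def)

text \<open>Both terms have a simple pole at \<open>\<eta>\<close>, and the residues agree because the angular derivative at \<open>\<eta>\<close> equals
  the speed; the existence of the limit makes the difference continuous up to the circle.\<close>

lemma kernel_limit_image:
  assumes \<eta>: "\<eta> \<in> sphere 0 1"
  shows "\<exists>l. ((\<lambda>w. (g w + g \<eta>) / (g w - g \<eta>) - complex_of_real (1 / norm (deriv g \<eta>)) * ((w + \<eta>) / (w - \<eta>))) \<longlongrightarrow> l) (at \<eta>)"
proof -
  obtain V where V: "open V" "sphere 0 1 \<subseteq> V" "g holomorphic_on V" using analytic unfolding analytic_on_holomorphic by blast
  define h where "h = (\<lambda>w. if w = \<eta> then deriv g \<eta> else (g w - g \<eta>) / (w - \<eta>))"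
  have h: "h holomorphic_on V" unfolding h_def by (rule pole_lemma_open[OF V(3,1)])
  define k where "k = (\<lambda>w. (g w + g \<eta>) / h w - complex_of_real (1 / norm (deriv g \<eta>)) * (w + \<eta>))"
  have \<eta>V: "\<eta> \<in> V" using V \<eta> by blast
  have h\<eta>: "h \<eta> = deriv g \<eta>" "h \<eta> \<noteq> 0" using deriv_nz[OF \<eta>] by (auto simp: h_def)
  have g\<eta>: "g \<eta> \<noteq> 0" "\<eta> \<noteq> 0" using norm_circle[of \<eta>] \<eta> by auto
  have "g \<eta> / deriv g \<eta> = complex_of_real (1 / norm (deriv g \<eta>)) * \<eta>"
  proof -
    have "\<eta> * deriv g \<eta> / g \<eta> = of_real (norm (deriv g \<eta>))" using angular[OF \<eta>] by (simp add: angular_deriv_def)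
    moreover have "complex_of_real (norm (deriv g \<eta>)) \<noteq> 0" using deriv_nz[OF \<eta>] by simp
    ultimately show ?thesis using g\<eta> deriv_nz[OF \<eta>] by (simp add: field_simps)
  qed
  note a = this
  have "(g \<eta> + g \<eta>) / deriv g \<eta> = complex_of_real (1 / norm (deriv g \<eta>)) * (\<eta> + \<eta>)"
    unfolding add_divide_distrib a distrib_left ..
  then have k0: "k \<eta> = 0" unfolding k_def h\<eta>(1) by simp
  have "g field_differentiable at \<eta>" "h field_differentiable at \<eta>"
    using V h \<eta>V holomorphic_on_imp_differentiable_at by blast+
  then have "k field_differentiable at \<eta>"
    unfolding k_def using h\<eta> by (intro derivative_intros) auto
  then obtain l where "(k has_field_derivative l) (at \<eta>)" unfolding field_differentiable_def by blast
  then have lim: "((\<lambda>w. (k w - k \<eta>) / (w - \<eta>)) \<longlongrightarrow> l) (at \<eta>)" by (simp add: has_field_derivative_iff)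
  have eq: "\<forall>\<^sub>F w in at \<eta>. (k w - k \<eta>) / (w - \<eta>) = (g w + g \<eta>) / (g w - g \<eta>) - complex_of_real (1 / norm (deriv g \<eta>)) * ((w + \<eta>) / (w - \<eta>))"
    unfolding eventually_at_filter
  proof (rule always_eventually, intro allI impI)
    fix w assume w: "w \<noteq> \<eta>"
    have "(g w + g \<eta>) / h w / (w - \<eta>) = (g w + g \<eta>) / (g w - g \<eta>)"
      using w by (simp add: h_def)
    then show "(k w - k \<eta>) / (w - \<eta>) = (g w + g \<eta>) / (g w - g \<eta>) - complex_of_real (1 / norm (deriv g \<eta>)) * ((w + \<eta>) / (w - \<eta>))"
      unfolding k0 by (simp add: k_def diff_divide_distrib)
  qed
  show ?thesis by (rule exI[of _ l], rule tendsto_cong[OF eq, THEN iffD1, OF lim])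
qed

lemma kernel_limit_speed:
  assumes \<eta>: "\<eta> \<in> sphere 0 1"
  shows "\<exists>l. ((\<lambda>w. (angular_deriv g w - complex_of_real (norm (deriv g \<eta>))) * ((w + \<eta>) / (w - \<eta>))) \<longlongrightarrow> l) (at \<eta>)"
proof -
  have "angular_deriv g field_differentiable at \<eta>"
    by (rule analytic_on_imp_differentiable_at[OF angular_analytic[OF R]]) (use \<eta> in \<open>auto simp: closed_annulus_def\<close>)
  then obtain l where "(angular_deriv g has_field_derivative l) (at \<eta>)" unfolding field_differentiable_def by blast
  then have lim: "((\<lambda>w. (angular_deriv g w - angular_deriv g \<eta>) / (w - \<eta>)) \<longlongrightarrow> l) (at \<eta>)" by (simp add: has_field_derivative_iff)
  then have "((\<lambda>w. (angular_deriv g w - angular_deriv g \<eta>) / (w - \<eta>) * (w + \<eta>)) \<longlongrightarrow> l * (\<eta> + \<eta>)) (at \<eta>)"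
    by (intro tendsto_intros)
  then show ?thesis unfolding angular[OF \<eta>] by (auto simp: mult.commute)
qed

lemma Re_kernel_circle:
  assumes "norm w = 1" "norm \<eta> = 1"
  shows "Re ((w + \<eta>) / (w - \<eta> :: complex)) = 0"
proof (cases "w = \<eta>")
  case False
  have "(w + \<eta>) * cnj (w - \<eta>) = (w * cnj w - \<eta> * cnj \<eta>) + (\<eta> * cnj w - w * cnj \<eta>)" by (simp add: algebra_simps)
  moreover have "w * cnj w = 1" "\<eta> * cnj \<eta> = 1" using assms by (simp_all add: complex_norm_square[symmetric])
  ultimately have "Re ((w + \<eta>) * cnj (w - \<eta>)) = 0" by simp
  then show ?thesis by (simp add: complex_div_cnj[of "w + \<eta>" "w - \<eta>"])
qed simp

text \<open>Near the circle the kernel with poles on the circle transforms under \<open>g\<close>, up to an error whose real part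
  vanishes uniformly on the circle, by the inverse of the speed at the pole.\<close>

lemma kernel_comparison:
  assumes r: "1 < r" "r < R"
  shows "\<exists>c. \<forall>\<eta>\<in>sphere 0 1. \<forall>w\<in>open_annulus r. 
    \<bar>Re ((g w + g \<eta>) / (g w - g \<eta>)) - 1 / norm (deriv g \<eta>) * Re ((w + \<eta>) / (w - \<eta>))\<bar> \<le> c * ln (norm w) \<and>
    \<bar>Re (angular_deriv g w * ((w + \<eta>) / (w - \<eta>))) - norm (deriv g \<eta>) * Re ((w + \<eta>) / (w - \<eta>))\<bar> \<le> c * ln (norm w)"
proof -
  have sub: "sphere 0 r \<subseteq> open_annulus R" using r by (auto simp: open_annulus_def)
  have sub': "sphere 0 r \<subseteq> closed_annulus r" "sphere 0 1 \<subseteq> closed_annulus r" using r by (auto simp: closed_annulus_def)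
  have contg: "continuous_on (sphere 0 r) (\<lambda>w. norm (g w))"
    by (intro continuous_intros continuous_on_subset[OF continuous[OF r(2)] sub'(1)])
  have "sphere (0::complex) r \<noteq> {}" using r by simp
  then obtain w0 where w0: "w0 \<in> sphere 0 r" "\<And>w. w \<in> sphere 0 r \<Longrightarrow> norm (g w0) \<le> norm (g w)"
    using continuous_attains_inf[OF compact_sphere _ contg] by blast
  define \<rho> where "\<rho> = norm (g w0)"
  have \<rho>: "1 < \<rho>" unfolding \<rho>_def using outside sub w0(1) by blast
  have dcont: "continuous_on (sphere 0 1) (\<lambda>\<eta>. norm (deriv g \<eta>))"
    using analytic analytic_deriv analytic_imp_holomorphic holomorphic_on_imp_continuous_on by (intro continuous_intros) blast
  have ne1: "sphere (0::complex) 1 \<noteq> {}" by simp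
  obtain \<eta>0 where \<eta>0: "\<eta>0 \<in> sphere 0 1" "\<And>\<eta>. \<eta> \<in> sphere 0 1 \<Longrightarrow> norm (deriv g \<eta>0) \<le> norm (deriv g \<eta>)"
    using continuous_attains_inf[OF compact_sphere ne1 dcont] by blast
  obtain \<eta>1 where \<eta>1: "\<eta>1 \<in> sphere 0 1" "\<And>\<eta>. \<eta> \<in> sphere 0 1 \<Longrightarrow> norm (deriv g \<eta>) \<le> norm (deriv g \<eta>1)"
    using continuous_attains_sup[OF compact_sphere ne1 dcont] by blast
  define m where "m = norm (deriv g \<eta>0)"
  have m: "0 < m" using deriv_nz[OF \<eta>0(1)] by (simp add: m_def)
  have bcont: "continuous_on (closed_annulus r) (angular_deriv g)"
    using angular_analytic[OF r(2)] by (intro holomorphic_on_imp_continuous_on analytic_imp_holomorphic)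
  have "bounded (angular_deriv g ` sphere 0 r)"
    by (intro compact_imp_bounded compact_continuous_image continuous_on_subset[OF bcont sub'(1)]) simp
  then obtain b where b: "\<And>w. w \<in> sphere 0 r \<Longrightarrow> norm (angular_deriv g w) \<le> b" unfolding bounded_iff by blast
  define q where "q = (r + 1) / (r - 1)"
  have q: "0 < q" using r by (simp add: q_def)
  have kq: "norm ((w + \<eta>) / (w - \<eta>)) \<le> q" if "norm w = r" "\<eta> \<in> sphere 0 1" for w \<eta> :: complex
    using outer_kernel_norm_le[of w \<eta>] that r by (simp add: q_def)
  define M1 where "M1 = (\<rho> + 1) / (\<rho> - 1) + 1 / m * q"
  define M2 where "M2 = (b + norm (deriv g \<eta>1)) * q"
  define c where "c = max (real (nat \<lceil>M1 / ln r\<rceil>)) (real (nat \<lceil>M2 / ln r\<rceil>))"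
  have gne: "g w \<noteq> g \<eta>" if "w \<in> closed_annulus r" "w \<noteq> \<eta>" "\<eta> \<in> sphere 0 1" for w \<eta>
  proof (cases "norm w = 1")
    case True
    then show ?thesis using bij that by (auto simp: bij_betw_def inj_on_def)
  next
    case False
    then have "w \<in> open_annulus R" using that r by (auto simp: closed_annulus_def open_annulus_def)
    then show ?thesis using outside[of w] norm_circle[of \<eta>] that by auto
  qed
  \<comment> \<open>Each difference extends continuously to the single boundary point \<open>\<eta>\<close>, where its real part vanishes by
    continuity along the circle.\<close>
  have ext: "\<bar>Re (f w)\<bar> \<le> real (nat \<lceil>M / ln r\<rceil>) * ln (norm w)"
    if lim: "(f \<longlongrightarrow> l) (at \<eta>)" and \<eta>: "\<eta> \<in> sphere 0 1" and d: "\<And>w. w \<in> closed_annulus r \<Longrightarrow> w \<noteq> \<eta> \<Longrightarrow> f field_differentiable at w"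
      and inner: "\<And>w. norm w = 1 \<Longrightarrow> w \<noteq> \<eta> \<Longrightarrow> Re (f w) = 0"
      and outer: "\<And>w. norm w = r \<Longrightarrow> \<bar>Re (f w)\<bar> \<le> M" and w: "w \<in> open_annulus r" for f l \<eta> M w
  proof -
    have n\<eta>: "norm \<eta> = 1" using \<eta> by simp
    define F where "F = (\<lambda>w. if w = \<eta> then l else f w)"
    have Fw: "F w = f w" if "w \<noteq> \<eta>" for w using that by (simp add: F_def)
    have contF: "isCont F w" if "w \<in> closed_annulus r" for w
    proof (cases "w = \<eta>")
      case True
      have "(F \<longlongrightarrow> l) (at \<eta>)" using lim by (rule Lim_transform_eventually) (auto simp: F_def eventually_at_filter)
      then show ?thesis using True by (simp add: isCont_def F_def)
    next
      case False
      have ev: "\<forall>\<^sub>F x in nhds w. F x = f x" 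
        using t1_space_nhds[OF False] by eventually_elim (rule Fw)
      have "isCont f w" using d[OF that False] by (rule field_differentiable_imp_continuous_at)
      then show ?thesis using isCont_cong[OF ev] by simp
    qed
    have "\<bar>Re (F w)\<bar> \<le> real (nat \<lceil>M / ln r\<rceil>) * ln (norm w)"
    proof (rule annulus_Re_bound[OF r(1) _ _ _ _ w])
      show "continuous_on (closed_annulus r) F" using contF by (intro continuous_at_imp_continuous_on ballI)
      have "f field_differentiable (at x within open_annulus r)" if x: "x \<in> open_annulus r" for x
      proof (rule field_differentiable_at_within, rule d)
        show "x \<in> closed_annulus r" using x open_annulus_subset by blast
        show "x \<noteq> \<eta>" using x n\<eta> by (auto simp: open_annulus_def)
      qed
      then have "f holomorphic_on open_annulus r" unfolding holomorphic_on_def by blast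
      then show "F holomorphic_on open_annulus r"
        by (rule holomorphic_transform) (use n\<eta> in \<open>auto simp: F_def open_annulus_def\<close>)
      have ev: "Re l = 0"
      proof -
        have lim0: "((\<lambda>x. Re (F (\<eta> * cis x))) \<longlongrightarrow> Re (F (\<eta> * cis 0))) (at_right 0)"
        proof (intro tendsto_Re isCont_tendsto_compose[of "\<eta> * cis 0" F])
          show "isCont F (\<eta> * cis 0)" using sub' \<eta> by (intro contF) auto
          have "isCont (\<lambda>x. \<eta> * cis x) 0" unfolding cis_conv_exp by (intro continuous_intros)
          then show "((\<lambda>x. \<eta> * cis x) \<longlongrightarrow> \<eta> * cis 0) (at_right 0)" 
            by (simp only: isCont_def filterlim_at_split)
        qed
        have ev0: "\<forall>\<^sub>F x in at_right 0. Re (F (\<eta> * cis x)) = 0"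
          using eventually_at_right_real[OF pi_gt_zero]
        proof eventually_elim
          case (elim x)
          have "cis x \<noteq> 1"
          proof
            assume "cis x = 1"
            then have "sin x = 0" by (metis cis.simps(2) one_complex.simps(2))
            then show False using sin_gt_zero[of x] elim by simp
          qed
          then have "\<eta> * cis x \<noteq> \<eta>" using n\<eta> by auto
          then show ?case using inner[of "\<eta> * cis x"] n\<eta> by (simp add: Fw norm_mult)
        qed
        have "Re (F (\<eta> * cis 0)) = 0"
          by (rule tendsto_unique[OF trivial_limit_at_right_real lim0 tendsto_eventually[OF ev0]])
        then show ?thesis by (simp add: F_def)
      qed
      show "Re (F z) = 0" if "norm z = 1" for z using inner[OF that] ev by (auto simp: F_def)
      show "\<bar>Re (F z)\<bar> \<le> M" if "norm z = r" for z using outer[OF that] n\<eta> r that by (auto simp: F_def)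
    qed
    moreover have "w \<noteq> \<eta>" using w n\<eta> by (auto simp: open_annulus_def)
    ultimately show ?thesis by (simp add: Fw)
  qed
  show ?thesis
  proof (intro exI[of _ c] ballI conjI)
    fix \<eta> w :: complex assume \<eta>: "\<eta> \<in> sphere 0 1" and w: "w \<in> open_annulus r"
    have n\<eta>: "norm \<eta> = 1" using \<eta> by simp
    have lnw: "0 \<le> ln (norm w)" using w by (auto simp: open_annulus_def)
    have gd: "g field_differentiable at w" if "w \<in> closed_annulus r" for w
      by (rule differentiable) (use that r in \<open>auto simp: closed_annulus_def\<close>)
    have bd: "angular_deriv g field_differentiable at w" if "w \<in> closed_annulus r" for w
      by (rule analytic_on_imp_differentiable_at[OF angular_analytic[OF r(2)] that])
    obtain l1 where l1: "((\<lambda>w. (g w + g \<eta>) / (g w - g \<eta>) - complex_of_real (1 / norm (deriv g \<eta>)) * ((w + \<eta>) / (w - \<eta>))) \<longlongrightarrow> l1) (at \<eta>)"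
      using kernel_limit_image[OF \<eta>] by blast
    have "\<bar>Re ((g w + g \<eta>) / (g w - g \<eta>) - complex_of_real (1 / norm (deriv g \<eta>)) * ((w + \<eta>) / (w - \<eta>)))\<bar> \<le> real (nat \<lceil>M1 / ln r\<rceil>) * ln (norm w)"
    proof (rule ext[OF l1 \<eta> _ _ _ w])
      fix w assume w: "w \<in> closed_annulus r" "w \<noteq> \<eta>"
      show "(\<lambda>w. (g w + g \<eta>) / (g w - g \<eta>) - complex_of_real (1 / norm (deriv g \<eta>)) * ((w + \<eta>) / (w - \<eta>))) field_differentiable at w"
        using gd[OF w(1)] gne[OF w \<eta>] w by (intro derivative_intros) auto
    next
      fix w :: complex assume w: "norm w = 1" "w \<noteq> \<eta>"
      have "Re (complex_of_real (1 / norm (deriv g \<eta>)) * ((w + \<eta>) / (w - \<eta>))) = 1 / norm (deriv g \<eta>) * Re ((w + \<eta>) / (w - \<eta>))"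
        by (rule Re_of_real_mult)
      then show "Re ((g w + g \<eta>) / (g w - g \<eta>) - complex_of_real (1 / norm (deriv g \<eta>)) * ((w + \<eta>) / (w - \<eta>))) = 0"
        using Re_kernel_circle[OF w(1) n\<eta>] Re_kernel_circle[OF norm_circle[OF w(1)] norm_circle[OF n\<eta>]] by simp
    next
      fix w :: complex assume w: "norm w = r"
      have gw: "\<rho> \<le> norm (g w)" using w0(2)[of w] w by (simp add: \<rho>_def)
      have "norm ((g w + g \<eta>) / (g w - g \<eta>)) \<le> (norm (g w) + 1) / (norm (g w) - 1)"
        using outer_kernel_norm_le[of "g w" "g \<eta>"] gw \<rho> norm_circle[OF n\<eta>] by simp
      also have "\<dots> \<le> (\<rho> + 1) / (\<rho> - 1)" using gw \<rho> by (simp add: divide_simps) (simp add: algebra_simps)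
      finally have 1: "norm ((g w + g \<eta>) / (g w - g \<eta>)) \<le> (\<rho> + 1) / (\<rho> - 1)" .
      have "norm (complex_of_real (1 / norm (deriv g \<eta>)) * ((w + \<eta>) / (w - \<eta>))) = 1 / norm (deriv g \<eta>) * norm ((w + \<eta>) / (w - \<eta>))"
        unfolding norm_mult by (simp add: norm_divide)
      also have "\<dots> \<le> 1 / m * q"
        using kq[OF w \<eta>] \<eta>0(2)[OF \<eta>] m unfolding m_def by (intro mult_mono frac_le) auto
      finally have 2: "norm (complex_of_real (1 / norm (deriv g \<eta>)) * ((w + \<eta>) / (w - \<eta>))) \<le> 1 / m * q" .
      show "\<bar>Re ((g w + g \<eta>) / (g w - g \<eta>) - complex_of_real (1 / norm (deriv g \<eta>)) * ((w + \<eta>) / (w - \<eta>)))\<bar> \<le> M1"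
        unfolding M1_def by (rule order_trans[OF abs_Re_le_cmod]) (rule order_trans[OF norm_triangle_ineq4 add_mono[OF 1 2]])
    qed
    also have "\<dots> \<le> c * ln (norm w)" using lnw by (intro mult_right_mono) (auto simp: c_def)
    also have "Re ((g w + g \<eta>) / (g w - g \<eta>) - complex_of_real (1 / norm (deriv g \<eta>)) * ((w + \<eta>) / (w - \<eta>))) = 
      Re ((g w + g \<eta>) / (g w - g \<eta>)) - 1 / norm (deriv g \<eta>) * Re ((w + \<eta>) / (w - \<eta>))"
      by (simp only: minus_complex.simps(1) Re_of_real_mult)
    finally show "\<bar>Re ((g w + g \<eta>) / (g w - g \<eta>)) - 1 / norm (deriv g \<eta>) * Re ((w + \<eta>) / (w - \<eta>))\<bar> \<le> c * ln (norm w)" .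
    obtain l2 where l2: "((\<lambda>w. (angular_deriv g w - complex_of_real (norm (deriv g \<eta>))) * ((w + \<eta>) / (w - \<eta>))) \<longlongrightarrow> l2) (at \<eta>)"
      using kernel_limit_speed[OF \<eta>] by blast
    have "\<bar>Re ((angular_deriv g w - complex_of_real (norm (deriv g \<eta>))) * ((w + \<eta>) / (w - \<eta>)))\<bar> \<le> real (nat \<lceil>M2 / ln r\<rceil>) * ln (norm w)"
    proof (rule ext[OF l2 \<eta> _ _ _ w])
      fix w assume w: "w \<in> closed_annulus r" "w \<noteq> \<eta>"
      show "(\<lambda>w. (angular_deriv g w - complex_of_real (norm (deriv g \<eta>))) * ((w + \<eta>) / (w - \<eta>))) field_differentiable at w"
        using bd[OF w(1)] w by (intro derivative_intros) auto
    next
      fix w :: complex assume w: "norm w = 1" "w \<noteq> \<eta>"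
      have "(angular_deriv g w - complex_of_real (norm (deriv g \<eta>))) = of_real (norm (deriv g w) - norm (deriv g \<eta>))"
        using angular[of w] w by simp
      then show "Re ((angular_deriv g w - complex_of_real (norm (deriv g \<eta>))) * ((w + \<eta>) / (w - \<eta>))) = 0"
        using Re_kernel_circle[OF w(1) n\<eta>] by (simp only: Re_of_real_mult mult_zero_right)
    next
      fix w :: complex assume w: "norm w = r"
      have "norm (angular_deriv g w - complex_of_real (norm (deriv g \<eta>))) \<le> norm (angular_deriv g w) + norm (deriv g \<eta>)"
        using norm_triangle_ineq4[of "angular_deriv g w" "of_real (norm (deriv g \<eta>))"] by simp
      also have "\<dots> \<le> b + norm (deriv g \<eta>1)" using b[of w] w \<eta>1(2)[OF \<eta>] by (intro add_mono) auto
      finally have "norm ((angular_deriv g w - complex_of_real (norm (deriv g \<eta>))) * ((w + \<eta>) / (w - \<eta>))) \<le> M2"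
        unfolding M2_def norm_mult using kq[OF w \<eta>] by (intro mult_mono) (auto intro: order_trans[OF norm_ge_zero])
      then show "\<bar>Re ((angular_deriv g w - complex_of_real (norm (deriv g \<eta>))) * ((w + \<eta>) / (w - \<eta>)))\<bar> \<le> M2"
        by (rule order_trans[OF abs_Re_le_cmod])
    qed
    also have "\<dots> \<le> c * ln (norm w)" using lnw by (intro mult_right_mono) (auto simp: c_def)
    also have "Re ((angular_deriv g w - complex_of_real (norm (deriv g \<eta>))) * ((w + \<eta>) / (w - \<eta>))) = 
      Re (angular_deriv g w * ((w + \<eta>) / (w - \<eta>))) - norm (deriv g \<eta>) * Re ((w + \<eta>) / (w - \<eta>))"
      by (simp only: left_diff_distrib minus_complex.simps(1) Re_of_real_mult)
    finally show "\<bar>Re (angular_deriv g w * ((w + \<eta>) / (w - \<eta>))) - norm (deriv g \<eta>) * Re ((w + \<eta>) / (w - \<eta>))\<bar> \<le> c * ln (norm w)" .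
  qed
qed

end

section \<open>The first order of the conjugacy near the circle\<close>

lemma abs_ln_diff_le:
  fixes a b :: real
  assumes "1 \<le> a" "1 \<le> b"
  shows "\<bar>ln a - ln b\<bar> \<le> \<bar>a - b\<bar>"
proof -
  have *: "ln x - ln y \<le> \<bar>x - y\<bar>" if "1 \<le> x" "1 \<le> y" for x y :: real
  proof -
    have "ln x - ln y \<le> (x - y) / y" by (rule ln_diff_le) (use that in auto)
    also have "\<dots> \<le> \<bar>x - y\<bar> / y" by (intro divide_right_mono) (use that in auto)
    also have "\<dots> \<le> \<bar>x - y\<bar> / 1" by (intro divide_left_mono) (use that in auto)
    finally show ?thesis by simp
  qed
  show ?thesis using *[OF assms] *[OF assms(2,1)] by (simp add: abs_le_iff abs_minus_commute)
qed

lemma norm_exp_minus_one_le: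
  assumes "norm (z :: complex) \<le> 1" shows "norm (exp z - 1) \<le> exp 1 * norm z"
proof -
  have "norm (exp z - exp 0) \<le> exp 1 * norm (z - 0)"
  proof (rule field_differentiable_bound[of "cball 0 1" exp exp])
    fix x :: complex assume "x \<in> cball 0 1"
    then have "norm x \<le> 1" by simp
    then show "norm (exp x) \<le> exp 1" using norm_exp[of x] by (meson exp_le_cancel_iff order_trans)
    show "(exp has_field_derivative exp x) (at x within cball 0 1)" by (auto intro!: derivative_eq_intros)
  qed (use assms in auto)
  then show ?thesis by simp
qed

lemma ln_one_plus_limit:
  fixes d :: "nat \<Rightarrow> real" and z :: "nat \<Rightarrow> complex"
  assumes d: "\<And>n. 0 < d n" "d \<longlonglongrightarrow> 0" and z: "z \<longlonglongrightarrow> l"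
    and nz: "\<And>n. 1 + d n * z n \<noteq> 0"
  shows "(\<lambda>n. ln (norm (1 + d n * z n)) / d n) \<longlonglongrightarrow> Re l"
proof -
  have "(Ln has_field_derivative inverse 1) (at 1)" by (rule has_field_derivative_Ln) (simp add: complex_nonpos_Reals_iff)
  then obtain \<Lambda> where \<Lambda>: "\<And>y. Ln y - Ln 1 = \<Lambda> y * (y - 1)" "isCont \<Lambda> 1" "\<Lambda> 1 = 1"
    unfolding CARAT_DERIV by auto
  have "(\<lambda>n. complex_of_real (d n) * z n) \<longlonglongrightarrow> of_real 0 * l" by (intro tendsto_intros d z)
  then have "(\<lambda>n. 1 + complex_of_real (d n) * z n) \<longlonglongrightarrow> 1 + of_real 0 * l" by (intro tendsto_add tendsto_const)
  then have "(\<lambda>n. 1 + complex_of_real (d n) * z n) \<longlonglongrightarrow> 1" by simp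
  then have "(\<lambda>n. \<Lambda> (1 + d n * z n)) \<longlonglongrightarrow> \<Lambda> 1" by (rule isCont_tendsto_compose[OF \<Lambda>(2)])
  then have "(\<lambda>n. Re (\<Lambda> (1 + d n * z n) * z n)) \<longlonglongrightarrow> Re (\<Lambda> 1 * l)" by (intro tendsto_intros z)
  moreover have "Re (\<Lambda> (1 + d n * z n) * z n) = ln (norm (1 + d n * z n)) / d n" for n
  proof -
    have "ln (norm (1 + d n * z n)) = Re (Ln (1 + d n * z n))" using nz[of n] by (simp add: Re_Ln)
    also have "Ln (1 + d n * z n) = of_real (d n) * (\<Lambda> (1 + d n * z n) * z n)"
      using \<Lambda>(1)[of "1 + d n * z n"] by (simp add: mult_ac)
    also have "Re \<dots> = d n * Re (\<Lambda> (1 + d n * z n) * z n)" by (rule Re_of_real_mult)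
    finally show ?thesis using d(1)[of n] by simp
  qed
  ultimately show ?thesis using \<Lambda>(3) by simp
qed

lemma herglotz_bound_antimono:
  fixes r x :: real assumes "1 < r" "r \<le> x" shows "(x + 1) / (x - 1) \<le> (r + 1) / (r - 1)"
proof -
  have "(x + 1) / (x - 1) = 1 + 2 / (x - 1)" using assms by (simp add: field_simps)
  also have "\<dots> \<le> 1 + 2 / (r - 1)" using assms by (intro add_left_mono divide_left_mono mult_pos_pos) auto
  also have "\<dots> = (r + 1) / (r - 1)" using assms by (simp add: field_simps)
  finally show ?thesis .
qed

text \<open>The maps \<open>f n\<close> tend to the identity at rate \<open>d n\<close>, with the Herglotz transform of \<open>\<nu> n\<close> as
  velocity, and \<open>F n\<close> is \<open>g\<close> conjugated by \<open>f n\<close>.\<close>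

locale infinitesimal_conjugacy = outer_diffeo +
  fixes d :: "nat \<Rightarrow> real" and \<nu> :: "nat \<Rightarrow> complex measure" and \<mu> :: "complex measure"
    and F :: "nat \<Rightarrow> complex \<Rightarrow> complex" and r :: real and f :: "nat \<Rightarrow> complex \<Rightarrow> complex"
  defines "f \<equiv> \<lambda>n w. w * exp (of_real (d n) * outer_herglotz (\<nu> n) w)"
  assumes d_pos: "\<And>n. 0 < d n" and d_lim: "d \<longlonglongrightarrow> 0"
    and \<nu>: "\<And>n. prob_space (\<nu> n)" "\<And>n. sets (\<nu> n) = sets circle_borel"
    and \<mu>: "prob_space \<mu>" "sets \<mu> = sets circle_borel"
    and conv: "\<And>z. 1 < norm z \<Longrightarrow> (\<lambda>n. outer_herglotz (\<nu> n) z) \<longlonglongrightarrow> outer_herglotz \<mu> z"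
    and f_le: "\<And>n s v. 1 < norm v \<Longrightarrow> norm v \<le> s \<Longrightarrow> norm (f n v) \<le> s * exp (d n * ((s + 1) / (s - 1)))"
    and r: "1 < r" "r < R"
    and F_cont: "\<And>n. continuous_on (closed_annulus r) (F n)"
    and F_holo: "\<And>n. F n holomorphic_on open_annulus r"
    and F_circle: "\<And>n w. norm w = 1 \<Longrightarrow> norm (F n w) = 1"
    and F_outside: "\<And>n w. 1 < norm w \<Longrightarrow> norm w \<le> r \<Longrightarrow> 1 < norm (F n w)"
    and conj: "\<And>n w. 1 < norm w \<Longrightarrow> norm w \<le> r \<Longrightarrow> f n (F n w) = g (f n w)"
begin

lemma d_small: "0 < e \<Longrightarrow> \<forall>\<^sub>F n in sequentially. d n < e"
  using order_tendstoD(2)[OF d_lim] by blast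

lemma P_le: "1 < s \<Longrightarrow> s \<le> norm z \<Longrightarrow> norm (outer_herglotz (\<nu> n) z) \<le> (s + 1) / (s - 1)"
  using outer_herglotz_norm_le[OF \<nu>, of z n] herglotz_bound_antimono[of s "norm z"] by force

text \<open>The maps \<open>f n\<close> do not move points close to the circle far away, so a point whose image under \<open>f n\<close> stays away
  from the circle must itself stay away from it.\<close>

lemma F_away:
  assumes "1 < r1" "r1 < r2"
  shows "\<forall>\<^sub>F n in sequentially. \<forall>w. 1 < norm w \<longrightarrow> norm w \<le> r \<longrightarrow> r2 < norm (g (f n w)) \<longrightarrow> r1 < norm (F n w)"
proof -
  have "(\<lambda>n. r1 * exp (d n * ((r1 + 1) / (r1 - 1)))) \<longlonglongrightarrow> r1 * exp (0 * ((r1 + 1) / (r1 - 1)))"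
    by (intro tendsto_intros d_lim)
  then have "\<forall>\<^sub>F n in sequentially. r1 * exp (d n * ((r1 + 1) / (r1 - 1))) < r2"
    by (rule order_tendstoD(2)) (use assms in simp)
  then show ?thesis
  proof eventually_elim
    case (elim n)
    show ?case
    proof (intro allI impI, rule ccontr)
      fix w assume w: "1 < norm w" "norm w \<le> r" "r2 < norm (g (f n w))" "\<not> r1 < norm (F n w)"
      have "norm (g (f n w)) = norm (f n (F n w))" using conj[OF w(1,2), of n] by simp
      also have "\<dots> \<le> r1 * exp (d n * ((r1 + 1) / (r1 - 1)))"
        by (rule f_le[OF F_outside[OF w(1,2)]]) (use w(4) in simp)
      finally show False using elim w(3) by simp
    qed
  qed
qed

lemma ln_F:
  assumes w: "1 < norm w" "norm w \<le> r"
  shows "ln (norm (F n w)) = ln (norm (g (f n w))) - d n * Re (outer_herglotz (\<nu> n) (F n w))"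
proof -
  have "norm (g (f n w)) = norm (F n w) * exp (d n * Re (outer_herglotz (\<nu> n) (F n w)))"
    unfolding conj[OF w, symmetric] by (simp add: f_def norm_mult)
  moreover have "0 < norm (F n w)" using F_outside[OF w, of n] by linarith
  ultimately show ?thesis by (simp add: ln_mult)
qed

text \<open>The first-order expansion of the conjugacy equation \<open>f n \<circ> F n = g \<circ> f n\<close> at a point outside the circle.\<close>

lemma pointwise_limit:
  assumes w: "1 < norm w" "norm w \<le> r"
  shows "(\<lambda>n. ln (norm (F n w / g w)) / d n) \<longlonglongrightarrow> 
    Re (angular_deriv g w * outer_herglotz \<mu> w) - Re (outer_herglotz \<mu> (g w))"
proof -
  let ?P = "\<lambda>n. outer_herglotz (\<nu> n) w"
  have wR: "w \<in> open_annulus R" using w r by (simp add: open_annulus_def)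
  have gw: "1 < norm (g w)" by (rule outside[OF wR])
  have gw0: "g w \<noteq> 0" using gw by auto
  have w0: "w \<noteq> 0" using w by auto
  define h where "h = (\<lambda>n. complex_of_real (d n) * ?P n)"
  have "h \<longlonglongrightarrow> of_real 0 * outer_herglotz \<mu> w" unfolding h_def by (intro tendsto_intros d_lim conv w)
  then have h: "h \<longlonglongrightarrow> 0" by simp
  have "((exp :: complex \<Rightarrow> complex) has_field_derivative exp 0) (at 0)" by (rule DERIV_exp)
  then obtain E where E: "\<And>z::complex. exp z - exp 0 = E z * (z - 0)" "isCont E 0" "E 0 = exp 0"
    unfolding CARAT_DERIV by blast
  define y where "y = (\<lambda>n. w * E (h n) * ?P n)"
  have y: "y \<longlonglongrightarrow> w * E 0 * outer_herglotz \<mu> w"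
    unfolding y_def by (intro tendsto_intros isCont_tendsto_compose[OF E(2)] h conv w)
  have fy: "f n w = w + d n * y n" for n
  proof -
    have "f n w - w = w * (exp (h n) - exp 0)" by (simp add: f_def h_def algebra_simps)
    then show ?thesis unfolding E(1) by (simp add: y_def h_def algebra_simps)
  qed
  have "(\<lambda>n. w + complex_of_real (d n) * y n) \<longlonglongrightarrow> w + of_real 0 * (w * E 0 * outer_herglotz \<mu> w)"
    by (intro tendsto_intros d_lim y)
  then have flim: "(\<lambda>n. f n w) \<longlonglongrightarrow> w" by (simp add: fy)
  have gdiff: "g field_differentiable at w" using differentiable[of w] w r by simp
  then have "(g has_field_derivative deriv g w) (at w)" by (simp add: DERIV_deriv_iff_field_differentiable)
  then obtain \<gamma> where \<gamma>: "\<And>z. g z - g w = \<gamma> z * (z - w)" "isCont \<gamma> w" "\<gamma> w = deriv g w"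
    unfolding CARAT_DERIV by blast
  have glim: "(\<lambda>n. g (f n w)) \<longlonglongrightarrow> g w"
    by (rule isCont_tendsto_compose[OF field_differentiable_imp_continuous_at[OF gdiff] flim])
  define z where "z = (\<lambda>n. \<gamma> (f n w) * y n / g w)"
  have gz: "g (f n w) / g w = 1 + d n * z n" for n
    using \<gamma>(1)[of "f n w"] gw0 fy[of n] by (simp add: z_def field_simps)
  have gnz: "g (f n w) \<noteq> 0" for n
  proof -
    have "F n w \<noteq> 0" using F_outside[OF w, of n] by auto
    then show ?thesis unfolding conj[OF w, symmetric] by (simp add: f_def)
  qed
  have zl: "z \<longlonglongrightarrow> deriv g w * (w * E 0 * outer_herglotz \<mu> w) / g w"
    unfolding z_def \<gamma>(3)[symmetric] by (intro tendsto_intros isCont_tendsto_compose[OF \<gamma>(2)] flim y gw0)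
  have "(\<lambda>n. ln (norm (1 + d n * z n)) / d n) \<longlonglongrightarrow> Re (deriv g w * (w * E 0 * outer_herglotz \<mu> w) / g w)"
    by (rule ln_one_plus_limit[OF d_pos d_lim zl]) (use gz gnz gw0 in \<open>metis divide_eq_0_iff\<close>)
  then have 1: "(\<lambda>n. ln (norm (g (f n w) / g w)) / d n) \<longlonglongrightarrow> Re (angular_deriv g w * outer_herglotz \<mu> w)"
    unfolding gz[symmetric] using E(3) by (simp add: angular_deriv_def mult_ac)
  define r1 where "r1 = (2 + norm (g w)) / 3"
  define r2 where "r2 = (1 + 2 * norm (g w)) / 3"
  have rr: "1 < r1" "r1 < r2" "r2 < norm (g w)" using gw by (auto simp: r1_def r2_def)
  have "\<forall>\<^sub>F n in sequentially. r2 < norm (g (f n w))"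
    by (rule order_tendstoD(1)[OF tendsto_norm[OF glim] rr(3)])
  then have away: "\<forall>\<^sub>F n in sequentially. r1 < norm (F n w)"
    using F_away[OF rr(1,2)] by eventually_elim (use w in auto)
  have hF: "(\<lambda>n. complex_of_real (d n) * outer_herglotz (\<nu> n) (F n w)) \<longlonglongrightarrow> 0"
  proof (rule Lim_null_comparison)
    show "\<forall>\<^sub>F n in sequentially. norm (complex_of_real (d n) * outer_herglotz (\<nu> n) (F n w)) \<le> d n * ((r1 + 1) / (r1 - 1))"
      using away
    proof eventually_elim
      case (elim n)
      then show ?case unfolding norm_mult norm_of_real
        using P_le[OF rr(1), of "F n w" n] d_pos[of n] by (intro mult_mono) auto
    qed
    have "(\<lambda>n. d n * ((r1 + 1) / (r1 - 1))) \<longlonglongrightarrow> 0 * ((r1 + 1) / (r1 - 1))" by (intro tendsto_intros d_lim)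
    then show "(\<lambda>n. d n * ((r1 + 1) / (r1 - 1))) \<longlonglongrightarrow> 0" by simp
  qed
  have "(\<lambda>n. g (f n w) * exp (- (complex_of_real (d n) * outer_herglotz (\<nu> n) (F n w)))) \<longlonglongrightarrow> g w * exp (- 0)"
    by (intro tendsto_intros glim hF)
  moreover have "g (f n w) * exp (- (complex_of_real (d n) * outer_herglotz (\<nu> n) (F n w))) = F n w" for n
    unfolding conj[OF w, symmetric] by (simp add: f_def mult.assoc exp_minus_inverse)
  ultimately have Flim: "(\<lambda>n. F n w) \<longlonglongrightarrow> g w" by simp
  have "(\<lambda>n. outer_herglotz (\<nu> n) (F n w) - outer_herglotz (\<nu> n) (g w)) \<longlonglongrightarrow> 0"
  proof (rule Lim_null_comparison)
    show "\<forall>\<^sub>F n in sequentially. norm (outer_herglotz (\<nu> n) (F n w) - outer_herglotz (\<nu> n) (g w)) \<le> 2 / (r1 - 1)\<^sup>2 * norm (F n w - g w)"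
      using away by eventually_elim (intro outer_herglotz_lipschitz \<nu>, use rr in auto)
    have "(\<lambda>n. 2 / (r1 - 1)\<^sup>2 * norm (F n w - g w)) \<longlonglongrightarrow> 2 / (r1 - 1)\<^sup>2 * norm (g w - g w)"
      by (intro tendsto_intros Flim)
    then show "(\<lambda>n. 2 / (r1 - 1)\<^sup>2 * norm (F n w - g w)) \<longlonglongrightarrow> 0" by simp
  qed
  from tendsto_add[OF this conv[OF gw]] have "(\<lambda>n. outer_herglotz (\<nu> n) (F n w)) \<longlonglongrightarrow> outer_herglotz \<mu> (g w)" by simp
  then have 2: "(\<lambda>n. Re (outer_herglotz (\<nu> n) (F n w))) \<longlonglongrightarrow> Re (outer_herglotz \<mu> (g w))" by (intro tendsto_intros)
  have "ln (norm (F n w / g w)) / d n = ln (norm (g (f n w) / g w)) / d n - Re (outer_herglotz (\<nu> n) (F n w))" for n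
  proof -
    have "F n w \<noteq> 0" using F_outside[OF w, of n] by auto
    then have "ln (norm (F n w / g w)) = ln (norm (g (f n w) / g w)) - d n * Re (outer_herglotz (\<nu> n) (F n w))"
      using ln_F[OF w, of n] gnz[of n] gw0 by (simp add: norm_divide ln_div)
    then show ?thesis using d_pos[of n] by (simp add: diff_divide_distrib)
  qed
  then show ?thesis using tendsto_diff[OF 1 2] by simp
qed

text \<open>The same expansion, uniformly on one circle but only as an upper bound.\<close>

lemma boundary_circle_estimate:
  obtains M where "0 \<le> M" "\<forall>\<^sub>F n in sequentially. \<forall>w. norm w = r \<longrightarrow> \<bar>ln (norm (F n w / g w))\<bar> \<le> M * d n"
proof -
  define \<delta> where "\<delta> = min (r - 1) (R - r) / 2"
  have \<delta>: "0 < \<delta>" "\<delta> < r - 1" "\<delta> < R - r" using r by (auto simp: \<delta>_def min_def field_simps)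
  define A where "A = {z :: complex. r - \<delta> \<le> norm z \<and> norm z \<le> r + \<delta>}"
  have AR: "A \<subseteq> open_annulus R" using \<delta> by (auto simp: A_def open_annulus_def)
  have "compact A" unfolding compact_eq_bounded_closed
  proof
    show "bounded A" unfolding bounded_iff A_def by (intro exI[of _ "r + \<delta>"]) auto
    show "closed A" unfolding A_def by (intro closed_Collect_conj closed_Collect_le continuous_intros)
  qed
  moreover have "continuous_on A (deriv g)"
    using holomorphic_on_imp_continuous_on[OF holomorphic_deriv[OF holo open_open_annulus]] AR
    by (rule continuous_on_subset)
  ultimately have "bounded (deriv g ` A)" by (intro compact_imp_bounded compact_continuous_image)
  then obtain K0 where K0: "\<And>z. z \<in> A \<Longrightarrow> norm (deriv g z) \<le> K0" unfolding bounded_iff by blast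
  define K where "K = max K0 0"
  have K: "0 \<le> K" "\<And>z. z \<in> A \<Longrightarrow> norm (deriv g z) \<le> K" using K0 by (fastforce simp: K_def)+
  have lip: "norm (g z - g w) \<le> K * norm (z - w)" if w: "norm w = r" and z: "norm (z - w) \<le> \<delta>" for z w
  proof (rule field_differentiable_bound[of "cball w \<delta>" g "deriv g"])
    fix x assume "x \<in> cball w \<delta>"
    then have x: "norm (x - w) \<le> \<delta>" by (simp add: dist_norm norm_minus_commute)
    have "norm x \<le> r + \<delta>" using norm_triangle_ineq2[of x w] x w by simp
    moreover have "r - \<delta> \<le> norm x" using norm_triangle_ineq2[of w x] x w by (simp add: norm_minus_commute)
    ultimately have xA: "x \<in> A" by (simp add: A_def)
    then show "norm (deriv g x) \<le> K" by (rule K(2))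
    have "g field_differentiable at x" using xA AR holo open_open_annulus holomorphic_on_imp_differentiable_at by blast
    then show "(g has_field_derivative deriv g x) (at x within cball w \<delta>)"
      using DERIV_deriv_iff_field_differentiable has_field_derivative_at_within by blast
  qed (use z \<delta> in \<open>auto simp: dist_norm norm_minus_commute\<close>)
  have ne: "sphere (0::complex) r \<noteq> {}" using r by simp
  have contg: "continuous_on (sphere 0 r) (\<lambda>w. norm (g w))"
    by (intro continuous_intros continuous_on_subset[OF continuous[OF r(2)]]) (use r in \<open>auto simp: closed_annulus_def\<close>)
  obtain w0 where w0: "w0 \<in> sphere 0 r" "\<And>w. w \<in> sphere 0 r \<Longrightarrow> norm (g w0) \<le> norm (g w)"
    using continuous_attains_inf[OF compact_sphere ne contg] by blast
  define m where "m = norm (g w0)"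
  have m: "1 < m" unfolding m_def by (rule outside) (use w0(1) r in \<open>auto simp: open_annulus_def\<close>)
  define r1 where "r1 = (2 + m) / 3"
  define r2 where "r2 = (1 + 2 * m) / 3"
  have rr: "1 < r1" "r1 < r2" "r2 < m" using m by (auto simp: r1_def r2_def)
  define Q where "Q = (r + 1) / (r - 1)"
  have Q: "0 < Q" using r by (simp add: Q_def)
  define C where "C = r * exp 1 * Q"
  have C: "0 < C" using r Q by (simp add: C_def)
  define M where "M = K * C + (r1 + 1) / (r1 - 1)"
  have M: "0 \<le> M" using K C rr by (simp add: M_def)
  have fw: "norm (f n w - w) \<le> C * d n" if "d n * Q \<le> 1" "norm w = r" for n w
  proof -
    let ?h = "complex_of_real (d n) * outer_herglotz (\<nu> n) w"
    have "norm ?h = d n * norm (outer_herglotz (\<nu> n) w)" using d_pos[of n] by (simp add: norm_mult)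
    also have "\<dots> \<le> d n * Q" unfolding Q_def using P_le[OF r(1), of w n] d_pos[of n] that by (intro mult_left_mono) auto
    finally have h: "norm ?h \<le> d n * Q" .
    have "f n w - w = w * (exp ?h - 1)" by (simp add: f_def algebra_simps)
    then have "norm (f n w - w) = r * norm (exp ?h - 1)" using that by (simp add: norm_mult)
    also have "\<dots> \<le> r * (exp 1 * norm ?h)" using norm_exp_minus_one_le[of ?h] h that r by (intro mult_left_mono) auto
    also have "\<dots> \<le> r * (exp 1 * (d n * Q))" using h r by (intro mult_left_mono) auto
    finally show ?thesis by (simp add: C_def mult_ac)
  qed
  have "\<forall>\<^sub>F n in sequentially. d n < 1 / Q" "\<forall>\<^sub>F n in sequentially. d n < \<delta> / C" 
      "\<forall>\<^sub>F n in sequentially. d n < (m - r2) / (K * C + 1)"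
    using Q \<delta> C K rr by (intro d_small divide_pos_pos; simp add: add_nonneg_pos)+
  then have "\<forall>\<^sub>F n in sequentially. \<forall>w. norm w = r \<longrightarrow> \<bar>ln (norm (F n w / g w))\<bar> \<le> M * d n"
    using F_away[OF rr(1,2)]
  proof eventually_elim
    case (elim n)
    have 1: "d n * Q \<le> 1" using elim(1) Q by (simp add: field_simps)
    have 2: "C * d n \<le> \<delta>" using elim(2) C by (simp add: field_simps)
    have kc: "0 < K * C + 1" using K C by (simp add: add_nonneg_pos)
    have 3: "(K * C + 1) * d n < m - r2" using elim(3) unfolding pos_less_divide_eq[OF kc] by (simp only: mult.commute)
    show ?case
    proof (intro allI impI)
      fix w :: complex assume w: "norm w = r"
      have w': "1 < norm w" "norm w \<le> r" using w r by auto
      have gw: "m \<le> norm (g w)" using w0(2)[of w] w by (simp add: m_def)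
      have "norm (g (f n w) - g w) \<le> K * norm (f n w - w)"
        by (rule lip[OF w]) (use fw[OF 1 w] 2 in linarith)
      also have "\<dots> \<le> K * (C * d n)" using fw[OF 1 w] K by (intro mult_left_mono)
      finally have gd: "norm (g (f n w) - g w) \<le> K * C * d n" by simp
      have "norm (g w) - norm (g (f n w)) \<le> K * C * d n"
        using norm_triangle_ineq2[of "g w" "g (f n w)"] gd by (simp add: norm_minus_commute)
      moreover have "K * C * d n < m - r2" using 3 d_pos[of n] by (simp add: distrib_right)
      ultimately have r2: "r2 < norm (g (f n w))" using gw by linarith
      have F1: "r1 < norm (F n w)" using elim(4) w' r2 by blast
      have "\<bar>ln (norm (g (f n w))) - ln (norm (g w))\<bar> \<le> \<bar>norm (g (f n w)) - norm (g w)\<bar>"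
        by (rule abs_ln_diff_le) (use r2 rr gw m in auto)
      also have "\<dots> \<le> K * C * d n" using norm_triangle_ineq3[of "g (f n w)" "g w"] gd by linarith
      finally have a: "\<bar>ln (norm (g (f n w))) - ln (norm (g w))\<bar> \<le> K * C * d n" .
      have "\<bar>Re (outer_herglotz (\<nu> n) (F n w))\<bar> \<le> (r1 + 1) / (r1 - 1)"
        using abs_Re_le_cmod[of "outer_herglotz (\<nu> n) (F n w)"] P_le[OF rr(1), of "F n w" n] F1 by linarith
      moreover have "\<bar>d n * Re (outer_herglotz (\<nu> n) (F n w))\<bar> \<le> (r1 + 1) / (r1 - 1) * d n"
        if "\<bar>Re (outer_herglotz (\<nu> n) (F n w))\<bar> \<le> (r1 + 1) / (r1 - 1)"
      proof -
        have "\<bar>d n * Re (outer_herglotz (\<nu> n) (F n w))\<bar> = \<bar>Re (outer_herglotz (\<nu> n) (F n w))\<bar> * d n"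
          using d_pos[of n] by (simp add: abs_mult)
        also have "\<dots> \<le> (r1 + 1) / (r1 - 1) * d n" by (rule mult_right_mono[OF that]) (use d_pos[of n] in simp)
        finally show ?thesis .
      qed
      ultimately have b: "\<bar>d n * Re (outer_herglotz (\<nu> n) (F n w))\<bar> \<le> (r1 + 1) / (r1 - 1) * d n" by blast
      have "F n w \<noteq> 0" "g w \<noteq> 0" using F1 rr gw m by auto
      then have "ln (norm (F n w / g w)) = (ln (norm (g (f n w))) - ln (norm (g w))) - d n * Re (outer_herglotz (\<nu> n) (F n w))"
        using ln_F[OF w', of n] by (simp add: norm_divide ln_div)
      then show "\<bar>ln (norm (F n w / g w))\<bar> \<le> M * d n" using a b unfolding M_def distrib_right by linarith
    qed
  qed
  then show thesis using that M by blast
qed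

text \<open>The function \<open>F n / g\<close> has modulus \<open>1\<close> on the circle, and it is within \<open>d n\<close> of
  modulus \<open>1\<close> on a larger circle. The maximum principle therefore bounds \<open>ln |F n / g| / d n\<close> by a multiple
  of \<open>ln |w|\<close>, uniformly in \<open>n\<close>, and the bound passes to the limit.\<close>

lemma velocity_boundary_estimate:
  "\<exists>c. \<forall>w\<in>open_annulus r. 
    \<bar>Re (angular_deriv g w * outer_herglotz \<mu> w) - Re (outer_herglotz \<mu> (g w))\<bar> \<le> c * ln (norm w)"
proof -
  obtain M where M: "0 \<le> M" and ev: "\<forall>\<^sub>F n in sequentially. \<forall>w. norm w = r \<longrightarrow> \<bar>ln (norm (F n w / g w))\<bar> \<le> M * d n"
    by (rule boundary_circle_estimate)
  have lnr: "0 < ln r" using r by simp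
  define k where "k = nat \<lceil>2 * M / ln r\<rceil>"
  have "2 * M / ln r \<le> real k" unfolding k_def by linarith
  then have k: "2 * M \<le> real k * ln r" using lnr by (simp add: divide_le_eq)
  have gnz: "g z \<noteq> 0" if "z \<in> closed_annulus r" for z using g_nz[of z] that r by (simp add: closed_annulus_def)
  have Fnz: "F n z \<noteq> 0" if "z \<in> closed_annulus r" for n z 
    using F_circle[of z n] F_outside[of z n] that by (cases "norm z = 1") (auto simp: closed_annulus_def)
  have bound: "\<forall>\<^sub>F n in sequentially. \<bar>ln (norm (F n w / g w)) / d n\<bar> \<le> real k * ln (norm w)" if w: "w \<in> open_annulus r" for w
    using ev d_small[OF zero_less_one]
  proof eventually_elim
    case (elim n)
    \<comment> \<open>The power that turns a bound of order \<open>d n\<close> on the larger circle into one of order \<open>1\<close>.\<close>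
    define N where "N = nat \<lceil>1 / d n\<rceil>"
    have N: "1 / d n \<le> real N" "real N \<le> 1 / d n + 1" using d_pos[of n] unfolding N_def by (simp_all add: ceiling_correct)
    have "real N * (M * d n) \<le> (1 / d n + 1) * (M * d n)" using N M d_pos[of n] by (intro mult_right_mono) auto
    also have "\<dots> = M * (1 + d n)" using d_pos[of n] by (simp add: field_simps)
    also have "\<dots> \<le> M * 2" using elim(2) M by (intro mult_left_mono) auto
    finally have Nk: "real N * (M * d n) \<le> real k * ln r" using k by simp
    have "real N * \<bar>ln (norm (F n w / g w))\<bar> \<le> real k * ln (norm w)"
    proof (rule annulus_modulus_bound[OF r(1) _ _ _ _ _ Nk w])
      show "continuous_on (closed_annulus r) (\<lambda>w. F n w / g w)"
        using gnz by (intro continuous_intros F_cont continuous[OF r(2)]) auto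
      show "(\<lambda>w. F n w / g w) holomorphic_on open_annulus r"
        using gnz open_annulus_subset r
        by (intro holomorphic_intros F_holo holomorphic_on_subset[OF holo]) (auto simp: open_annulus_def closed_annulus_def)
      show "norm (F n z / g z) = 1" if "norm z = 1" for z using F_circle[OF that] norm_circle[OF that] by (simp add: norm_divide)
    qed (use Fnz gnz elim(1) in auto)
    moreover have "\<bar>ln (norm (F n w / g w)) / d n\<bar> \<le> real N * \<bar>ln (norm (F n w / g w))\<bar>"
    proof -
      have "\<bar>ln (norm (F n w / g w)) / d n\<bar> = 1 / d n * \<bar>ln (norm (F n w / g w))\<bar>" using d_pos[of n] by (simp add: abs_divide)
      also have "\<dots> \<le> real N * \<bar>ln (norm (F n w / g w))\<bar>" by (rule mult_right_mono[OF N(1)]) simp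
      finally show ?thesis .
    qed
    ultimately show ?case by linarith
  qed
  show ?thesis
  proof (intro exI[of _ "real k"] ballI)
    fix w assume w: "w \<in> open_annulus r"
    then have w': "1 < norm w" "norm w \<le> r" by (auto simp: open_annulus_def)
    show "\<bar>Re (angular_deriv g w * outer_herglotz \<mu> w) - Re (outer_herglotz \<mu> (g w))\<bar> \<le> real k * ln (norm w)"
      by (rule tendsto_upperbound[OF tendsto_rabs[OF pointwise_limit[OF w']] bound[OF w]]) simp
  qed
qed

end

section \<open>The infinitesimal measure is conformal\<close>

lemma circle_density:
  assumes M: "finite_measure M" "sets M = sets circle_borel" and h: "continuous_on (sphere 0 1) h"
    and pos: "\<And>\<xi>. \<xi> \<in> sphere 0 1 \<Longrightarrow> 0 \<le> h \<xi>"
  defines "D \<equiv> density M (\<lambda>\<xi>. ennreal (h \<xi>))"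
  shows "finite_measure D" "sets D = sets circle_borel"
    and "\<And>f :: complex \<Rightarrow> complex. continuous_on (sphere 0 1) f \<Longrightarrow> integral\<^sup>L D f = (\<integral>\<xi>. h \<xi> *\<^sub>R f \<xi> \<partial>M)"
proof -
  have sp: "space M = sphere 0 1" by (rule space_circle[OF M(2)])
  have hm: "h \<in> borel_measurable M" by (rule circle_measurable[OF M(2) h])
  show "sets D = sets circle_borel" by (simp add: D_def M)
  show "finite_measure D"
  proof
    have "emeasure D (space D) = (\<integral>\<^sup>+\<xi>. ennreal (h \<xi>) \<partial>M)"
      unfolding D_def using hm by (subst emeasure_density) (auto intro!: nn_integral_cong simp: indicator_def)
    also have "\<dots> = ennreal (\<integral>\<xi>. h \<xi> \<partial>M)"
      by (rule nn_integral_eq_integral[OF circle_integrable[OF M h]]) (use pos sp in auto)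
    finally show "emeasure D (space D) \<noteq> \<infinity>" by simp
  qed
  fix f :: "complex \<Rightarrow> complex" assume f: "continuous_on (sphere 0 1) f"
  show "integral\<^sup>L D f = (\<integral>\<xi>. h \<xi> *\<^sub>R f \<xi> \<partial>M)"
    unfolding D_def by (rule integral_density[OF circle_measurable[OF M(2) f] hm]) (use pos sp in auto)
qed

context outer_diffeo
begin

text \<open>The two measures that are compared are \<open>|g'| \<mu>\<close> and the pull-back of \<open>\<mu>\<close> under \<open>g\<close> divided by
  \<open>|g'|\<close>. Their equality is conformality with exponent \<open>2\<close>.\<close>

lemma conformal_of_boundary_estimate:
  assumes \<mu>: "prob_space \<mu>" "sets \<mu> = sets circle_borel" and r: "1 < r" "r < R"
    and est: "\<And>w. w \<in> open_annulus r \<Longrightarrow> 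
      \<bar>Re (angular_deriv g w * outer_herglotz \<mu> w) - Re (outer_herglotz \<mu> (g w))\<bar> \<le> c * ln (norm w)"
  shows "is_conformal_measure 2 g \<mu>"
proof -
  interpret \<mu>: prob_space \<mu> by fact
  have sp: "space \<mu> = sphere 0 1" by (rule space_circle[OF \<mu>(2)])
  define s where "s = (\<lambda>\<xi>. norm (deriv g \<xi>))"
  have s_cont: "continuous_on (sphere 0 1) s"
    unfolding s_def using analytic analytic_deriv analytic_imp_holomorphic holomorphic_on_imp_continuous_on 
    by (intro continuous_intros) blast
  have s_pos: "0 < s \<xi>" if "\<xi> \<in> sphere 0 1" for \<xi> using deriv_nz[OF that] by (simp add: s_def)
  have inv_cont: "continuous_on (sphere 0 1) (\<lambda>\<xi>. 1 / s \<xi>)"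
    using s_pos by (intro continuous_intros s_cont) force
  have g_cont: "continuous_on (sphere 0 1) g"
    using analytic analytic_imp_holomorphic holomorphic_on_imp_continuous_on by blast
  define k where "k = inv_into (sphere 0 1) g"
  have inj: "inj_on g (sphere 0 1)" and img: "g ` sphere 0 1 = sphere 0 1" using bij by (auto simp: bij_betw_def)
  have kg: "k (g \<xi>) = \<xi>" if "\<xi> \<in> sphere 0 1" for \<xi> unfolding k_def by (rule inv_into_f_f[OF inj that])
  have gk: "g (k \<xi>) = \<xi>" "k \<xi> \<in> sphere 0 1" if "\<xi> \<in> sphere 0 1" for \<xi>
  proof -
    have "\<xi> \<in> g ` sphere 0 1" using img that by simp
    then show "g (k \<xi>) = \<xi>" "k \<xi> \<in> sphere 0 1" unfolding k_def by (rule f_inv_into_f, rule inv_into_into)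
  qed
  have "continuous_on (g ` sphere 0 1) k"
    by (rule continuous_on_inv[OF g_cont compact_sphere]) (use kg in auto)
  then have k_cont: "continuous_on (sphere 0 1) k" by (simp only: img)
  have km: "k \<in> measurable \<mu> circle_borel"
    by (rule measurable_restrict_space2) (use gk sp circle_measurable[OF \<mu>(2) k_cont] in auto)
  define \<mu>' where "\<mu>' = distr \<mu> circle_borel k"
  have \<mu>': "finite_measure \<mu>'" "sets \<mu>' = sets circle_borel"
    using \<mu>.finite_measure_distr[OF km] by (auto simp: \<mu>'_def)
  interpret \<mu>': prob_space \<mu>' unfolding \<mu>'_def by (rule \<mu>.prob_space_distr[OF km])
  have sp': "space \<mu>' = sphere 0 1" by (rule space_circle[OF \<mu>'(2)])
  define N1 where "N1 = density \<mu> (\<lambda>\<xi>. ennreal (s \<xi>))"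
  define N2 where "N2 = density \<mu>' (\<lambda>\<xi>. ennreal (1 / s \<xi>))"
  have s0: "0 \<le> s \<xi>" "0 \<le> 1 / s \<xi>" for \<xi> by (auto simp: s_def)
  note D1 = circle_density[OF \<mu>.finite_measure_axioms \<mu>(2) s_cont s0(1), folded N1_def]
  note D2 = circle_density[OF \<mu>' inv_cont s0(2), folded N2_def]
  obtain c2 where c2: "\<And>\<eta> w. \<eta> \<in> sphere 0 1 \<Longrightarrow> w \<in> open_annulus r \<Longrightarrow>
      \<bar>Re ((g w + g \<eta>) / (g w - g \<eta>)) - 1 / norm (deriv g \<eta>) * Re ((w + \<eta>) / (w - \<eta>))\<bar> \<le> c2 * ln (norm w)"
     "\<And>\<eta> w. \<eta> \<in> sphere 0 1 \<Longrightarrow> w \<in> open_annulus r \<Longrightarrow>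
      \<bar>Re (angular_deriv g w * ((w + \<eta>) / (w - \<eta>))) - norm (deriv g \<eta>) * Re ((w + \<eta>) / (w - \<eta>))\<bar> \<le> c2 * ln (norm w)"
    using kernel_comparison[OF r] by meson
  have int_bound: "\<bar>Re (integral\<^sup>L K f1) - Re (integral\<^sup>L K f2)\<bar> \<le> B"
    if K: "prob_space K" "sets K = sets circle_borel" and f: "continuous_on (sphere 0 1) f1" "continuous_on (sphere 0 1) f2"
      and B: "\<And>\<xi>. \<xi> \<in> sphere 0 1 \<Longrightarrow> \<bar>Re (f1 \<xi>) - Re (f2 \<xi>)\<bar> \<le> B" for K B and f1 f2 :: "complex \<Rightarrow> complex"
  proof -
    interpret K: prob_space K by fact
    note i = circle_integrable[OF K.finite_measure_axioms K(2)]
    have "Re (integral\<^sup>L K f1) - Re (integral\<^sup>L K f2) = (\<integral>\<xi>. Re (f1 \<xi>) \<partial>K) - (\<integral>\<xi>. Re (f2 \<xi>) \<partial>K)"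
      using integral_bounded_linear[OF bounded_linear_Re i[OF f(1)]] integral_bounded_linear[OF bounded_linear_Re i[OF f(2)]] by simp
    also have "\<dots> = (\<integral>\<xi>. Re (f1 \<xi>) - Re (f2 \<xi>) \<partial>K)"
      by (rule Bochner_Integration.integral_diff[symmetric]) (intro i continuous_intros f)+
    also have "\<bar>\<dots>\<bar> \<le> (\<integral>\<xi>. \<bar>Re (f1 \<xi>) - Re (f2 \<xi>)\<bar> \<partial>K)" by (rule integral_abs_bound)
    also have "\<dots> \<le> (\<integral>\<xi>. B \<partial>K)"
      by (rule integral_mono) (use B space_circle[OF K(2)] in \<open>auto intro!: i continuous_intros f\<close>)
    finally show ?thesis by (simp add: K.prob_space)
  qed
  have "N1 = N2"
  proof (rule circle_measure_eqI_Re_boundary[OF D1(1,2) D2(1,2) r(1)])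
    fix w :: complex assume w: "1 < norm w" "norm w < r"
    then have wa: "w \<in> open_annulus r" by (simp add: open_annulus_def)
    have gw: "1 < norm (g w)" by (rule outside) (use w r in \<open>auto simp: open_annulus_def\<close>)
    note kc = outer_kernel_cont[OF w(1)]
    have kg_cont: "continuous_on (sphere 0 1) (\<lambda>\<xi>. (g w + g \<xi>) / (g w - g \<xi>))"
      by (rule continuous_on_compose2[OF outer_kernel_cont[OF gw] g_cont]) (simp add: img)
    have e1: "\<bar>Re (\<integral>\<xi>. s \<xi> *\<^sub>R ((w + \<xi>) / (w - \<xi>)) \<partial>\<mu>) - Re (\<integral>\<xi>. angular_deriv g w * ((w + \<xi>) / (w - \<xi>)) \<partial>\<mu>)\<bar> \<le> c2 * ln (norm w)"
    proof (rule int_bound[OF \<mu>])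
      fix \<xi> :: complex assume "\<xi> \<in> sphere 0 1"
      from c2(2)[OF this wa] show "\<bar>Re (s \<xi> *\<^sub>R ((w + \<xi>) / (w - \<xi>))) - Re (angular_deriv g w * ((w + \<xi>) / (w - \<xi>)))\<bar> \<le> c2 * ln (norm w)"
        unfolding scaleR_complex.simps s_def by linarith
    qed (intro continuous_on_scaleR continuous_on_mult continuous_on_const s_cont kc)+
    have e2: "\<bar>Re (\<integral>\<xi>. (g w + g \<xi>) / (g w - g \<xi>) \<partial>\<mu>') - Re (\<integral>\<xi>. (1 / s \<xi>) *\<^sub>R ((w + \<xi>) / (w - \<xi>)) \<partial>\<mu>')\<bar> \<le> c2 * ln (norm w)"
    proof (rule int_bound[OF \<mu>'.prob_space_axioms \<mu>'(2) kg_cont])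
      fix \<xi> :: complex assume "\<xi> \<in> sphere 0 1"
      from c2(1)[OF this wa] show "\<bar>Re ((g w + g \<xi>) / (g w - g \<xi>)) - Re ((1 / s \<xi>) *\<^sub>R ((w + \<xi>) / (w - \<xi>)))\<bar> \<le> c2 * ln (norm w)"
        unfolding scaleR_complex.simps s_def .
    qed (intro continuous_on_scaleR inv_cont kc)
    have "(\<integral>\<xi>. (g w + g \<xi>) / (g w - g \<xi>) \<partial>\<mu>') = (\<integral>\<xi>. (g w + g (k \<xi>)) / (g w - g (k \<xi>)) \<partial>\<mu>)"
      unfolding \<mu>'_def by (rule integral_distr[OF km circle_measurable[OF refl kg_cont]])
    also have "\<dots> = outer_herglotz \<mu> (g w)"
      unfolding outer_herglotz_def by (rule Bochner_Integration.integral_cong) (use gk sp in auto)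
    finally have o2: "(\<integral>\<xi>. (g w + g \<xi>) / (g w - g \<xi>) \<partial>\<mu>') = outer_herglotz \<mu> (g w)" .
    have o1: "(\<integral>\<xi>. angular_deriv g w * ((w + \<xi>) / (w - \<xi>)) \<partial>\<mu>) = angular_deriv g w * outer_herglotz \<mu> w"
      unfolding outer_herglotz_def by (rule integral_mult_right_zero)
    have n1: "outer_herglotz N1 w = (\<integral>\<xi>. s \<xi> *\<^sub>R ((w + \<xi>) / (w - \<xi>)) \<partial>\<mu>)"
      unfolding outer_herglotz_def by (rule D1(3)[OF kc])
    have n2: "outer_herglotz N2 w = (\<integral>\<xi>. (1 / s \<xi>) *\<^sub>R ((w + \<xi>) / (w - \<xi>)) \<partial>\<mu>')"
      unfolding outer_herglotz_def by (rule D2(3)[OF kc])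
    have "\<bar>Re (outer_herglotz N1 w) - Re (outer_herglotz N2 w)\<bar> \<le> c2 * ln (norm w) + c * ln (norm w) + c2 * ln (norm w)"
      using e1 e2 est[OF wa] unfolding n1[symmetric] n2[symmetric] o1 o2 by linarith
    then show "\<bar>Re (outer_herglotz N1 w) - Re (outer_herglotz N2 w)\<bar> \<le> (c2 + c + c2) * ln (norm w)"
      by (simp add: distrib_right)
  qed
  show ?thesis unfolding is_conformal_measure_def
  proof (intro conjI ballI \<mu>)
    fix E assume "E \<in> sets \<mu>"
    then have E: "E \<in> sets circle_borel" using \<mu>(2) by simp
    have Es: "E \<subseteq> sphere 0 1" using E by (simp add: sets_circle_iff)
    have sm: "s \<in> borel_measurable M" if "sets M = sets circle_borel" for M
      by (rule circle_measurable[OF that s_cont])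
    have im: "(\<lambda>\<xi>. 1 / s \<xi>) \<in> borel_measurable \<mu>'" by (rule circle_measurable[OF \<mu>'(2) inv_cont])
    have indE: "indicator E \<in> borel_measurable M" if "sets M = sets circle_borel" for M :: "complex measure"
      by (rule borel_measurable_indicator) (use E that in simp)
    have fm: "(\<lambda>\<xi>. ennreal (s \<xi>) * indicator E \<xi>) \<in> borel_measurable M" if "sets M = sets circle_borel" for M
      by (intro borel_measurable_times_ennreal measurable_compose[OF sm[OF that] measurable_ennreal] indE[OF that])
    have "(\<integral>\<^sup>+\<xi>\<in>E. ennreal (norm (deriv g \<xi>) powr 2) \<partial>\<mu>) = (\<integral>\<^sup>+\<xi>. ennreal (s \<xi>) * (ennreal (s \<xi>) * indicator E \<xi>) \<partial>\<mu>)"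
    proof (rule nn_integral_cong)
      fix \<xi> assume "\<xi> \<in> space \<mu>"
      then have "0 < s \<xi>" using s_pos sp by simp
      then have "ennreal (s \<xi> powr 2) = ennreal (s \<xi>) * ennreal (s \<xi>)"
        by (simp add: power2_eq_square ennreal_mult)
      then show "ennreal (norm (deriv g \<xi>) powr 2) * indicator E \<xi> = ennreal (s \<xi>) * (ennreal (s \<xi>) * indicator E \<xi>)"
        by (simp add: s_def mult.assoc)
    qed
    also have "\<dots> = (\<integral>\<^sup>+\<xi>. ennreal (s \<xi>) * indicator E \<xi> \<partial>N1)"
      unfolding N1_def by (rule nn_integral_density[symmetric, OF measurable_compose[OF sm[OF \<mu>(2)] measurable_ennreal] fm[OF \<mu>(2)]])
    also have "\<dots> = (\<integral>\<^sup>+\<xi>. ennreal (s \<xi>) * indicator E \<xi> \<partial>N2)" unfolding \<open>N1 = N2\<close> ..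
    also have "\<dots> = (\<integral>\<^sup>+\<xi>. ennreal (1 / s \<xi>) * (ennreal (s \<xi>) * indicator E \<xi>) \<partial>\<mu>')"
      unfolding N2_def by (rule nn_integral_density[OF measurable_compose[OF im measurable_ennreal] fm[OF \<mu>'(2)]])
    also have "\<dots> = (\<integral>\<^sup>+\<xi>. indicator E \<xi> \<partial>\<mu>')"
    proof (rule nn_integral_cong)
      fix \<xi> assume "\<xi> \<in> space \<mu>'"
      then have p: "0 < s \<xi>" using s_pos sp' by simp
      then have "ennreal (1 / s \<xi>) * ennreal (s \<xi>) = ennreal (1 / s \<xi> * s \<xi>)" by (subst ennreal_mult) auto
      then have "ennreal (1 / s \<xi>) * ennreal (s \<xi>) = 1" using p by simp
      then show "ennreal (1 / s \<xi>) * (ennreal (s \<xi>) * indicator E \<xi>) = indicator E \<xi>"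
        by (simp only: mult.assoc[symmetric]) simp
    qed
    also have "\<dots> = emeasure \<mu>' E" using E \<mu>'(2) by (intro nn_integral_indicator) simp
    also have "\<dots> = emeasure \<mu> (k -` E \<inter> space \<mu>)" unfolding \<mu>'_def by (rule emeasure_distr[OF km E])
    also have "k -` E \<inter> space \<mu> = g ` E"
    proof (intro equalityI subsetI)
      fix y assume "y \<in> k -` E \<inter> space \<mu>"
      then show "y \<in> g ` E" using gk[of y] sp by (intro image_eqI[of _ _ "k y"]) auto
    next
      fix y assume "y \<in> g ` E"
      then obtain x where x: "x \<in> E" "y = g x" by blast
      then have "x \<in> sphere 0 1" using Es by blast
      then have "k y = x" "y \<in> sphere 0 1" using kg x img by auto
      then show "y \<in> k -` E \<inter> space \<mu>" using x sp by simp
    qed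
    finally show "emeasure \<mu> (g ` E) = (\<integral>\<^sup>+\<xi>\<in>E. ennreal (norm (deriv g \<xi>) powr 2) \<partial>\<mu>)" ..
  qed
qed

end

section \<open>Exterior maps and the Loewner chain\<close>

lemma open_ext_disk: "open ext_disk"
  unfolding ext_disk_def by (intro open_Collect_less continuous_intros)

lemma ext_disk_iff: "z \<in> ext_disk \<longleftrightarrow> 1 < norm z" by (simp add: ext_disk_def)

text \<open>The image of the outside of a circle is the outside of the image of that circle, and injectivity keeps
  the points inside the circle out of it.\<close>

lemma exterior_bounded_inside:
  assumes hol: "f holomorphic_on ext_disk" and inj: "inj_on f ext_disk"
    and inf: "filterlim f at_infinity at_infinity"
    and s: "1 < s" and B: "\<And>z. norm z = s \<Longrightarrow> norm (f z) \<le> B"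
    and v: "1 < norm v" "norm v \<le> s"
  shows "norm (f v) \<le> B"
proof (rule ccontr)
  assume "\<not> norm (f v) \<le> B"
  then have fv: "B < norm (f v)" by simp
  let ?W = "- cball (0::complex) B"
  let ?S = "{z :: complex. s < norm z}" and ?S' = "{z :: complex. s \<le> norm z}"
  have sub: "?S \<subseteq> ext_disk" "?S' \<subseteq> ext_disk" using s by (auto simp: ext_disk_iff)
  have opS: "open ?S" by (intro open_Collect_less continuous_intros)
  have opI: "open (f ` ?S)"
    by (rule open_mapping_thm3[OF holomorphic_on_subset[OF hol sub(1)] opS inj_on_subset[OF inj sub(1)]])
  have clI: "closed (f ` ?S')"
    unfolding closed_sequential_limits
  proof (intro allI impI, elim conjE)
    fix X l assume X: "\<forall>n. X n \<in> f ` ?S'" and Xl: "X \<longlonglongrightarrow> l"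
    then obtain z where z: "\<And>n. s \<le> norm (z n)" "\<And>n. X n = f (z n)" by (auto simp: image_iff) metis
    have "bounded (range X)" using Xl convergent_imp_bounded by blast
    then obtain C where C: "\<And>n. norm (X n) \<le> C" unfolding bounded_iff by blast
    have "\<forall>\<^sub>F z in at_infinity. max C 0 + 1 \<le> norm (f z)"
      using inf unfolding filterlim_at_infinity[OF order_refl] by (simp add: add_nonneg_pos)
    then obtain D where D: "\<And>z. D \<le> norm z \<Longrightarrow> max C 0 + 1 \<le> norm (f z)" unfolding eventually_at_infinity by blast
    have zD: "norm (z n) \<le> D" for n
    proof (rule ccontr)
      assume "\<not> norm (z n) \<le> D"
      then have "max C 0 + 1 \<le> norm (f (z n))" by (intro D) simp
      then show False using C[of n] z(2)[of n] by simp
    qed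
    have "compact (cball (0::complex) D)" by simp
    then obtain l' r where r: "strict_mono (r :: nat \<Rightarrow> nat)" "(z \<circ> r) \<longlonglongrightarrow> l'"
      using zD unfolding compact_def by (metis mem_cball_0)
    have l's: "s \<le> norm l'" 
      by (rule LIMSEQ_le_const[OF tendsto_norm[OF r(2)]]) (use z(1) in auto)
    then have "l' \<in> ext_disk" using s by (simp add: ext_disk_iff)
    then have "isCont f l'" using holomorphic_on_imp_continuous_on[OF hol] open_ext_disk continuous_on_eq_continuous_at by blast
    then have "(\<lambda>n. f ((z \<circ> r) n)) \<longlonglongrightarrow> f l'" using r(2) by (rule isCont_tendsto_compose)
    moreover have "(\<lambda>n. f ((z \<circ> r) n)) = X \<circ> r" using z(2) by (auto simp: o_def)
    ultimately have "l = f l'" using LIMSEQ_subseq_LIMSEQ[OF Xl r(1)] LIMSEQ_unique by metis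
    then show "l \<in> f ` ?S'" using l's by blast
  qed
  have eq: "?W \<inter> f ` ?S = ?W \<inter> f ` ?S'"
  proof
    show "?W \<inter> f ` ?S' \<subseteq> ?W \<inter> f ` ?S"
    proof
      fix y assume y: "y \<in> ?W \<inter> f ` ?S'"
      then obtain z where z: "y = f z" "s \<le> norm z" by blast
      have "norm z \<noteq> s" using B[of z] y z by auto
      then show "y \<in> ?W \<inter> f ` ?S" using y z by auto
    qed
  qed auto
  have "connected ?W" by (rule connected_complement_bounded_convex) auto
  moreover have "openin (top_of_set ?W) (?W \<inter> f ` ?S)" using opI by (simp add: openin_open_Int)
  moreover have "closedin (top_of_set ?W) (?W \<inter> f ` ?S)" unfolding eq using clI by (simp add: closedin_closed_Int)
  ultimately have "?W \<inter> f ` ?S = {} \<or> ?W \<inter> f ` ?S = ?W" unfolding connected_clopen by blast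
  moreover have "?W \<inter> f ` ?S \<noteq> {}"
  proof -
    have "\<forall>\<^sub>F z in at_infinity. max B 0 + 1 \<le> norm (f z)"
      using inf unfolding filterlim_at_infinity[OF order_refl] by (simp add: add_nonneg_pos)
    then obtain D where D: "\<And>z. D \<le> norm z \<Longrightarrow> max B 0 + 1 \<le> norm (f z)" unfolding eventually_at_infinity by blast
    define z where "z = complex_of_real (max \<bar>D\<bar> s + 1)"
    have nz: "norm z = max \<bar>D\<bar> s + 1" using s unfolding z_def norm_of_real by simp
    then have "max B 0 + 1 \<le> norm (f z)" by (intro D) simp
    then have "f z \<in> ?W \<inter> f ` ?S" using nz by auto
    then show ?thesis by blast
  qed
  ultimately have "?W \<subseteq> f ` ?S" by blast
  moreover have "f v \<in> ?W" using fv by simp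
  ultimately obtain z where z: "f v = f z" "s < norm z" by blast
  have "v = z" using inj_onD[OF inj z(1)] v z(2) s by (simp add: ext_disk_iff)
  then show False using z(2) v by simp
qed

lemma exterior_map_asymptotics:
  assumes "exterior_map K c \<phi>"
  shows "((\<lambda>z. \<phi> z / z) \<longlongrightarrow> of_real (exp c)) at_infinity" "filterlim \<phi> at_infinity at_infinity"
proof -
  have "(\<lambda>z. \<phi> z - of_real (exp c) * z) \<in> O[at_infinity](\<lambda>_. 1)" using assms by (simp add: exterior_map_def)
  then obtain C where C: "\<forall>\<^sub>F z in at_infinity. norm (\<phi> z - of_real (exp c) * z) \<le> C * norm (1::complex)" by (rule landau_o.bigE)
  have inv: "((\<lambda>z::complex. norm (inverse z)) \<longlongrightarrow> 0) at_infinity"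
    using tendsto_inverse_0 tendsto_norm_zero by blast
  have "((\<lambda>z. \<phi> z / z - of_real (exp c)) \<longlongrightarrow> 0) at_infinity"
  proof (rule Lim_null_comparison)
    show "\<forall>\<^sub>F z in at_infinity. norm (\<phi> z / z - of_real (exp c)) \<le> C * norm (inverse z)"
      using C eventually_not_equal_at_infinity[of 0]
    proof eventually_elim
      case (elim z)
      have "\<phi> z / z - of_real (exp c) = (\<phi> z - of_real (exp c) * z) * inverse z" using elim(2) by (simp add: field_simps)
      then have "norm (\<phi> z / z - of_real (exp c)) = norm (\<phi> z - of_real (exp c) * z) * norm (inverse z)" by (simp add: norm_mult)
      also have "\<dots> \<le> C * norm (inverse z)" using elim(1) by (intro mult_right_mono) auto
      finally show ?case .
    qed
    have "((\<lambda>z::complex. C * norm (inverse z)) \<longlongrightarrow> C * 0) at_infinity" by (intro tendsto_intros inv)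
    then show "((\<lambda>z::complex. C * norm (inverse z)) \<longlongrightarrow> 0) at_infinity" by simp
  qed
  then show lim: "((\<lambda>z. \<phi> z / z) \<longlongrightarrow> of_real (exp c)) at_infinity" by (rule LIM_zero_cancel)
  have "filterlim (\<lambda>z. \<phi> z / z * z) at_infinity at_infinity"
    by (rule tendsto_mult_filterlim_at_infinity[OF lim]) (auto simp: filterlim_ident)
  then show "filterlim \<phi> at_infinity at_infinity"
  proof (rule filterlim_mono_eventually[OF _ order_refl order_refl])
    show "\<forall>\<^sub>F z in at_infinity. \<phi> z / z * z = \<phi> z"
      using eventually_not_equal_at_infinity[of 0] by eventually_elim simp
  qed
qed

lemma exterior_map_inverse:
  assumes \<phi>: "exterior_map K c \<phi>"
  shows "inj_on \<phi> ext_disk" "\<phi> ` ext_disk = - K" "ext_inv \<phi> holomorphic_on - K"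
    "\<And>y. y \<notin> K \<Longrightarrow> \<phi> (ext_inv \<phi> y) = y" "\<And>y. y \<notin> K \<Longrightarrow> ext_inv \<phi> y \<in> ext_disk"
    "\<And>z. z \<in> ext_disk \<Longrightarrow> ext_inv \<phi> (\<phi> z) = z"
proof -
  have hol: "\<phi> holomorphic_on ext_disk" and bij: "bij_betw \<phi> ext_disk (- K)" using \<phi> by (auto simp: exterior_map_def)
  show inj: "inj_on \<phi> ext_disk" and img: "\<phi> ` ext_disk = - K" using bij by (auto simp: bij_betw_def)
  show inv: "ext_inv \<phi> (\<phi> z) = z" if "z \<in> ext_disk" for z by (rule inv_into_f_f[OF inj that])
  show "\<phi> (ext_inv \<phi> y) = y" "ext_inv \<phi> y \<in> ext_disk" if "y \<notin> K" for y
  proof -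
    have "y \<in> \<phi> ` ext_disk" using img that by simp
    then show "\<phi> (ext_inv \<phi> y) = y" "ext_inv \<phi> y \<in> ext_disk" by (rule f_inv_into_f, rule inv_into_into)
  qed
  obtain h where h: "h holomorphic_on \<phi> ` ext_disk" "\<And>z. z \<in> ext_disk \<Longrightarrow> h (\<phi> z) = z"
    using holomorphic_has_inverse[OF hol open_ext_disk inj] by metis
  have "h holomorphic_on - K" using h(1) img by simp
  then show "ext_inv \<phi> holomorphic_on - K"
  proof (rule holomorphic_transform)
    fix y assume "y \<in> - K"
    then obtain z where z: "z \<in> ext_disk" "y = \<phi> z" using img by blast
    then show "h y = ext_inv \<phi> y" using h(2) inv by simp
  qed
qed

text \<open>Schwarz's lemma and the Herglotz representation: the displacement of a conformal map of the outside of the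
  disk into itself is driven by a probability measure on the circle; the capacity is its size.\<close>

lemma univalent_outer_herglotz:
  assumes hol: "f holomorphic_on ext_disk" and into: "\<And>z. z \<in> ext_disk \<Longrightarrow> f z \<in> ext_disk"
    and lim: "((\<lambda>z. f z / z) \<longlongrightarrow> of_real (exp \<delta>)) at_infinity" and \<delta>: "0 < \<delta>"
  obtains \<nu> where "prob_space \<nu>" "sets \<nu> = sets circle_borel"
    "\<And>z. z \<in> ext_disk \<Longrightarrow> f z = z * exp (of_real \<delta> * outer_herglotz \<nu> z)"
proof -
  define q where "q = (\<lambda>u. if u = 0 then of_real (exp \<delta>) else u * f (1 / u))"
  have inv_ext: "1 / u \<in> ext_disk" if "u \<in> ball 0 1 - {0}" for u
    using that by (auto simp: ext_disk_iff norm_divide field_simps)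
  have "(\<lambda>u. 1 / u) ` (ball 0 1 - {0}) \<subseteq> ext_disk" using inv_ext by blast
  moreover have "(\<lambda>u::complex. 1 / u) holomorphic_on ball 0 1 - {0}" by (intro holomorphic_intros) auto
  ultimately have "f \<circ> (\<lambda>u. 1 / u) holomorphic_on ball 0 1 - {0}"
    by (intro holomorphic_on_compose_gen[OF _ hol])
  then have "(\<lambda>u. f (1 / u)) holomorphic_on ball 0 1 - {0}" by (simp add: o_def)
  then have "(\<lambda>u. u * f (1 / u)) holomorphic_on ball 0 1 - {0}" by (intro holomorphic_intros)
  then have qh0: "q holomorphic_on ball 0 1 - {0}" by (rule holomorphic_transform) (simp add: q_def)
  have "(q \<longlongrightarrow> q 0) (at 0)"
  proof -
    have "((\<lambda>u. f (inverse u) / inverse u) \<longlongrightarrow> of_real (exp \<delta>)) (at 0)"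
      by (rule filterlim_compose[OF lim filterlim_inverse_at_infinity])
    then show ?thesis
    proof (rule Lim_transform_eventually[THEN tendsto_eq_rhs])
      show "\<forall>\<^sub>F u in at 0. f (inverse u) / inverse u = q u"
        by (auto simp: eventually_at_filter q_def inverse_eq_divide)
      show "of_real (exp \<delta>) = q 0" by (simp add: q_def)
    qed
  qed
  then have q0c: "isCont q 0" by (simp add: isCont_def)
  have qc: "continuous_on (ball 0 1) q"
  proof (rule continuous_at_imp_continuous_on, rule ballI)
    fix u :: complex assume u: "u \<in> ball 0 1"
    show "isCont q u"
    proof (cases "u = 0")
      case False
      then show ?thesis using holomorphic_on_imp_continuous_on[OF qh0] u
        by (simp add: continuous_on_eq_continuous_at open_delete)
    qed (use q0c in simp)
  qed
  have q_holo: "q holomorphic_on ball 0 1"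
    by (rule no_isolated_singularity[OF qc qh0]) auto
  have q1: "1 < norm (f (1 / u))" if "u \<in> ball 0 1 - {0}" for u using into[OF inv_ext[OF that]] by (simp add: ext_disk_iff)
  have qnz: "q u \<noteq> 0" if "u \<in> ball 0 1" for u
    using q1[of u] that by (auto simp: q_def)
  have qge: "1 \<le> norm (q u)" if "norm u < 1" for u
  proof (cases "u = 0")
    case True
    then show ?thesis using \<delta> by (simp add: q_def)
  next
    case False
    define k where "k = (\<lambda>u. u / q u)"
    have kh: "k holomorphic_on ball 0 1" unfolding k_def using qnz by (intro holomorphic_intros q_holo) auto
    have "norm (k u) \<le> norm u"
    proof (rule Schwarz_Lemma(1)[OF kh])
      show "k 0 = 0" by (simp add: k_def)
      show "norm (k z) < 1" if "norm z < 1" for z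
      proof (cases "z = 0")
        case False
        have "1 < norm (f (1 / z))" using q1[of z] that False by simp
        moreover have "k z = 1 / f (1 / z)" using False by (simp add: k_def q_def)
        ultimately show ?thesis by (simp add: norm_divide divide_less_eq)
      qed (simp add: k_def)
    qed (use that in auto)
    then have "norm u / norm (q u) \<le> norm u" by (simp add: k_def norm_divide)
    moreover have "0 < norm (q u)" "0 < norm u" using qnz[of u] that False by auto
    ultimately show ?thesis by (simp add: divide_le_eq)
  qed
  obtain l where l: "l holomorphic_on ball 0 1" "\<And>u. u \<in> ball 0 1 \<Longrightarrow> q u = exp (l u)"
    using contractible_imp_holomorphic_log[OF q_holo convex_imp_contractible[OF convex_ball]] qnz by metis
  define p where "p = (\<lambda>u. (l u - (l 0 - of_real \<delta>)) / of_real \<delta>)"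
  have el0: "exp (l 0) = of_real (exp \<delta>)" using l(2)[of 0] by (simp add: q_def)
  have qp: "q u = exp (of_real \<delta> * p u)" if "norm u < 1" for u
  proof -
    have "of_real \<delta> * p u = l u - l 0 + of_real \<delta>" using \<delta> by (simp add: p_def)
    then have "exp (of_real \<delta> * p u) = exp (l u) / exp (l 0) * exp (of_real \<delta>)" by (simp add: exp_add exp_diff)
    also have "\<dots> = exp (l u)" unfolding el0 by (simp add: exp_of_real)
    finally show ?thesis using l(2)[of u] that by simp
  qed
  have "p holomorphic_on ball 0 1" unfolding p_def using \<delta> by (intro holomorphic_intros l) auto
  moreover have "0 \<le> Re (p u)" if "norm u < 1" for u
  proof -
    have "1 \<le> exp (\<delta> * Re (p u))" using qge[OF that] unfolding qp[OF that] by simp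
    then have "0 \<le> \<delta> * Re (p u)" by simp
    then show ?thesis using \<delta> by (simp add: zero_le_mult_iff)
  qed
  moreover have "p 0 = 1" using \<delta> by (simp add: p_def)
  ultimately obtain N where N: "prob_space N" "sets N = sets circle_borel"
    and pN: "\<And>u. norm u < 1 \<Longrightarrow> p u = (\<integral>\<xi>. (1 + \<xi> * u) / (1 - \<xi> * u) \<partial>N)"
    using herglotz_representation by blast
  show thesis
  proof (rule that[OF N])
    fix z assume z: "z \<in> ext_disk"
    define u where "u = 1 / z"
    have z0: "z \<noteq> 0" using z by (auto simp: ext_disk_iff)
    have u: "norm u < 1" "u \<noteq> 0" "1 / u = z" using z z0 by (auto simp: u_def ext_disk_iff norm_divide)
    have "p u = outer_herglotz N z" using pN[OF u(1)] outer_herglotz_inverse[OF u(2), of N] u(3) by simp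
    then have "q u = exp (of_real \<delta> * outer_herglotz N z)" using qp[OF u(1)] by simp
    moreover have "q u = f z / z" using u by (simp add: q_def) (simp add: u_def)
    ultimately show "f z = z * exp (of_real \<delta> * outer_herglotz N z)" using z0 by (simp add: field_simps)
  qed
qed

section \<open>The derivative of the Loewner chain\<close>

text \<open>The behaviour at infinity needs an argument, because the inverse of \<open>\<phi>\<close> might send points near infinity to the
  neighbourhood of the circle. This is excluded since \<open>\<phi>\<close> is bounded on bounded parts of the outside.\<close>

lemma transition_map:
  assumes t: "exterior_map K t \<phi>" and s: "exterior_map K' s \<phi>'" and sub: "K \<subseteq> K'"
  defines "f \<equiv> \<lambda>z. ext_inv \<phi> (\<phi>' z)"
  shows "f holomorphic_on ext_disk" "inj_on f ext_disk" "\<And>z. z \<in> ext_disk \<Longrightarrow> f z \<in> ext_disk"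
    "\<And>z. z \<in> ext_disk \<Longrightarrow> \<phi> (f z) = \<phi>' z"
    "filterlim f at_infinity at_infinity" "((\<lambda>z. f z / z) \<longlongrightarrow> of_real (exp (s - t))) at_infinity"
proof -
  note it = exterior_map_inverse[OF t] and is_s = exterior_map_inverse[OF s]
  have hol: "\<phi> holomorphic_on ext_disk" "\<phi>' holomorphic_on ext_disk" using t s by (auto simp: exterior_map_def)
  have out: "\<phi>' z \<notin> K" if "z \<in> ext_disk" for z using is_s(2) sub that by blast
  show fe: "f z \<in> ext_disk" if "z \<in> ext_disk" for z unfolding f_def by (rule it(5)[OF out[OF that]])
  show pf: "\<phi> (f z) = \<phi>' z" if "z \<in> ext_disk" for z unfolding f_def by (rule it(4)[OF out[OF that]])
  have "\<phi>' ` ext_disk \<subseteq> - K" using out by blast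
  from holomorphic_on_compose_gen[OF hol(2) it(3) this] show "f holomorphic_on ext_disk"
    by (simp add: f_def o_def)
  show "inj_on f ext_disk"
  proof (rule inj_onI)
    fix x y assume xy: "x \<in> ext_disk" "y \<in> ext_disk" "f x = f y"
    then have "\<phi>' x = \<phi>' y" using pf by metis
    then show "x = y" using inj_onD[OF is_s(1)] xy by blast
  qed
  note inft = exterior_map_asymptotics[OF t] and infs = exterior_map_asymptotics[OF s]
  have ev_ext: "\<forall>\<^sub>F z in at_infinity. z \<in> ext_disk"
    unfolding eventually_at_infinity ext_disk_iff by (intro exI[of _ 2]) auto
  show finf: "filterlim f at_infinity at_infinity"
    unfolding filterlim_at_infinity[OF order_refl]
  proof (intro allI impI)
    fix c :: real assume "0 < c"
    define \<sigma> where "\<sigma> = max c 2"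
    have \<sigma>: "1 < \<sigma>" "c \<le> \<sigma>" by (auto simp: \<sigma>_def)
    have "continuous_on (sphere 0 \<sigma>) \<phi>"
      using holomorphic_on_imp_continuous_on[OF hol(1)] by (rule continuous_on_subset) (use \<sigma> in \<open>auto simp: ext_disk_iff\<close>)
    then have "bounded (\<phi> ` sphere 0 \<sigma>)" by (intro compact_imp_bounded compact_continuous_image) auto
    then obtain B where B: "\<And>z. z \<in> sphere 0 \<sigma> \<Longrightarrow> norm (\<phi> z) \<le> B" unfolding bounded_iff by blast
    have inside: "norm (\<phi> v) \<le> B" if "1 < norm v" "norm v \<le> \<sigma>" for v
      by (rule exterior_bounded_inside[OF hol(1) it(1) inft(2) \<sigma>(1) _ that]) (use B in auto)
    have "\<forall>\<^sub>F z in at_infinity. max B 0 + 1 \<le> norm (\<phi>' z)"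
      using infs(2) unfolding filterlim_at_infinity[OF order_refl] by (simp add: add_nonneg_pos)
    then show "\<forall>\<^sub>F z in at_infinity. c \<le> norm (f z)"
      using ev_ext
    proof eventually_elim
      case (elim z)
      have "\<sigma> < norm (f z)"
      proof (rule ccontr)
        assume "\<not> \<sigma> < norm (f z)"
        then have "norm (\<phi> (f z)) \<le> B" using inside[of "f z"] fe[OF elim(2)] by (simp add: ext_disk_iff)
        then show False using elim pf[OF elim(2)] by simp
      qed
      then show ?case using \<sigma> by simp
    qed
  qed
  have "((\<lambda>z. \<phi> (f z) / f z) \<longlongrightarrow> of_real (exp t)) at_infinity"
    by (rule filterlim_compose[OF inft(1) finf])
  then have "((\<lambda>z. (\<phi>' z / z) / (\<phi> (f z) / f z)) \<longlongrightarrow> of_real (exp s) / of_real (exp t)) at_infinity"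
    by (intro tendsto_divide infs(1)) auto
  moreover have "\<forall>\<^sub>F z in at_infinity. (\<phi>' z / z) / (\<phi> (f z) / f z) = f z / z"
  proof -
    have "\<forall>\<^sub>F z in at_infinity. 1 \<le> norm (\<phi>' z)"
      using infs(2) unfolding filterlim_at_infinity[OF order_refl] by simp
    then show ?thesis using ev_ext
    proof eventually_elim
      case (elim z)
      have "\<phi>' z \<noteq> 0" "f z \<noteq> 0" "z \<noteq> 0" using elim fe[OF elim(2)] by (auto simp: ext_disk_iff)
      then show ?case unfolding pf[OF elim(2)] by (simp add: field_simps)
    qed
  qed
  ultimately have "((\<lambda>z. f z / z) \<longlongrightarrow> of_real (exp s) / of_real (exp t)) at_infinity"
    by (rule Lim_transform_eventually)
  then show "((\<lambda>z. f z / z) \<longlongrightarrow> of_real (exp (s - t))) at_infinity" by (simp add: exp_diff)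
qed

text \<open>Total invariance of the larger hull makes the conjugate of \<open>g\<close> on its outside defined as far as the one on the
  outside of the smaller hull; \<open>h\<close> continues it across the circle.\<close>

lemma conjugate_continuation:
  assumes t: "exterior_map (cball 0 1 \<union> At) t \<phi>" and s: "exterior_map (cball 0 1 \<union> As) s \<phi>'" 
    and sub: "cball 0 1 \<union> At \<subseteq> cball 0 1 \<union> As"
    and U: "open U" "g holomorphic_on U" and inv: "U \<inter> g -` As = As"
    and R: "1 < R" "\<And>z. z \<in> open_annulus R \<Longrightarrow> \<phi> z \<in> U \<and> g (\<phi> z) \<in> \<phi> ` ext_disk \<and> G z = ext_inv \<phi> (g (\<phi> z))"
    and h: "h analytic_on sphere 0 1" "bij_betw h (sphere 0 1) (sphere 0 1)"
    and R': "1 < R'" "\<And>z. z \<in> open_annulus R' \<Longrightarrow> h z = ext_inv \<phi>' (g (\<phi>' z))"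
    and r: "1 < r" "r < r'" and small: "\<And>z. z \<in> open_annulus r' \<Longrightarrow> norm (ext_inv \<phi> (\<phi>' z)) < R"
  defines "F \<equiv> \<lambda>z. if norm z \<le> 1 then h z else ext_inv \<phi>' (g (\<phi>' z))"
  shows "continuous_on (closed_annulus r) F" "F holomorphic_on open_annulus r"
    "\<And>w. norm w = 1 \<Longrightarrow> norm (F w) = 1" "\<And>w. 1 < norm w \<Longrightarrow> norm w \<le> r \<Longrightarrow> 1 < norm (F w)"
    "\<And>w. 1 < norm w \<Longrightarrow> norm w \<le> r \<Longrightarrow> ext_inv \<phi> (\<phi>' (F w)) = G (ext_inv \<phi> (\<phi>' w))"
proof -
  note it = exterior_map_inverse[OF t] and is_s = exterior_map_inverse[OF s]
  note tr = transition_map[OF t s sub]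
  have hol: "\<phi>' holomorphic_on ext_disk" using s by (simp add: exterior_map_def)
  have key: "\<phi>' z \<in> U \<and> g (\<phi>' z) \<notin> cball 0 1 \<union> As \<and> ext_inv \<phi> (g (\<phi>' z)) = G (ext_inv \<phi> (\<phi>' z))"
    if z: "z \<in> open_annulus r'" for z
  proof -
    have ze: "z \<in> ext_disk" using z by (simp add: open_annulus_def ext_disk_iff)
    let ?f = "ext_inv \<phi> (\<phi>' z)"
    have "?f \<in> open_annulus R" using small[OF z] tr(3)[OF ze] by (simp add: open_annulus_def ext_disk_iff)
    from R(2)[OF this] have *: "\<phi>' z \<in> U" "g (\<phi>' z) \<in> \<phi> ` ext_disk" "G ?f = ext_inv \<phi> (g (\<phi>' z))"
      unfolding tr(4)[OF ze] by auto
    have "g (\<phi>' z) \<notin> cball 0 1" using *(2) it(2) by blast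
    moreover have "g (\<phi>' z) \<notin> As"
    proof
      assume "g (\<phi>' z) \<in> As"
      then have "\<phi>' z \<in> As" using *(1) inv by blast
      then show False using is_s(2) ze by blast
    qed
    ultimately show ?thesis using * by auto
  qed
  have holF': "(\<lambda>z. ext_inv \<phi>' (g (\<phi>' z))) holomorphic_on open_annulus r'"
  proof -
    have sub1: "open_annulus r' \<subseteq> ext_disk" by (auto simp: open_annulus_def ext_disk_iff)
    have "g \<circ> \<phi>' holomorphic_on open_annulus r'"
      by (rule holomorphic_on_compose_gen[OF holomorphic_on_subset[OF hol sub1] U(2)]) (use key in blast)
    moreover have "(g \<circ> \<phi>') ` open_annulus r' \<subseteq> - (cball 0 1 \<union> As)" using key unfolding o_def by blast
    ultimately have "ext_inv \<phi>' \<circ> (g \<circ> \<phi>') holomorphic_on open_annulus r'"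
      by (rule holomorphic_on_compose_gen[OF _ is_s(3)])
    then show ?thesis by (simp only: o_def)
  qed
  have holF: "F holomorphic_on open_annulus r'"
    using holF' by (rule holomorphic_transform) (simp add: F_def open_annulus_def)
  then show "F holomorphic_on open_annulus r"
    by (rule holomorphic_on_subset) (use r in \<open>auto simp: open_annulus_def\<close>)
  show "norm (F w) = 1" if "norm w = 1" for w using bij_betwE[OF h(2)] that by (auto simp: F_def)
  have Fw: "F w = ext_inv \<phi>' (g (\<phi>' w))" "w \<in> open_annulus r'" "w \<in> ext_disk" if "1 < norm w" "norm w \<le> r" for w
    using that r by (auto simp: F_def open_annulus_def ext_disk_iff)
  show "1 < norm (F w)" if "1 < norm w" "norm w \<le> r" for w
    using is_s(5)[of "g (\<phi>' w)"] key[OF Fw(2)[OF that]] unfolding Fw(1)[OF that] by (simp add: ext_disk_iff)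
  show "ext_inv \<phi> (\<phi>' (F w)) = G (ext_inv \<phi> (\<phi>' w))" if "1 < norm w" "norm w \<le> r" for w
    using is_s(4)[of "g (\<phi>' w)"] key[OF Fw(2)[OF that]] unfolding Fw(1)[OF that] by simp
  show "continuous_on (closed_annulus r) F"
  proof (rule continuous_on_eq_continuous_within[THEN iffD2], rule ballI)
    fix w assume w: "w \<in> closed_annulus r"
    show "continuous (at w within closed_annulus r) F"
    proof (cases "norm w = 1")
      case False
      then have "w \<in> open_annulus r'" using w r by (auto simp: open_annulus_def closed_annulus_def)
      then have "isCont F w" using holomorphic_on_imp_continuous_on[OF holF] open_open_annulus continuous_on_eq_continuous_at by blast
      then show ?thesis by (rule continuous_at_imp_continuous_at_within)
    next
      case True
      have "isCont h w"
        using analytic_on_imp_differentiable_at[OF h(1), of w] True field_differentiable_imp_continuous_at by simp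
      then have c: "continuous (at w within closed_annulus r) h" by (rule continuous_at_imp_continuous_at_within)
      show ?thesis
      proof (rule continuous_transform_within[OF c, of "R' - 1"])
        fix y assume y: "y \<in> closed_annulus r" "dist y w < R' - 1"
        have "norm y < R'" using y(2) norm_triangle_ineq2[of y w] True by (simp add: dist_norm)
        then show "h y = F y" using R'(2)[of y] y(1) by (auto simp: F_def open_annulus_def)
      qed (use R' w in auto)
    qed
  qed
qed

lemma exp_difference_quotient:
  fixes d :: "nat \<Rightarrow> real" and p z :: "nat \<Rightarrow> complex"
  assumes d: "\<And>n. 0 < d n" "d \<longlonglongrightarrow> 0" and p: "p \<longlonglongrightarrow> l" and z: "z \<longlonglongrightarrow> a"
  shows "(\<lambda>n. (z n * exp (d n * p n) - z n) / d n) \<longlonglongrightarrow> a * l"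
proof -
  have "((exp :: complex \<Rightarrow> complex) has_field_derivative exp 0) (at 0)" by (rule DERIV_exp)
  then obtain E where E: "\<And>z::complex. exp z - exp 0 = E z * (z - 0)" "isCont E 0" "E 0 = exp 0"
    unfolding CARAT_DERIV by blast
  have "(\<lambda>n. complex_of_real (d n) * p n) \<longlonglongrightarrow> of_real 0 * l" by (intro tendsto_intros d p)
  then have "(\<lambda>n. complex_of_real (d n) * p n) \<longlonglongrightarrow> 0" by simp
  then have "(\<lambda>n. E (d n * p n)) \<longlonglongrightarrow> E 0" by (rule isCont_tendsto_compose[OF E(2)])
  then have "(\<lambda>n. z n * (E (d n * p n) * p n)) \<longlonglongrightarrow> a * (E 0 * l)" by (intro tendsto_intros z p)
  moreover have "z n * (E (d n * p n) * p n) = (z n * exp (d n * p n) - z n) / d n" for n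
  proof -
    have "z n * exp (d n * p n) - z n = z n * (exp (d n * p n) - exp 0)" by (simp add: algebra_simps)
    also have "\<dots> = z n * (E (d n * p n) * (d n * p n))" unfolding E(1) by simp
    finally show ?thesis using d(1)[of n] by simp
  qed
  ultimately show ?thesis using E(3) by simp
qed

theorem theorem1p1:
  fixes \<alpha> \<epsilon> :: real and g :: "complex \<Rightarrow> complex" and U :: "complex set"
    and A :: "real \<Rightarrow> complex set" and \<phi> gt :: "real \<Rightarrow> complex \<Rightarrow> complex"
  assumes "\<alpha> \<notin> \<rat>" and "g \<in> Diff_omega \<alpha>"
    and "open U" and "sphere 0 1 \<subseteq> U" and "g holomorphic_on U" and "inj_on g U"
    and "0 < \<epsilon>" and "herman_family U g \<epsilon> A"
    and "loewner_chain \<epsilon> A \<phi>"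
    and "\<And>t. t \<in> {0..<\<epsilon>} \<Longrightarrow> semigroup_image \<alpha> U g (\<phi> t) (gt t)"
  shows "\<forall>t\<in>{0..<\<epsilon>}. \<forall>K. compact K \<and> K \<subseteq> ext_disk \<longrightarrow>
    uniform_limit K
      (\<lambda>s z. (ext_inv (\<phi> t) (\<phi> s z) - z) / of_real (s - t))
      (\<lambda>z. z * herglotz (conj_pullback (conformal_measure 2 (gt t))) z)
      (at_right t)"
proof (intro ballI allI impI, elim conjE)
  fix t K assume t: "t \<in> {0..<\<epsilon>}" and K: "compact K" "K \<subseteq> ext_disk"
  have chain: "exterior_map (cball 0 1 \<union> A s) s (\<phi> s)" if "s \<in> {0..<\<epsilon>}" for s
    using assms(9) that by (simp add: loewner_chain_def)
  have nested: "cball 0 1 \<union> A t \<subseteq> cball 0 1 \<union> A s" if "t < s" "s < \<epsilon>" for s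
  proof -
    have "A t \<subset> A s" using assms(8) t that unfolding herman_family_def by (intro strict_mono_onD[of "{0..<\<epsilon>}" A]) auto
    then show ?thesis by blast
  qed
  have inv: "U \<inter> g -` A s = A s" if "s \<in> {0..<\<epsilon>}" for s
    using assms(8) that by (auto simp: herman_family_def herman_compact_def)
  define G where "G = gt t"
  have GD: "G \<in> Diff_omega \<alpha>" using assms(10)[OF t] by (simp add: semigroup_image_def G_def)
  obtain R where RR: "1 < R" "\<And>z. z \<in> open_annulus R \<Longrightarrow> 
      \<phi> t z \<in> U \<and> g (\<phi> t z) \<in> \<phi> t ` ext_disk \<and> G z = ext_inv (\<phi> t) (g (\<phi> t z))"
    using assms(10)[OF t] unfolding semigroup_image_def G_def open_annulus_def by auto
  note it = exterior_map_inverse[OF chain[OF t]]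
  have hol_t: "\<phi> t holomorphic_on ext_disk" using chain[OF t] by (simp add: exterior_map_def)
  interpret outer_diffeo G R
  proof
    show "1 < R" by (rule RR)
    show "G analytic_on sphere 0 1" "bij_betw G (sphere 0 1) (sphere 0 1)" "\<And>\<xi>. \<xi> \<in> sphere 0 1 \<Longrightarrow> deriv G \<xi> \<noteq> 0"
      using GD by (auto simp: Diff_omega_def)
    show "angular_deriv G \<xi> = of_real (norm (deriv G \<xi>))" if "\<xi> \<in> sphere 0 1" for \<xi>
      by (rule Diff_omega_lift(2)[OF GD assms(1) that])
    show "1 < norm (G z)" if "z \<in> open_annulus R" for z
      using RR(2)[OF that] it(2) it(5)[of "g (\<phi> t z)"] by (auto simp: ext_disk_iff)
    have "open_annulus R \<subseteq> ext_disk" by (auto simp: open_annulus_def ext_disk_iff)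
    then have "g \<circ> \<phi> t holomorphic_on open_annulus R"
      using RR(2) by (intro holomorphic_on_compose_gen[OF holomorphic_on_subset[OF hol_t] assms(5)]) auto
    moreover have "(g \<circ> \<phi> t) ` open_annulus R \<subseteq> - (cball 0 1 \<union> A t)"
      using RR(2) unfolding it(2) o_def by blast
    ultimately have "ext_inv (\<phi> t) \<circ> (g \<circ> \<phi> t) holomorphic_on open_annulus R"
      by (rule holomorphic_on_compose_gen[OF _ it(3)])
    then have "(\<lambda>z. ext_inv (\<phi> t) (g (\<phi> t z))) holomorphic_on open_annulus R" by (simp only: o_def)
    then show "G holomorphic_on open_annulus R" by (rule holomorphic_transform) (use RR(2) in auto)
  qed
  define T where "T = (\<lambda>s z. ext_inv (\<phi> t) (\<phi> s z))"
  have Ts: "T s = (\<lambda>z. ext_inv (\<phi> t) (\<phi> s z))" for s by (simp add: T_def)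
  have "\<exists>\<nu>. prob_space \<nu> \<and> sets \<nu> = sets circle_borel \<and> 
      (\<forall>z\<in>ext_disk. T s z = z * exp (of_real (s - t) * outer_herglotz \<nu> z))" if s: "t < s" "s < \<epsilon>" for s
  proof -
    have s': "s \<in> {0..<\<epsilon>}" using s t by simp
    note tr = transition_map[OF chain[OF t] chain[OF s'] nested[OF s]]
    show ?thesis
      by (rule univalent_outer_herglotz[OF tr(1,3,6)]) (use s in \<open>auto simp: T_def\<close>)
  qed
  then obtain N where N: "\<And>s. t < s \<Longrightarrow> s < \<epsilon> \<Longrightarrow> prob_space (N s)" "\<And>s. t < s \<Longrightarrow> s < \<epsilon> \<Longrightarrow> sets (N s) = sets circle_borel"
    and TN: "\<And>s z. t < s \<Longrightarrow> s < \<epsilon> \<Longrightarrow> z \<in> ext_disk \<Longrightarrow> T s z = z * exp (of_real (s - t) * outer_herglotz (N s) z)"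
    by metis
  have T_le: "norm (T s v) \<le> \<sigma> * exp ((s - t) * ((\<sigma> + 1) / (\<sigma> - 1)))"
    if s: "t < s" "s < \<epsilon>" and v: "1 < norm v" "norm v \<le> \<sigma>" for s v \<sigma>
  proof -
    have s': "s \<in> {0..<\<epsilon>}" using s t by simp
    note tr = transition_map[OF chain[OF t] chain[OF s'] nested[OF s], folded Ts]
    have \<sigma>: "1 < \<sigma>" using v by simp
    show ?thesis
    proof (rule exterior_bounded_inside[OF tr(1,2,5) \<sigma> _ v])
      fix z :: complex assume z: "norm z = \<sigma>"
      have "norm (T s z) = \<sigma> * exp (Re (of_real (s - t) * outer_herglotz (N s) z))"
        using TN[OF s, of z] z \<sigma> by (simp add: norm_mult ext_disk_iff)
      also have "Re (of_real (s - t) * outer_herglotz (N s) z) = (s - t) * Re (outer_herglotz (N s) z)" by (rule Re_of_real_mult)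
      also have "\<sigma> * exp \<dots> \<le> \<sigma> * exp ((s - t) * ((\<sigma> + 1) / (\<sigma> - 1)))"
      proof -
        have "Re (outer_herglotz (N s) z) \<le> (\<sigma> + 1) / (\<sigma> - 1)"
          using outer_herglotz_norm_le[OF N[OF s], of z] complex_Re_le_cmod[of "outer_herglotz (N s) z"] z \<sigma> by simp
        then have "(s - t) * Re (outer_herglotz (N s) z) \<le> (s - t) * ((\<sigma> + 1) / (\<sigma> - 1))" using s by (intro mult_left_mono) auto
        then show ?thesis using \<sigma> by (intro mult_left_mono) auto
      qed
      finally show "norm (T s z) \<le> \<sigma> * exp ((s - t) * ((\<sigma> + 1) / (\<sigma> - 1)))" .
    qed
  qed
  \<comment> \<open>The conjugated maps are holomorphic up to radius \<open>r'\<close>, hence continuous up to the outer circle of radius \<open>r\<close>.\<close>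
  define r where "r = (2 + R) / 3"
  define r' where "r' = (1 + 2 * R) / 3"
  have r: "1 < r" "r < r'" "r' < R" using RR(1) by (auto simp: r_def r'_def)
  obtain \<eta> where \<eta>: "0 < \<eta>" "t + \<eta> \<le> \<epsilon>" "\<And>s. t < s \<Longrightarrow> s < t + \<eta> \<Longrightarrow> r' * exp ((s - t) * ((r' + 1) / (r' - 1))) < R"
  proof -
    have "((\<lambda>s. r' * exp ((s - t) * ((r' + 1) / (r' - 1)))) \<longlongrightarrow> r' * exp ((t - t) * ((r' + 1) / (r' - 1)))) (at_right t)"
      by (intro tendsto_intros)
    then have "\<forall>\<^sub>F s in at_right t. r' * exp ((s - t) * ((r' + 1) / (r' - 1))) < R"
      by (rule order_tendstoD(2)) (use r in simp)
    then obtain b where b: "t < b" "\<And>s. t < s \<Longrightarrow> s < b \<Longrightarrow> r' * exp ((s - t) * ((r' + 1) / (r' - 1))) < R"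
      unfolding eventually_at_right_field by blast
    show ?thesis
      by (rule that[of "min (b - t) (\<epsilon> - t)"]) (use b t in auto)
  qed
  \<comment> \<open>Every weak limit of the driving measures is a conformal measure.\<close>
  have limit: "\<exists>\<rho> \<mu>. strict_mono (\<rho> :: nat \<Rightarrow> nat) \<and> is_conformal_measure 2 G \<mu> \<and>
      (\<forall>z. 1 < norm z \<longrightarrow> (\<lambda>n. outer_herglotz (N (s (\<rho> n))) z) \<longlonglongrightarrow> outer_herglotz \<mu> z)"
    if s: "\<And>n. t < s n" "\<And>n. s n < t + \<eta>" and slim: "s \<longlonglongrightarrow> t" for s :: "nat \<Rightarrow> real"
  proof -
    have s\<epsilon>: "s n < \<epsilon>" for n using s(2)[of n] \<eta>(2) by linarith
    have s': "s n \<in> {0..<\<epsilon>}" for n using s(1)[of n] s\<epsilon>[of n] t by simp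
    obtain \<rho> \<mu> where \<rho>: "strict_mono (\<rho> :: nat \<Rightarrow> nat)" and \<mu>: "prob_space \<mu>" "sets \<mu> = sets circle_borel"
      and weak: "\<And>f :: complex \<Rightarrow> complex. continuous_on (sphere 0 1) f \<Longrightarrow> (\<lambda>n. integral\<^sup>L (N (s (\<rho> n))) f) \<longlonglongrightarrow> integral\<^sup>L \<mu> f"
    proof (rule circle_weak_compactness[of "\<lambda>n. N (s n)"])
      fix \<rho> \<mu> assume a: "strict_mono (\<rho> :: nat \<Rightarrow> nat)" "prob_space \<mu>" "sets \<mu> = sets circle_borel"
        "\<And>f :: complex \<Rightarrow> complex. continuous_on (sphere 0 1) f \<Longrightarrow> (\<lambda>n. integral\<^sup>L (N (s (\<rho> n))) f) \<longlonglongrightarrow> integral\<^sup>L \<mu> f"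
      show thesis by (rule that[OF a])
    qed (use N s(1) s\<epsilon> in auto)
    have conv: "(\<lambda>n. outer_herglotz (N (s (\<rho> n))) z) \<longlonglongrightarrow> outer_herglotz \<mu> z" if "1 < norm z" for z
      unfolding outer_herglotz_def by (rule weak[OF outer_kernel_cont[OF that]])
    define F where "F = (\<lambda>n z. if norm z \<le> 1 then gt (s n) z else ext_inv (\<phi> (s n)) (g (\<phi> (s n) z)))"
    have FF: "continuous_on (closed_annulus r) (F n)" "F n holomorphic_on open_annulus r"
      "\<And>w. norm w = 1 \<Longrightarrow> norm (F n w) = 1" "\<And>w. 1 < norm w \<Longrightarrow> norm w \<le> r \<Longrightarrow> 1 < norm (F n w)"
      "\<And>w. 1 < norm w \<Longrightarrow> norm w \<le> r \<Longrightarrow> T (s n) (F n w) = G (T (s n) w)" for n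
    proof -
      obtain R' where R': "1 < R'" "\<And>z. z \<in> open_annulus R' \<Longrightarrow> gt (s n) z = ext_inv (\<phi> (s n)) (g (\<phi> (s n) z))"
        using assms(10)[OF s'[of n]] unfolding semigroup_image_def open_annulus_def by auto
      have h: "gt (s n) analytic_on sphere 0 1" "bij_betw (gt (s n)) (sphere 0 1) (sphere 0 1)"
        using assms(10)[OF s'[of n]] by (auto simp: semigroup_image_def Diff_omega_def)
      have small: "norm (ext_inv (\<phi> t) (\<phi> (s n) z)) < R" if "z \<in> open_annulus r'" for z
        using T_le[OF s(1) s\<epsilon>, of z r' n] \<eta>(3)[OF s(1)[of n] s(2)[of n]] that by (auto simp: T_def open_annulus_def)
      note cc = conjugate_continuation[OF chain[OF t] chain[OF s'[of n]] nested[OF s(1) s\<epsilon>] assms(3,5) inv[OF s'[of n]]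
          RR h R' r(1,2) small]
      show "continuous_on (closed_annulus r) (F n)" unfolding F_def by (rule cc(1))
      show "F n holomorphic_on open_annulus r" unfolding F_def by (rule cc(2))
      show "norm (F n w) = 1" if "norm w = 1" for w unfolding F_def by (rule cc(3)) (use that in auto)
      show "1 < norm (F n w)" if "1 < norm w" "norm w \<le> r" for w unfolding F_def by (rule cc(4)) (use that in auto)
      show "T (s n) (F n w) = G (T (s n) w)" if "1 < norm w" "norm w \<le> r" for w
        unfolding F_def T_def by (rule cc(5)) (use that in auto)
    qed
    define d where "d = (\<lambda>n. s (\<rho> n) - t)"
    define \<nu> where "\<nu> = (\<lambda>n. N (s (\<rho> n)))"
    let ?f = "\<lambda>n w. w * exp (of_real (d n) * outer_herglotz (\<nu> n) w)"
    have fT: "?f n w = T (s (\<rho> n)) w" if "1 < norm w" for n w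
      using TN[OF s(1) s\<epsilon>, of w] that by (simp add: d_def \<nu>_def ext_disk_iff)
    have d_lim: "d \<longlonglongrightarrow> 0"
      using LIMSEQ_subseq_LIMSEQ[OF slim \<rho>] unfolding d_def o_def by (rule LIM_zero)
    have "infinitesimal_conjugacy G R d \<nu> \<mu> (\<lambda>n. F (\<rho> n)) r"
    proof (rule infinitesimal_conjugacy.intro[OF outer_diffeo_axioms], rule infinitesimal_conjugacy_axioms.intro)
      show "0 < d n" for n using s(1) by (simp add: d_def)
      show "prob_space (\<nu> n)" "sets (\<nu> n) = sets circle_borel" for n using N s(1) s\<epsilon> by (auto simp: \<nu>_def)
      show "(\<lambda>n. outer_herglotz (\<nu> n) z) \<longlonglongrightarrow> outer_herglotz \<mu> z" if "1 < norm z" for z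
        unfolding \<nu>_def by (rule conv[OF that])
      show "norm (?f n v) \<le> \<sigma> * exp (d n * ((\<sigma> + 1) / (\<sigma> - 1)))" if "1 < norm v" "norm v \<le> \<sigma>" for n \<sigma> v
      proof -
        have "norm (T (s (\<rho> n)) v) \<le> \<sigma> * exp (d n * ((\<sigma> + 1) / (\<sigma> - 1)))"
          unfolding d_def by (rule T_le[OF s(1) s\<epsilon> that])
        then show ?thesis by (simp only: fT[OF that(1)])
      qed
      show "1 < r" "r < R" using r by auto
      show "?f n (F (\<rho> n) w) = G (?f n w)" if "1 < norm w" "norm w \<le> r" for n w
        using FF(5)[OF that] by (simp only: fT[OF that(1)] fT[OF FF(4)[OF that]])
    qed (use FF d_lim \<mu> in auto)
    note estimate = infinitesimal_conjugacy.velocity_boundary_estimate[OF this]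
    obtain c where "\<And>w. w \<in> open_annulus r \<Longrightarrow> \<bar>Re (angular_deriv G w * outer_herglotz \<mu> w) - Re (outer_herglotz \<mu> (G w))\<bar> \<le> c * ln (norm w)"
      using estimate by blast
    then have "is_conformal_measure 2 G \<mu>"
      using r by (intro conformal_of_boundary_estimate[OF \<mu>, of r]) auto
    then show ?thesis using \<rho> conv by blast
  qed
  \<comment> \<open>Uniqueness makes the description of the conformal measure pick out any limit that has been found.\<close>
  have uniq: "conformal_measure 2 G = \<mu>" if "is_conformal_measure 2 G \<mu>" for \<mu>
  proof -
    obtain L w l where "lifted_diffeo L \<alpha> G w l" using Diff_omega_lift(1)[OF GD assms(1)] by blast
    then interpret lifted_diffeo L \<alpha> G w l .
    show ?thesis unfolding conformal_measure_def
    proof (rule the_equality)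
      show "is_conformal_measure 2 G \<mu>" by (rule that)
      show "\<mu>' = \<mu>" if "is_conformal_measure 2 G \<mu>'" for \<mu>'
        by (rule conformal_measure_unique[OF that \<open>is_conformal_measure 2 G \<mu>\<close>]) simp
    qed
  qed
  show "uniform_limit K (\<lambda>s z. (ext_inv (\<phi> t) (\<phi> s z) - z) / of_real (s - t))
      (\<lambda>z. z * herglotz (conj_pullback (conformal_measure 2 (gt t))) z) (at_right t)"
    unfolding uniform_limit_iff
  proof (intro allI impI, rule ccontr)
    fix e :: real assume e: "0 < e"
    let ?Q = "\<lambda>s z. (ext_inv (\<phi> t) (\<phi> s z) - z) / of_real (s - t)"
    let ?H = "\<lambda>z. z * herglotz (conj_pullback (conformal_measure 2 (gt t))) z"
    assume neg: "\<not> (\<forall>\<^sub>F s in at_right t. \<forall>z\<in>K. dist (?Q s z) (?H z) < e)"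
    have "\<exists>s z. t < s \<and> s < t + \<eta> / real (Suc n) \<and> z \<in> K \<and> e \<le> dist (?Q s z) (?H z)" for n
    proof -
      have "t < t + \<eta> / real (Suc n)" using \<eta>(1) by simp
      then show ?thesis using neg unfolding eventually_at_right_field by (meson not_less)
    qed
    then obtain s z where s: "\<And>n. t < s n" "\<And>n. s n < t + \<eta> / real (Suc n)" 
      and zK: "\<And>n. z n \<in> K" and far: "\<And>n. e \<le> dist (?Q (s n) (z n)) (?H (z n))" by metis
    have s\<eta>: "s n < t + \<eta>" for n
    proof -
      have "\<eta> / real (Suc n) \<le> \<eta> / 1" by (rule divide_left_mono) (use \<eta>(1) in auto)
      then show ?thesis using s(2)[of n] by simp
    qed
    have slim: "s \<longlonglongrightarrow> t"
    proof (rule tendsto_sandwich[of "\<lambda>_. t" s sequentially "\<lambda>n. t + \<eta> / real (Suc n)"])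
      have "(\<lambda>n. t + \<eta> / real (Suc n)) \<longlonglongrightarrow> t + 0"
        by (intro tendsto_intros LIMSEQ_Suc lim_const_over_n)
      then show "(\<lambda>n. t + \<eta> / real (Suc n)) \<longlonglongrightarrow> t" by simp
    qed (use s in \<open>auto simp: less_imp_le\<close>)
    obtain r1 a where r1: "strict_mono (r1 :: nat \<Rightarrow> nat)" and a: "a \<in> K" and za: "(z \<circ> r1) \<longlonglongrightarrow> a"
      using K(1) zK unfolding compact_def by metis
    have "(\<lambda>n. s (r1 n)) \<longlonglongrightarrow> t" using LIMSEQ_subseq_LIMSEQ[OF slim r1] by (simp add: o_def)
    from limit[OF s(1) s\<eta> this] obtain r2 \<mu> where r2: "strict_mono (r2 :: nat \<Rightarrow> nat)" and \<mu>: "is_conformal_measure 2 G \<mu>"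
      and conv: "\<And>z. 1 < norm z \<Longrightarrow> (\<lambda>n. outer_herglotz (N (s (r1 (r2 n)))) z) \<longlonglongrightarrow> outer_herglotz \<mu> z" by blast
    have \<mu>p: "prob_space \<mu>" "sets \<mu> = sets circle_borel" using \<mu> by (auto simp: is_conformal_measure_def)
    define S where "S = (\<lambda>n. s (r1 (r2 n)))"
    define Z where "Z = (\<lambda>n. z (r1 (r2 n)))"
    have SN: "prob_space (N (S n))" "sets (N (S n)) = sets circle_borel" and St: "t < S n" "S n < \<epsilon>" for n
    proof -
      show St: "t < S n" "S n < \<epsilon>" using s(1) s\<eta>[of "r1 (r2 n)"] \<eta>(2) by (auto simp: S_def)
      show "prob_space (N (S n))" "sets (N (S n)) = sets circle_borel" using N[OF St] by auto
    qed
    have Zlim: "Z \<longlonglongrightarrow> a" using LIMSEQ_subseq_LIMSEQ[OF za r2] by (simp add: Z_def o_def)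
    have Slim: "(\<lambda>n. S n - t) \<longlonglongrightarrow> 0"
      using LIMSEQ_subseq_LIMSEQ[OF LIMSEQ_subseq_LIMSEQ[OF slim r1] r2] unfolding S_def o_def by (rule LIM_zero)
    have "K \<noteq> {}" using a by blast
    then obtain k where k: "k \<in> K" "\<And>y. y \<in> K \<Longrightarrow> norm k \<le> norm y"
      using continuous_attains_inf[OF K(1), of norm] continuous_on_norm_id by blast
    define \<sigma> where "\<sigma> = norm k"
    have \<sigma>: "1 < \<sigma>" using k(1) K(2) by (auto simp: \<sigma>_def ext_disk_iff)
    have Z\<sigma>: "\<sigma> \<le> norm (Z n)" "\<sigma> \<le> norm a" for n using k(2) zK a by (auto simp: \<sigma>_def Z_def)
    have a1: "1 < norm a" using \<sigma> Z\<sigma> by linarith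
    have transfer: "(\<lambda>n. outer_herglotz (M n) (Z n)) \<longlonglongrightarrow> outer_herglotz \<mu> a"
      if M: "\<And>n. prob_space (M n)" "\<And>n. sets (M n) = sets circle_borel" 
        and Mc: "(\<lambda>n. outer_herglotz (M n) a) \<longlonglongrightarrow> outer_herglotz \<mu> a" for M
    proof -
      have "(\<lambda>n. outer_herglotz (M n) (Z n) - outer_herglotz (M n) a) \<longlonglongrightarrow> 0"
      proof (rule Lim_null_comparison)
        show "\<forall>\<^sub>F n in sequentially. norm (outer_herglotz (M n) (Z n) - outer_herglotz (M n) a) \<le> 2 / (\<sigma> - 1)\<^sup>2 * norm (Z n - a)"
          by (intro always_eventually allI outer_herglotz_lipschitz M Z\<sigma> \<sigma>)
        have "(\<lambda>n. 2 / (\<sigma> - 1)\<^sup>2 * norm (Z n - a)) \<longlonglongrightarrow> 2 / (\<sigma> - 1)\<^sup>2 * norm (a - a)"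
          by (intro tendsto_intros Zlim)
        then show "(\<lambda>n. 2 / (\<sigma> - 1)\<^sup>2 * norm (Z n - a)) \<longlonglongrightarrow> 0" by simp
      qed
      from tendsto_add[OF this Mc] show ?thesis by simp
    qed
    have "(\<lambda>n. outer_herglotz (N (S n)) (Z n)) \<longlonglongrightarrow> outer_herglotz \<mu> a"
      by (rule transfer[OF SN]) (use conv[OF a1] in \<open>simp add: S_def\<close>)
    from exp_difference_quotient[OF _ Slim this Zlim]
    have "(\<lambda>n. (Z n * exp (of_real (S n - t) * outer_herglotz (N (S n)) (Z n)) - Z n) / of_real (S n - t)) \<longlonglongrightarrow> a * outer_herglotz \<mu> a"
      using St(1) by simp
    moreover have "?Q (S n) (Z n) = (Z n * exp (of_real (S n - t) * outer_herglotz (N (S n)) (Z n)) - Z n) / of_real (S n - t)" for n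
    proof -
      have "Z n \<in> ext_disk" using Z\<sigma>(1)[of n] \<sigma> by (simp add: ext_disk_iff)
      from TN[OF St this] show ?thesis by (simp add: T_def)
    qed
    ultimately have lim1: "(\<lambda>n. ?Q (S n) (Z n)) \<longlonglongrightarrow> a * outer_herglotz \<mu> a" by (simp only:)
    have "(\<lambda>n. Z n * outer_herglotz \<mu> (Z n)) \<longlonglongrightarrow> a * outer_herglotz \<mu> a"
      by (intro tendsto_intros Zlim transfer \<mu>p)
    moreover have "?H (Z n) = Z n * outer_herglotz \<mu> (Z n)" for n
    proof -
      have "1 < norm (Z n)" using Z\<sigma>(1)[of n] \<sigma> by simp
      then show ?thesis using herglotz_conj_pullback[OF \<mu>p(2)] uniq[OF \<mu>] by (simp add: G_def)
    qed
    ultimately have lim2: "(\<lambda>n. ?H (Z n)) \<longlonglongrightarrow> a * outer_herglotz \<mu> a" by (simp only:)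
    have "(\<lambda>n. dist (?Q (S n) (Z n)) (?H (Z n))) \<longlonglongrightarrow> dist (a * outer_herglotz \<mu> a) (a * outer_herglotz \<mu> a)"
      by (rule tendsto_dist[OF lim1 lim2])
    then have "e \<le> dist (a * outer_herglotz \<mu> a) (a * outer_herglotz \<mu> a)"
      by (rule LIMSEQ_le_const) (use far in \<open>auto simp: S_def Z_def\<close>)
    then show False using e by simp
  qed
qed

end
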